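(* Let $a,b\in\mathbb{Z}$ with $ab\neq 0$ be such that $F(x)=x^9+ax+b$ is irreducible over $\mathbb{Q}$, let $\theta$ be a complex root of $F(x)$ and $K=\mathbb{Q}(\theta)$. If $p\geq 5$ is a rational prime, then $p$ is not a common index divisor of $K$, i.e. $p\nmid i(K)$.
   Context: The index of $K$ is $i(K)=\gcd\{(\mathbb{Z}_K:\mathbb{Z}[\eta]) : \eta\in\mathbb{Z}_K,\ K=\mathbb{Q}(\eta)\}$, where $\mathbb{Z}_K$ is the ring of integers of $K$; a prime $p$ is a common index divisor of $K$ if $p\mid i(K)$. *)

theory Defs
  imports "HOL-Algebra.Algebraic_Closure_Type" "HOL-Algebra.Generated_Fields"
begin

text \<open>Number fields are taken as subfields of the complex numbers.\<close>

abbreviation complex_ring :: "complex ring"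
  where "complex_ring \<equiv> ring_of_type_algebra"

text \<open>\<open>\<rat>(x)\<close> and \<open>\<int>[x]\<close>: the subfield and the subring of the complex numbers generated by \<open>x\<close>.
  A subfield contains 1, hence contains \<open>\<rat>\<close>, so it need not be adjoined.\<close>

definition rat_adjoin :: "complex \<Rightarrow> complex set"
  where "rat_adjoin x = generate_field complex_ring {x}"

definition int_adjoin :: "complex \<Rightarrow> complex set"
  where "int_adjoin x = generate_ring complex_ring {x}"

definition ring_of_integers :: "complex set \<Rightarrow> complex set"
  where "ring_of_integers K = {x \<in> K. algebraic_int x}"

text \<open>The index \<open>(A : B)\<close> of the additive subgroup \<open>B\<close> in \<open>A\<close>.  An infinite index is counted as 0;
  this does not affect the greatest common divisor below.\<close>

definition add_index :: "complex set \<Rightarrow> complex set \<Rightarrow> nat"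
  where "add_index A B = card (a_rcosets\<^bsub>complex_ring\<lparr>carrier := A\<rparr>\<^esub> B)"

definition field_index :: "complex set \<Rightarrow> nat"
  where "field_index K =
    Gcd {add_index (ring_of_integers K) (int_adjoin \<eta>) | \<eta>.
           \<eta> \<in> ring_of_integers K \<and> K = rat_adjoin \<eta>}"

definition common_index_divisor :: "nat \<Rightarrow> complex set \<Rightarrow> bool"
  where "common_index_divisor p K \<longleftrightarrow> Factorial_Ring.prime p \<and> p dvd field_index K"

end

theory Submission
  imports Defs "HOL-Algebra.Sylow"
begin

text \<open>Let \<open>\<eta> = P(\<theta>)\<close> be an element of \<open>K\<close> with conjugates \<open>\<eta>\<^sub>x = P(x)\<close>, \<open>x\<close> running through the roots of the
  minimal polynomial of \<open>\<theta>\<close>, and let \<open>V\<close> be a valuation ring of \<open>\<complex>\<close> whose maximal ideal contains \<open>p\<close>.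
  If \<open>g(\<eta>)/p\<close> is integral, Lagrange interpolation writes the coefficients of \<open>g\<close> as combinations
  of the quotients \<open>p / \<Prod>\<^bsub>y \<noteq> x\<^esub> (\<eta>\<^sub>x - \<eta>\<^sub>y)\<close>; so if all of these lie in the maximal ideal, \<open>p\<close> divides \<open>g\<close>
  and the index of \<open>\<int>[\<eta>]\<close> is prime to \<open>p\<close>.  Such an \<open>\<eta>\<close> is found from the Newton polygon of
  \<open>x\<^sup>9 + a x + b\<close>: for \<open>p \<ge> 5\<close> the ramification is tame, and after scaling by a root of \<open>p\<close> the roots are
  pairwise incongruent.  This fails only if (after removing common powers of \<open>p\<close>) \<open>p\<close> divides the
  discriminant but not \<open>ab\<close>; then exactly two roots meet, at the rational number \<open>-9b/(8a)\<close>, and they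
  are separated by hand.\<close>

section \<open>Valuation rings\<close>

text \<open>One valuation ring \<open>V\<close> of \<complex> replaces the primes above p, the
  Galois closure and the completions: it contains all algebraic integers, in particular all
  conjugates of \<eta> and all roots of p, and it meets \<rat> in \<int> localised at p. As the
  index of K is a gcd, one \<eta> suffices, and it need only be integral at p. The obstacle is that
  \<eta> must be a rational polynomial in \<theta>, which cannot scale by a fractional power of p.
  Rational monomials in the root recover only part of the scaled residues: up to e roots stay
  congruent, with differences of valuation 1/e when p has valuation 1. Each root then meets at most
  e - 1 others, so its product of differences has valuation at most (e - 1)/e < 1, and this strict
  inequality is why tame ramification does no harm. Two roots that meet to high order at -9b/(8a)
  stay congruent under every polynomial with p-integral coefficients, so their witness needs
  denominators p^k whose effect on the other roots is neutral. The bound p \<ge> 5 makes 8, 9 and 36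
  units and leaves enough residues for moving the two roots to free places.\<close>

definition is_subring :: "'a::field set \<Rightarrow> bool"
  where "is_subring R \<longleftrightarrow> 1 \<in> R \<and> (\<forall>x\<in>R. \<forall>y\<in>R. x - y \<in> R \<and> x * y \<in> R)"

lemma is_subringD:
  assumes "is_subring R"
  shows "1 \<in> R" "0 \<in> R" "x \<in> R \<Longrightarrow> y \<in> R \<Longrightarrow> x - y \<in> R" "x \<in> R \<Longrightarrow> - x \<in> R"
    "x \<in> R \<Longrightarrow> y \<in> R \<Longrightarrow> x + y \<in> R" "x \<in> R \<Longrightarrow> y \<in> R \<Longrightarrow> x * y \<in> R" "x \<in> R \<Longrightarrow> x ^ n \<in> R"
    "(\<And>i. i \<in> I \<Longrightarrow> f i \<in> R) \<Longrightarrow> sum f I \<in> R" "(\<And>i. i \<in> I \<Longrightarrow> f i \<in> R) \<Longrightarrow> prod f I \<in> R"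
    "of_int j \<in> R" "of_nat k \<in> R"
proof -
  show 1: "1 \<in> R" and diff: "\<And>x y. x \<in> R \<Longrightarrow> y \<in> R \<Longrightarrow> x - y \<in> R"
    and mult: "\<And>x y. x \<in> R \<Longrightarrow> y \<in> R \<Longrightarrow> x * y \<in> R"
    using assms by (auto simp: is_subring_def)
  show 0: "0 \<in> R" using diff[OF 1 1] by simp
  show minus: "\<And>x. x \<in> R \<Longrightarrow> - x \<in> R" using diff[OF 0] by simp
  show add: "\<And>x y. x \<in> R \<Longrightarrow> y \<in> R \<Longrightarrow> x + y \<in> R"
    using diff minus by (metis diff_minus_eq_add)
  show "x \<in> R \<Longrightarrow> x ^ n \<in> R" by (induction n) (auto simp: 1 mult)
  show "(\<And>i. i \<in> I \<Longrightarrow> f i \<in> R) \<Longrightarrow> sum f I \<in> R" for f :: "'b \<Rightarrow> 'a" and I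
    by (induction I rule: infinite_finite_induct) (auto simp: 0 add)
  show "(\<And>i. i \<in> I \<Longrightarrow> f i \<in> R) \<Longrightarrow> prod f I \<in> R" for f :: "'b \<Rightarrow> 'a" and I
    by (induction I rule: infinite_finite_induct) (auto simp: 1 mult)
  show nat: "of_nat k \<in> R" for k by (induction k) (auto simp: 0 1 add)
  show "of_int j \<in> R"
    by (cases j rule: int_cases2) (auto simp: nat minus)
qed

lemma coeff_mult_mem:
  assumes "is_subring R" "\<forall>i. Polynomial.coeff p i \<in> R" "\<forall>i. Polynomial.coeff q i \<in> R"
  shows "Polynomial.coeff (p * q) i \<in> R"
  unfolding coeff_mult using assms by (intro is_subringD(8) is_subringD(6)) auto

lemma poly_mem:
  assumes "is_subring R" "\<forall>i. Polynomial.coeff p i \<in> R" "x \<in> R"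
  shows "poly p x \<in> R"
  unfolding poly_altdef using assms by (intro is_subringD(8) is_subringD(6) is_subringD(7)) auto

section \<open>Chevalley's existence theorem for valuation rings\<close>

definition adjoin :: "'a::field set \<Rightarrow> 'a \<Rightarrow> 'a set"
  where "adjoin R x = {poly q x | q. \<forall>i. Polynomial.coeff q i \<in> R}"

lemma is_subring_adjoin:
  assumes "is_subring R"
  shows "is_subring (adjoin R x)"
  unfolding is_subring_def adjoin_def
proof (intro conjI ballI)
  show "1 \<in> {poly q x | q. \<forall>i. Polynomial.coeff q i \<in> R}"
    using is_subringD(1,2)[OF assms] by (auto intro!: exI[of _ 1] simp: coeff_1)
next
  fix u v assume "u \<in> {poly q x | q. \<forall>i. Polynomial.coeff q i \<in> R}" "v \<in> {poly q x | q. \<forall>i. Polynomial.coeff q i \<in> R}"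
  then obtain q r where qr: "u = poly q x" "v = poly r x" "\<forall>i. Polynomial.coeff q i \<in> R" "\<forall>i. Polynomial.coeff r i \<in> R"
    by auto
  show "u - v \<in> {poly q x | q. \<forall>i. Polynomial.coeff q i \<in> R}"
    using qr is_subringD(3)[OF assms] by (auto intro!: exI[of _ "q - r"])
  show "u * v \<in> {poly q x | q. \<forall>i. Polynomial.coeff q i \<in> R}"
    using qr coeff_mult_mem[OF assms] by (auto intro!: exI[of _ "q * r"])
qed

lemma adjoin_superset: "is_subring R \<Longrightarrow> R \<subseteq> adjoin R x"
proof
  fix y assume "is_subring R" "y \<in> R"
  thus "y \<in> adjoin R x" unfolding adjoin_def
    by (auto intro!: exI[of _ "[:y:]"] simp: coeff_pCons is_subringD(2) split: nat.splits)
qed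

lemma mem_adjoin: "is_subring R \<Longrightarrow> x \<in> adjoin R x"
  unfolding adjoin_def
  by (auto intro!: exI[of _ "[:0,1:]"] simp: coeff_pCons is_subringD(1,2) split: nat.splits)

locale valuation_ring =
  fixes V :: "'a::field set"
  assumes is_subring: "is_subring V"
    and total: "x \<in> V \<or> inverse x \<in> V"

text \<open>The descent showing that a subring \<open>V\<close> maximal among those without \<open>1/p\<close> contains \<open>x\<close> or \<open>1/x\<close>:
  of two relations \<open>p q(x) = 1\<close> and \<open>p r(1/x) = 1\<close> over \<open>V\<close>, the one of larger degree can be shortened.\<close>

lemma chevalley_step:
  fixes p x :: "'a::field"
  assumes V: "is_subring V" and p: "p \<in> V"
    and units: "\<And>b. b \<in> V \<Longrightarrow> 1 - p * b \<noteq> 0 \<and> inverse (1 - p * b) \<in> V"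
    and x: "x \<noteq> 0"
    and q: "\<forall>i. Polynomial.coeff q i \<in> V" "p * poly q x = 1"
    and r: "\<forall>i. Polynomial.coeff r i \<in> V" "p * poly r (inverse x) = 1"
    and deg: "Polynomial.degree r \<le> Polynomial.degree q"
  shows "\<exists>q'. (\<forall>i. Polynomial.coeff q' i \<in> V) \<and> p * poly q' x = 1 \<and> Polynomial.degree q' < Polynomial.degree q"
proof -
  note [intro] = is_subringD[OF V]
  define n where "n = Polynomial.degree q"
  define r0 where "r0 = Polynomial.coeff r 0"
  define u where "u = inverse (1 - p * r0)"
  have r0: "r0 \<in> V" using r by (simp add: r0_def)
  note u = units[OF r0, folded u_def]
  have pinv: "1 - p * c \<noteq> 0" if "c \<in> V" for c using units[OF that] by simp
  have n0: "n \<noteq> 0"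
  proof
    assume "n = 0"
    then obtain c where "q = [:c:]" unfolding n_def using degree_eq_zeroE by blast
    thus False using q pinv[of c] by (auto dest: spec[of _ 0])
  qed
  \<comment> \<open>Multiplying the relation for 1/x by x^n and dividing by the unit 1 - p r0 turns
    x^n into p times a polynomial in x of degree at most n - 1; this replaces the leading term of
    \<open>q\<close>.\<close>
  define R where "R = (\<Sum>j\<in>{1..Polynomial.degree r}. Polynomial.monom (Polynomial.coeff r j) (n - j))"
  have "poly r (inverse x) = (\<Sum>j\<le>Polynomial.degree r. Polynomial.coeff r j * inverse x ^ j)"
    by (simp add: poly_altdef)
  also have "\<dots> = r0 + (\<Sum>j\<in>{1..Polynomial.degree r}. Polynomial.coeff r j * inverse x ^ j)"
    by (simp add: r0_def atMost_atLeast0 sum.atLeast_Suc_atMost[of 0])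
  finally have "1 - p * r0 = p * (\<Sum>j\<in>{1..Polynomial.degree r}. Polynomial.coeff r j * inverse x ^ j)"
    using r(2) by (simp add: algebra_simps)
  hence "(1 - p * r0) * x ^ n = p * (\<Sum>j\<in>{1..Polynomial.degree r}. Polynomial.coeff r j * (inverse x ^ j * x ^ n))"
    by (simp add: sum_distrib_right mult.assoc)
  also have "(\<Sum>j\<in>{1..Polynomial.degree r}. Polynomial.coeff r j * (inverse x ^ j * x ^ n)) = poly R x"
    unfolding R_def poly_sum poly_monom
  proof (intro sum.cong refl)
    fix j assume "j \<in> {1..Polynomial.degree r}"
    hence "j \<le> n" using deg by (simp add: n_def)
    hence "inverse x ^ j * x ^ n = x ^ (n - j)"
      using x by (simp add: power_diff field_simps power_inverse)
    thus "Polynomial.coeff r j * (inverse x ^ j * x ^ n) = Polynomial.coeff r j * x ^ (n - j)" by simp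
  qed
  finally have "u * ((1 - p * r0) * x ^ n) = u * (p * poly R x)" by simp
  moreover have "u * (1 - p * r0) = 1" using pinv[OF r0] by (simp add: u_def)
  ultimately have xn: "x ^ n = u * p * poly R x" by (metis mult.assoc mult_1_left)
  have degR: "Polynomial.degree R \<le> n - 1" unfolding R_def
    by (intro degree_sum_le) (auto intro: order.trans[OF degree_monom_le])
  have coR: "Polynomial.coeff R i \<in> V" for i
    unfolding R_def coeff_sum coeff_monom using r(1) by (intro is_subringD(8)[OF V]) auto
  define c where "c = Polynomial.coeff q n"
  define q1 where "q1 = q - Polynomial.monom c n"
  have degq1: "Polynomial.degree q1 \<le> n - 1"
  proof (rule degree_le, intro allI impI)
    fix i assume "n - 1 < i"
    thus "Polynomial.coeff q1 i = 0"
      by (cases "i = n") (auto simp: q1_def c_def n_def coeff_eq_0)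
  qed
  have coq1: "Polynomial.coeff q1 i \<in> V" for i
    unfolding q1_def c_def using q(1) by auto
  define q' where "q' = Polynomial.smult (c * u * p) R + q1"
  have "poly q x = c * x ^ n + poly q1 x" by (simp add: q1_def poly_monom)
  also have "\<dots> = poly q' x" by (simp add: q'_def xn mult.assoc)
  finally have "p * poly q' x = 1" using q(2) by simp
  moreover have "Polynomial.degree q' < n"
  proof -
    have "Polynomial.degree q' \<le> n - 1" unfolding q'_def
      using degR degq1 by (intro degree_add_le) (auto intro: order.trans[OF degree_smult_le])
    thus ?thesis using n0 by linarith
  qed
  moreover have "Polynomial.coeff q' i \<in> V" for i
    unfolding q'_def coeff_add coeff_smult c_def
    using coR coq1 u p q(1) by (intro is_subringD(5,6)[OF V]) auto
  ultimately show ?thesis by (intro exI[of _ q']) (simp add: n_def)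
qed

lemma ex_valuation_ring:
  fixes p :: "'a::field"
  assumes R: "is_subring R" "p \<in> R" "inverse p \<notin> R"
  obtains V where "valuation_ring V" "R \<subseteq> V" "inverse p \<notin> V"
proof -
  define Fam where "Fam = {V. is_subring V \<and> R \<subseteq> V \<and> inverse p \<notin> V}"
  have "\<exists>M\<in>Fam. \<forall>Y\<in>Fam. M \<subseteq> Y \<longrightarrow> Y = M"
  proof (rule subset_Zorn_nonempty)
    show "Fam \<noteq> {}" using R by (auto simp: Fam_def)
    fix \<C> assume C: "\<C> \<noteq> {}" "subset.chain Fam \<C>"
    hence sub: "\<C> \<subseteq> Fam" and ch: "\<And>S T. S \<in> \<C> \<Longrightarrow> T \<in> \<C> \<Longrightarrow> S \<subseteq> T \<or> T \<subseteq> S"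
      unfolding subset_chain_def by auto
    have "is_subring (\<Union>\<C>)"
      unfolding is_subring_def
    proof (intro conjI ballI)
      show "1 \<in> \<Union>\<C>" using C sub by (auto simp: Fam_def is_subring_def)
    next
      fix x y assume "x \<in> \<Union>\<C>" "y \<in> \<Union>\<C>"
      then obtain Z where Z: "Z \<in> \<C>" "x \<in> Z" "y \<in> Z" using ch by blast
      hence sZ: "is_subring Z" using sub by (auto simp: Fam_def)
      show "x - y \<in> \<Union>\<C>" "x * y \<in> \<Union>\<C>"
        using Z is_subringD(3,6)[OF sZ, of x y] by auto
    qed
    thus "\<Union>\<C> \<in> Fam" using sub C by (auto simp: Fam_def)
  qed
  then obtain V where VF: "V \<in> Fam" and VM: "\<forall>Y\<in>Fam. V \<subseteq> Y \<longrightarrow> Y = V" by (elim bexE)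
  from VF have V: "is_subring V" "R \<subseteq> V" "inverse p \<notin> V" by (simp_all add: Fam_def)
  have max: "W = V" if "is_subring W" "V \<subseteq> W" "inverse p \<notin> W" for W
    using VM that V(2) by (simp add: Fam_def subset_trans[of R V W])
  note [intro] = is_subringD[OF V(1)]
  have pV: "p \<in> V" and p0: "p \<noteq> 0" using R V is_subringD(2)[OF V(1)] by auto
  have adj: "inverse p \<in> adjoin V x" if "x \<notin> V" for x
    using max[OF is_subring_adjoin[OF V(1)] adjoin_superset[OF V(1)], of x] that mem_adjoin[OF V(1), of x]
    by auto
  \<comment> \<open>If 1/(1 - p b) were outside \<open>V\<close>, maximality would put 1/p into
    V[1/(1 - p b)]; multiplying by (1 - p b)^N, which is congruent to 1 modulo p V, brings 1/p back
    into \<open>V\<close>.\<close>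
  have units: "1 - p * b \<noteq> 0 \<and> inverse (1 - p * b) \<in> V" if b: "b \<in> V" for b
  proof -
    have nz: "1 - p * b \<noteq> 0"
    proof
      assume "1 - p * b = 0"
      hence "b = inverse p" using p0 by (simp add: field_simps)
      thus False using b V by simp
    qed
    have pw: "\<exists>c\<in>V. (1 - p * b) ^ n = 1 - p * c" for n
    proof (induction n)
      case 0 show ?case by (intro bexI[of _ 0]) auto
    next
      case (Suc n)
      then obtain c where c: "c \<in> V" "(1 - p * b) ^ n = 1 - p * c" by auto
      have "(1 - p * b) ^ Suc n = 1 - p * (c + b - p * b * c)"
        unfolding power_Suc c(2) by (simp add: algebra_simps)
      moreover have "c + b - p * b * c \<in> V" using c(1) b pV by (intro is_subringD(3,5,6)[OF V(1)])
      ultimately show ?case by blast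
    qed
    have "inverse (1 - p * b) \<in> V"
    proof (rule ccontr)
      assume "inverse (1 - p * b) \<notin> V"
      from adj[OF this] obtain q where q: "inverse p = poly q (inverse (1 - p * b))" "\<forall>i. Polynomial.coeff q i \<in> V"
        by (auto simp: adjoin_def)
      define N where "N = Polynomial.degree q"
      have "(1 - p * b) ^ N * inverse p = (\<Sum>i\<le>N. Polynomial.coeff q i * (inverse (1 - p * b) ^ i * (1 - p * b) ^ N))"
        by (simp add: q(1) poly_altdef N_def sum_distrib_left mult_ac)
      also have "\<dots> = (\<Sum>i\<le>N. Polynomial.coeff q i * (1 - p * b) ^ (N - i))"
        using nz by (intro sum.cong) (auto simp: power_diff field_simps power_inverse)
      also have "\<dots> \<in> V"
        using q(2) b pV by (intro is_subringD(1,3,6,7,8)[OF V(1)]) auto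
      finally have 1: "(1 - p * b) ^ N * inverse p \<in> V" .
      obtain c where c: "c \<in> V" "(1 - p * b) ^ N = 1 - p * c" using pw by blast
      have "(1 - p * b) ^ N * inverse p + c = inverse p" unfolding c using p0 by (simp add: field_simps)
      thus False using 1 c V by (metis is_subringD(5))
    qed
    thus ?thesis using nz by simp
  qed
  have "x \<in> V \<or> inverse x \<in> V" for x
  proof (rule ccontr)
    assume "\<not> (x \<in> V \<or> inverse x \<in> V)"
    hence xV: "x \<notin> V" "inverse x \<notin> V" by auto
    hence x0: "x \<noteq> 0" "inverse x \<noteq> 0" by auto
    define Q where "Q y q \<longleftrightarrow> (\<forall>i. Polynomial.coeff q i \<in> V) \<and> p * poly q y = 1" for y q
    have ex: "\<exists>q. Q y q" if "y \<notin> V" for y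
    proof -
      from adj[OF that] obtain q where q: "inverse p = poly q y" "\<forall>i. Polynomial.coeff q i \<in> V"
        by (auto simp: adjoin_def)
      moreover have "p * poly q y = 1" unfolding q(1)[symmetric] using p0 by simp
      ultimately show ?thesis by (auto simp: Q_def)
    qed
    \<comment> \<open>Relations of least degree for x and for 1/x; the descent is applied to the
      longer one, so the two cases are symmetric.\<close>
    define q where "q = (ARG_MIN Polynomial.degree q. Q x q)"
    define r where "r = (ARG_MIN Polynomial.degree q. Q (inverse x) q)"
    from ex[OF xV(1)] have q: "Q x q" and qmin: "\<And>q'. Q x q' \<Longrightarrow> Polynomial.degree q \<le> Polynomial.degree q'"
      unfolding q_def by (blast intro: arg_min_natI arg_min_nat_le)+
    from ex[OF xV(2)] have r: "Q (inverse x) r" and rmin: "\<And>q'. Q (inverse x) q' \<Longrightarrow> Polynomial.degree r \<le> Polynomial.degree q'"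
      unfolding r_def by (blast intro: arg_min_natI arg_min_nat_le)+
    show False
    proof (cases "Polynomial.degree r \<le> Polynomial.degree q")
      case True
      have "\<exists>q'. Q x q' \<and> Polynomial.degree q' < Polynomial.degree q"
        using chevalley_step[OF V(1) pV units x0(1) _ _ _ _ True] q r unfolding Q_def by simp
      thus False using qmin not_le by blast
    next
      case False
      hence le: "Polynomial.degree q \<le> Polynomial.degree r" by simp
      have "\<exists>q'. Q (inverse x) q' \<and> Polynomial.degree q' < Polynomial.degree r"
        using chevalley_step[OF V(1) pV units x0(2) _ _ _ _ le] q r unfolding Q_def by simp
      thus False using rmin not_le by blast
    qed
  qed
  hence "valuation_ring V" using V by unfold_locales auto
  thus ?thesis using V that by blast
qed

text \<open>Multiplying x = q(1/x) by x^n, with n the degree of q, gives a monic equation for x. It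
  is used in contrapositive form: for x not integral, 1/x is a non-unit of \<int>[1/x] and can play
  the role of p in \<open>ex_valuation_ring\<close>.\<close>

lemma algebraic_int_iff_mem_adjoin_inverse:
  fixes x :: "'a::field_char_0"
  assumes "x \<noteq> 0" "x \<in> adjoin (range of_int) (inverse x)"
  shows "algebraic_int x"
proof -
  obtain q where q: "x = poly q (inverse x)" "\<forall>i. Polynomial.coeff q i \<in> \<int>"
    using assms(2) by (auto simp: adjoin_def Ints_def)
  define n where "n = Polynomial.degree q"
  define S where "S = (\<Sum>i\<le>n. Polynomial.monom (Polynomial.coeff q i) (n - i))"
  define r where "r = Polynomial.monom 1 (Suc n) - S"
  have co: "Polynomial.coeff S i = (if i \<le> n then Polynomial.coeff q (n - i) else 0)" for i
  proof -
    have "Polynomial.coeff S i = (\<Sum>j\<le>n. if n - j = i then Polynomial.coeff q j else 0)"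
      by (simp add: S_def coeff_sum)
    also have "\<dots> = (\<Sum>j\<le>n. if i \<le> n \<and> j = n - i then Polynomial.coeff q j else 0)"
      by (intro sum.cong) auto
    finally show ?thesis by (cases "i \<le> n") auto
  qed
  have "x ^ Suc n = x ^ n * poly q (inverse x)" using q(1) by simp
  also have "\<dots> = (\<Sum>i\<le>n. Polynomial.coeff q i * (inverse x ^ i * x ^ n))"
    by (simp add: poly_altdef n_def sum_distrib_left mult_ac)
  also have "\<dots> = (\<Sum>i\<le>n. Polynomial.coeff q i * x ^ (n - i))"
    using assms(1) by (intro sum.cong) (auto simp: power_diff field_simps power_inverse)
  also have "\<dots> = poly S x" by (simp add: S_def poly_sum poly_monom)
  finally have "poly r x = 0" by (simp add: r_def poly_monom)
  moreover have coS: "Polynomial.coeff S i \<in> \<int>" for i using q(2) co by auto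
  have "Polynomial.coeff r i \<in> \<int>" for i
    unfolding r_def using coS by (auto simp: coeff_diff intro!: Ints_diff)
  moreover have "Polynomial.degree r = Suc n"
  proof (rule antisym)
    show "Polynomial.degree r \<le> Suc n"
      by (rule degree_le) (auto simp: r_def co)
    show "Suc n \<le> Polynomial.degree r"
      by (rule le_degree) (auto simp: r_def co)
  qed
  ultimately show ?thesis
    by (intro algebraic_int.intros[of r]) (simp_all add: r_def co)
qed

lemma degree_monom_minus_const:
  "n > 0 \<Longrightarrow> Polynomial.degree (Polynomial.monom (1::'a::field) n - [:c:]) = n"
  by (intro antisym degree_le le_degree) (auto simp: coeff_pCons split: nat.splits)

lemma is_subring_Ints: "is_subring (range of_int)"
  unfolding Ints_def[symmetric] is_subring_def by auto

section \<open>Integral closedness, maximal ideal and units of a valuation ring\<close>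

context valuation_ring
begin

lemmas closed [intro] = is_subringD[OF is_subring]

text \<open>If x were outside \<open>V\<close>, then 1/x would be in \<open>V\<close>, and dividing
  the monic equation by x^(n-1) would write x as a polynomial in 1/x over \<open>V\<close>.\<close>

lemma integral_mem:
  assumes "Polynomial.lead_coeff q = 1" "\<forall>i. Polynomial.coeff q i \<in> V" "poly q x = 0"
  shows "x \<in> V"
proof (rule ccontr)
  assume x: "x \<notin> V"
  hence y: "inverse x \<in> V" and x0: "x \<noteq> 0" using total by auto
  define n where "n = Polynomial.degree q"
  have "n \<noteq> 0"
  proof
    assume "n = 0"
    then obtain c where "q = [:c:]" unfolding n_def using degree_eq_zeroE by blast
    thus False using assms by auto
  qed
  then obtain k where n: "n = Suc k" using not0_implies_Suc by blast
  have "0 = (\<Sum>i\<le>n. Polynomial.coeff q i * x ^ i)"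
    using assms(3) by (simp add: poly_altdef n_def)
  also have "\<dots> = x ^ n + (\<Sum>i<n. Polynomial.coeff q i * x ^ i)"
    using assms(1) by (simp add: n_def lessThan_Suc_atMost[symmetric])
  finally have "x ^ Suc k = - (\<Sum>i\<le>k. Polynomial.coeff q i * x ^ i)"
    unfolding n by (simp add: lessThan_Suc_atMost eq_neg_iff_add_eq_0)
  hence "x ^ Suc k * inverse x ^ k = - (\<Sum>i\<le>k. Polynomial.coeff q i * (x ^ i * inverse x ^ k))"
    by (simp add: sum_distrib_right mult.assoc)
  also have "\<dots> = - (\<Sum>i\<le>k. Polynomial.coeff q i * inverse x ^ (k - i))"
    using x0 by (intro arg_cong[of _ _ uminus] sum.cong) (auto simp: power_diff field_simps power_inverse)
  also have "\<dots> \<in> V" using assms(2) y by (intro closed) auto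
  also have "x ^ Suc k * inverse x ^ k = x" using x0 by (simp add: power_inverse)
  finally show False using x by simp
qed

lemma algebraic_int_mem: "algebraic_int x \<Longrightarrow> x \<in> V"
proof (erule algebraic_int.cases)
  fix q y assume q: "x = y" "Polynomial.lead_coeff q = 1" "\<forall>i. Polynomial.coeff q i \<in> \<int>" "poly q y = 0"
  have "\<forall>i. Polynomial.coeff q i \<in> V"
  proof
    fix i show "Polynomial.coeff q i \<in> V"
      using q(3)[rule_format, of i] closed(10) by (elim Ints_cases) simp
  qed
  thus "x \<in> V" using q integral_mem by blast
qed

lemma power_mem_iff: "n > 0 \<Longrightarrow> x ^ n \<in> V \<longleftrightarrow> x \<in> V"
proof
  assume n: "n > 0" and x: "x ^ n \<in> V"
  have deg: "Polynomial.degree (Polynomial.monom 1 n - [:x ^ n:]) = n"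
    using n by (rule degree_monom_minus_const)
  show "x \<in> V"
  proof (rule integral_mem[of "Polynomial.monom 1 n - [:x ^ n:]"])
    show "Polynomial.lead_coeff (Polynomial.monom 1 n - [:x ^ n:]) = 1"
      unfolding deg using n by (simp add: coeff_pCons split: nat.splits)
    show "\<forall>i. Polynomial.coeff (Polynomial.monom 1 n - [:x ^ n:]) i \<in> V"
      using x by (auto simp: coeff_pCons split: nat.splits)
  qed (simp add: poly_monom)
qed auto

text \<open>Since \<open>inverse 0 = 0\<close> lies in \<open>V\<close>, zero needs a clause of its
  own here and in \<open>uni\<close>.\<close>

definition maxi :: "'a set"
  where "maxi = {x \<in> V. x = 0 \<or> inverse x \<notin> V}"

definition uni :: "'a set"
  where "uni = {x \<in> V. x \<noteq> 0 \<and> inverse x \<in> V}"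

lemma maxi_mem: "x \<in> maxi \<Longrightarrow> x \<in> V" and uni_mem: "x \<in> uni \<Longrightarrow> x \<in> V"
  and uni_nz: "x \<in> uni \<Longrightarrow> x \<noteq> 0"
  by (auto simp: maxi_def uni_def)

lemma uni_not_maxi: "x \<in> uni \<Longrightarrow> x \<notin> maxi" and uni_or_maxi: "x \<in> V \<Longrightarrow> x \<in> uni \<or> x \<in> maxi"
  by (auto simp: maxi_def uni_def)

lemma uni_1 [intro, simp]: "1 \<in> uni"
  by (auto simp: uni_def)

lemma maxi_0 [intro, simp]: "0 \<in> maxi"
  by (auto simp: maxi_def)

lemma uni_mult [intro]: "x \<in> uni \<Longrightarrow> y \<in> uni \<Longrightarrow> x * y \<in> uni"
  by (auto simp: uni_def)

lemma uni_inverse [intro]: "x \<in> uni \<Longrightarrow> inverse x \<in> uni"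
  by (auto simp: uni_def)

lemma uni_divide [intro]: "x \<in> uni \<Longrightarrow> y \<in> uni \<Longrightarrow> x / y \<in> uni"
  by (auto simp: divide_inverse)

lemma uni_minus [intro]: "x \<in> uni \<Longrightarrow> - x \<in> uni"
  by (auto simp: uni_def)

lemma uni_power [intro]: "x \<in> uni \<Longrightarrow> x ^ n \<in> uni"
  by (induction n) auto

lemma uni_prod [intro]: "(\<And>i. i \<in> I \<Longrightarrow> f i \<in> uni) \<Longrightarrow> prod f I \<in> uni"
  by (induction I rule: infinite_finite_induct) auto

lemma divide_uni_mem [intro]: "x \<in> V \<Longrightarrow> y \<in> uni \<Longrightarrow> x / y \<in> V"
  by (auto simp: divide_inverse uni_def)

lemma mult_uni_iff: "x \<in> V \<Longrightarrow> y \<in> V \<Longrightarrow> x * y \<in> uni \<longleftrightarrow> x \<in> uni \<and> y \<in> uni"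
proof
  assume "x \<in> V" "y \<in> V" "x * y \<in> uni"
  hence nz: "x \<noteq> 0" "y \<noteq> 0" and i: "inverse (x * y) \<in> V" by (auto simp: uni_def)
  have 1: "y * inverse (x * y) = inverse x" and 2: "x * inverse (x * y) = inverse y"
    using nz by (auto simp: field_simps)
  have "inverse x \<in> V" "inverse y \<in> V"
    unfolding 1[symmetric] 2[symmetric] by (intro closed(6) i \<open>x \<in> V\<close> \<open>y \<in> V\<close>)+
  thus "x \<in> uni \<and> y \<in> uni" using nz \<open>x \<in> V\<close> \<open>y \<in> V\<close> by (simp add: uni_def)
qed (simp add: uni_mult)

lemma maxi_mult: "x \<in> maxi \<Longrightarrow> y \<in> V \<Longrightarrow> x * y \<in> maxi" "y \<in> V \<Longrightarrow> x \<in> maxi \<Longrightarrow> y * x \<in> maxi"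
  by (metis mult_uni_iff uni_or_maxi uni_not_maxi maxi_mem closed(6))+

lemma maxi_prime: "x \<in> V \<Longrightarrow> y \<in> V \<Longrightarrow> x * y \<in> maxi \<Longrightarrow> x \<in> maxi \<or> y \<in> maxi"
  using mult_uni_iff uni_or_maxi uni_not_maxi by metis

lemma maxi_minus [intro]: "x \<in> maxi \<Longrightarrow> - x \<in> maxi"
  using maxi_mult(1)[of x "-1"] closed(4)[OF closed(1)] by simp

text \<open>Of two elements of a valuation ring one divides the other, so the sum is a multiple of
  the divisor.\<close>

lemma maxi_add [intro]:
  assumes "x \<in> maxi" "y \<in> maxi"
  shows "x + y \<in> maxi"
proof -
  have aux: "x + y \<in> maxi" if "x \<in> maxi" "y \<in> maxi" "x / y \<in> V" for x y
  proof (cases "y = 0")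
    case False
    hence "x + y = y * (x / y + 1)" by (simp add: field_simps)
    thus ?thesis using maxi_mult(1)[OF that(2), of "x / y + 1"] closed(5)[OF that(3) closed(1)] by simp
  qed (use that in auto)
  have "x / y \<in> V \<or> y / x \<in> V" using total[of "x / y"] by simp
  thus ?thesis using aux[OF assms] aux[OF assms(2,1)] by (auto simp: add.commute)
qed

lemma maxi_diff [intro]: "x \<in> maxi \<Longrightarrow> y \<in> maxi \<Longrightarrow> x - y \<in> maxi"
  using maxi_add[of x "-y"] by auto

lemma maxi_sum [intro]: "(\<And>i. i \<in> I \<Longrightarrow> f i \<in> maxi) \<Longrightarrow> sum f I \<in> maxi"
  by (induction I rule: infinite_finite_induct) auto

lemma uni_add_maxi: "x \<in> uni \<Longrightarrow> y \<in> maxi \<Longrightarrow> x + y \<in> uni"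
  using maxi_diff[of "x + y" y] uni_not_maxi[of x] uni_or_maxi[of "x + y"]
  by (auto simp: uni_mem maxi_mem closed)

lemma maxi_add_uni: "x \<in> maxi \<Longrightarrow> y \<in> uni \<Longrightarrow> x + y \<in> uni"
  using uni_add_maxi[of y x] by (simp add: add.commute)

lemma uni_diff_maxi: "x \<in> uni \<Longrightarrow> y \<in> maxi \<Longrightarrow> x - y \<in> uni"
  using uni_add_maxi[of x "-y"] by auto

lemma maxi_diff_uni: "x \<in> maxi \<Longrightarrow> y \<in> uni \<Longrightarrow> x - y \<in> uni"
  using uni_diff_maxi[of y x] uni_minus[of "y - x"] by simp

lemma maxi_power_iff: "n > 0 \<Longrightarrow> x ^ n \<in> maxi \<longleftrightarrow> x \<in> maxi"
  by (cases "x = 0") (auto simp: maxi_def power_mem_iff power_inverse[symmetric] closed)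

lemma uni_power_iff: "n > 0 \<Longrightarrow> x ^ n \<in> uni \<longleftrightarrow> x \<in> uni"
  by (cases "x = 0") (auto simp: uni_def power_mem_iff power_inverse[symmetric] closed)

lemma maxi_power [intro]: "x \<in> maxi \<Longrightarrow> n > 0 \<Longrightarrow> x ^ n \<in> maxi"
  by (simp add: maxi_power_iff)

lemma poly_diff_mem:
  assumes "\<forall>i. Polynomial.coeff q i \<in> V" "x \<in> V" "y \<in> V"
  obtains s where "s \<in> V" "poly q x - poly q y = (x - y) * s"
proof -
  have "\<exists>s\<in>V. poly q x - poly q y = (x - y) * s"
    using assms(1)
  proof (induction q)
    case 0 show ?case by (intro bexI[of _ 0]) auto
  next
    case (pCons a q)
    have co: "\<forall>i. Polynomial.coeff q i \<in> V"
      using pCons.prems by (metis coeff_pCons_Suc)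
    then obtain s where s: "s \<in> V" "poly q x - poly q y = (x - y) * s" using pCons.IH by blast
    have "poly (pCons a q) x - poly (pCons a q) y = x * (poly q x - poly q y) + (x - y) * poly q y"
      by (simp add: algebra_simps)
    also have "\<dots> = (x - y) * (x * s + poly q y)" unfolding s by (simp add: algebra_simps)
    finally show ?case using s assms co by (intro bexI[of _ "x * s + poly q y"]) (auto intro: poly_mem is_subring)
  qed
  thus ?thesis using that by blast
qed

lemma power_cong_maxi:
  assumes "x - y \<in> maxi" "x \<in> V" "y \<in> V"
  shows "x ^ n - y ^ n \<in> maxi"
proof -
  have "x ^ n - y ^ n = (x - y) * (\<Sum>i<n. y ^ (n - Suc i) * x ^ i)"
    by (rule power_diff_sumr2)
  moreover have "(\<Sum>i<n. y ^ (n - Suc i) * x ^ i) \<in> V"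
    using assms(2,3) by (intro closed(6,7,8))
  ultimately show ?thesis using maxi_mult(1)[OF assms(1)] by simp
qed

end

text \<open>A non-integral x is missed by a valuation ring above \<int>[1/x] in which 1/x is not
  invertible. Being an intersection of rings, the algebraic integers then form a ring.\<close>

lemma algebraic_int_altdef_valuation:
  fixes x :: "'a::field_char_0"
  shows "algebraic_int x \<longleftrightarrow> (\<forall>V. valuation_ring V \<longrightarrow> x \<in> V)"
proof
  assume "\<forall>V. valuation_ring V \<longrightarrow> x \<in> V"
  show "algebraic_int x"
  proof (cases "x = 0")
    case False
    show ?thesis
    proof (rule ccontr)
      assume "\<not> algebraic_int x"
      with False have "x \<notin> adjoin (range of_int) (inverse x)"
        using algebraic_int_iff_mem_adjoin_inverse by blast
      then obtain V where "valuation_ring V" "x \<notin> V"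
        using ex_valuation_ring[of "adjoin (range of_int) (inverse x)" "inverse x"]
          is_subring_adjoin[OF is_subring_Ints] mem_adjoin[OF is_subring_Ints]
        by (metis inverse_inverse_eq)
      thus False using \<open>\<forall>V. _ \<longrightarrow> _\<close> by blast
    qed
  qed auto
qed (auto intro: valuation_ring.algebraic_int_mem)

lemma is_subring_algebraic_int: "is_subring {x::'a::field_char_0. algebraic_int x}"
  unfolding is_subring_def mem_Collect_eq algebraic_int_altdef_valuation
  by (intro conjI ballI allI impI)
    (simp_all add: is_subringD(1,3,6)[OF valuation_ring.is_subring])

section \<open>Lagrange interpolation over a valuation ring\<close>

lemma lagrange_interpolation:
  fixes g :: "'b::field poly"
  assumes "finite A" "inj_on h A" "g = 0 \<or> Polynomial.degree g < card A"
  shows "g = (\<Sum>x\<in>A. Polynomial.smult (poly g (h x) / (\<Prod>y\<in>A - {x}. h x - h y)) (\<Prod>y\<in>A - {x}. [:- h y, 1:]))"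
    (is "g = ?r")
proof (cases "A = {}")
  case False
  show ?thesis
  proof (rule poly_eqI_degree)
    fix z assume "z \<in> h ` A"
    then obtain w where w: "w \<in> A" "z = h w" by auto
    have nz: "(\<Prod>y\<in>A - {w}. h w - h y) \<noteq> 0"
      using assms w by (auto simp: inj_on_def)
    have "poly ?r z = (\<Sum>x\<in>A. if x = w then poly g (h w) else 0)"
      unfolding poly_sum
    proof (intro sum.cong refl)
      fix x assume "x \<in> A"
      show "poly (Polynomial.smult (poly g (h x) / (\<Prod>y\<in>A - {x}. h x - h y)) (\<Prod>y\<in>A - {x}. [:- h y, 1:])) z
          = (if x = w then poly g (h w) else 0)"
        using w nz assms by (auto simp: poly_prod prod_zero_iff)
    qed
    also have "\<dots> = poly g z" using w assms by simp
    finally show "poly g z = poly ?r z" by simp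
  next
    have c: "card (h ` A) = card A" using assms by (simp add: card_image)
    have pos: "card A > 0" using assms False by (simp add: card_gt_0_iff)
    show "Polynomial.degree g < card (h ` A)" using assms c pos by auto
    have "Polynomial.degree ?r \<le> card A - 1"
    proof (rule degree_sum_le[OF assms(1)])
      fix x assume x: "x \<in> A"
      have "Polynomial.degree (\<Prod>y\<in>A - {x}. [:- h y, 1:]) \<le> (\<Sum>y\<in>A-{x}. 1)"
        using degree_prod_sum_le[of "A - {x}" "\<lambda>y. [:- h y, 1:]"] assms by simp
      hence "Polynomial.degree (\<Prod>y\<in>A - {x}. [:- h y, 1:]) \<le> card A - 1"
        using x assms by simp
      thus "Polynomial.degree (Polynomial.smult (poly g (h x) / (\<Prod>y\<in>A - {x}. h x - h y)) (\<Prod>y\<in>A - {x}. [:- h y, 1:])) \<le> card A - 1"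
        by (rule order.trans[OF degree_smult_le])
    qed
    thus "Polynomial.degree ?r < card (h ` A)" using c pos by linarith
  qed
qed (use assms in auto)

lemma coeff_prod_linear_mem:
  assumes R: "is_subring R" and "\<And>y. y \<in> B \<Longrightarrow> h y \<in> R"
  shows "Polynomial.coeff (\<Prod>y\<in>B. [:- h y, 1:]) i \<in> R"
  using assms(2)
proof (induction B arbitrary: i rule: infinite_finite_induct)
  case (insert x F)
  have "\<forall>i. Polynomial.coeff [:- h x, 1:] i \<in> R"
    using insert.prems[of x] is_subringD(1,2,4)[OF R] by (auto simp: coeff_pCons split: nat.splits)
  moreover have "\<forall>i. Polynomial.coeff (\<Prod>y\<in>F. [:- h y, 1:]) i \<in> R"
    using insert.IH insert.prems by simp
  ultimately show ?case unfolding prod.insert[OF insert.hyps] by (rule coeff_mult_mem[OF R])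
qed (auto simp: coeff_1 is_subringD(1,2)[OF R])

context valuation_ring
begin

lemma lagrange_maxi:
  assumes "finite A" "inj_on h A" "Polynomial.degree g < card A"
    and "\<And>x. x \<in> A \<Longrightarrow> h x \<in> V"
    and "\<And>x. x \<in> A \<Longrightarrow> poly g (h x) / (\<Prod>y\<in>A - {x}. h x - h y) \<in> maxi"
  shows "Polynomial.coeff g i \<in> maxi"
proof -
  have "Polynomial.coeff g i = (\<Sum>x\<in>A. poly g (h x) / (\<Prod>y\<in>A - {x}. h x - h y)
      * Polynomial.coeff (\<Prod>y\<in>A - {x}. [:- h y, 1:]) i)"
    by (subst lagrange_interpolation[OF assms(1,2), of g]) (use assms(3) in \<open>auto simp: coeff_sum\<close>)
  also have "\<dots> \<in> maxi"
    using assms by (intro maxi_sum maxi_mult coeff_prod_linear_mem is_subring) auto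
  finally show ?thesis .
qed

text \<open>X^n - c has at most n roots in the residue field. That field is never formed:
  interpolation of X^n - c at more than n points with unit differences would put its leading
  coefficient 1 into the maximal ideal.\<close>

lemma card_power_cong_le:
  assumes "finite A" "\<And>x. x \<in> A \<Longrightarrow> x \<in> V" "\<And>x y. x \<in> A \<Longrightarrow> y \<in> A \<Longrightarrow> x \<noteq> y \<Longrightarrow> x - y \<in> uni"
    and "\<And>x. x \<in> A \<Longrightarrow> x ^ n - c \<in> maxi" and n: "n > 0"
  shows "card A \<le> n"
proof (rule ccontr)
  assume "\<not> card A \<le> n"
  define g where "g = Polynomial.monom 1 n - [:c:]"
  have deg: "Polynomial.degree g = n"
    unfolding g_def using n by (rule degree_monom_minus_const)
  have "Polynomial.coeff g n \<in> maxi"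
  proof (rule lagrange_maxi[of A "\<lambda>x. x"])
    fix x assume x: "x \<in> A"
    have "(\<Prod>y\<in>A - {x}. x - y) \<in> uni" using x assms by (intro uni_prod) auto
    moreover have "poly g x \<in> maxi" using x assms(4) by (simp add: g_def poly_monom)
    ultimately show "poly g x / (\<Prod>y\<in>A - {x}. x - y) \<in> maxi"
      by (auto simp: divide_inverse uni_inverse uni_mem intro: maxi_mult)
  qed (use assms deg \<open>\<not> card A \<le> n\<close> in auto)
  moreover have "Polynomial.coeff g n = 1" using n by (simp add: g_def coeff_pCons split: nat.splits)
  ultimately show False using uni_not_maxi by simp
qed

end

section \<open>Rational polynomials and number fields\<close>

definition rpoly :: "rat poly \<Rightarrow> complex \<Rightarrow> complex"
  where "rpoly g x = poly (map_poly of_rat g) x"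

lemma rpoly_pCons: "rpoly (pCons a g) x = of_rat a + x * rpoly g x"
  by (simp add: rpoly_def map_poly_pCons)

lemma rpoly_0 [simp]: "rpoly 0 x = 0"
  and rpoly_const [simp]: "rpoly [:a:] x = of_rat a"
  and rpoly_1 [simp]: "rpoly 1 x = 1"
  by (simp_all add: rpoly_def map_poly_pCons one_pCons)

lemma rpoly_add [simp]: "rpoly (g + h) x = rpoly g x + rpoly h x"
  by (induction g h rule: poly_induct2) (simp_all add: rpoly_pCons of_rat_add algebra_simps)

lemma rpoly_smult [simp]: "rpoly (Polynomial.smult a g) x = of_rat a * rpoly g x"
  by (induction g) (simp_all add: rpoly_pCons of_rat_mult algebra_simps)

lemma rpoly_minus [simp]: "rpoly (- g) x = - rpoly g x"
  using rpoly_smult[of "-1" g x] by (simp add: of_rat_minus)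

lemma rpoly_diff [simp]: "rpoly (g - h) x = rpoly g x - rpoly h x"
  using rpoly_add[of g "-h" x] by simp

lemma rpoly_mult [simp]: "rpoly (g * h) x = rpoly g x * rpoly h x"
  by (induction g) (simp_all add: rpoly_pCons algebra_simps)

lemma rpoly_power [simp]: "rpoly (g ^ n) x = rpoly g x ^ n"
  by (induction n) simp_all

lemma rpoly_sum [simp]: "rpoly (sum g I) x = (\<Sum>i\<in>I. rpoly (g i) x)"
  by (induction I rule: infinite_finite_induct) simp_all

lemma rpoly_monom [simp]: "rpoly (Polynomial.monom a n) x = of_rat a * x ^ n"
  by (simp add: rpoly_def map_poly_monom poly_monom)

lemma rpoly_pcompose [simp]: "rpoly (g \<circ>\<^sub>p h) x = rpoly g (rpoly h x)"
  by (induction g) (simp_all add: rpoly_pCons pcompose_pCons)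

lemma degree_map_poly_of_rat [simp]: "Polynomial.degree (map_poly (of_rat :: rat \<Rightarrow> complex) g) = Polynomial.degree g"
  by (rule degree_map_poly) simp

lemma rpoly_altdef: "rpoly g x = (\<Sum>i\<le>Polynomial.degree g. of_rat (Polynomial.coeff g i) * x ^ i)"
  by (simp add: rpoly_def poly_altdef coeff_map_poly)

lemma rpoly_altdef_lessThan:
  assumes "Polynomial.degree g < n"
  shows "rpoly g x = (\<Sum>i<n. of_rat (Polynomial.coeff g i) * x ^ i)"
  unfolding rpoly_altdef
  by (rule sum.mono_neutral_left) (use assms in \<open>auto simp: coeff_eq_0\<close>)

lemma irreducible_dvd_of_root:
  assumes "Factorial_Ring.irreducible f" "rpoly f \<theta> = 0" "rpoly g \<theta> = 0"
  shows "f dvd g"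
proof (rule ccontr)
  assume "\<not> f dvd g"
  moreover have "Factorial_Ring.prime_elem f" using assms(1) by (rule irreducible_imp_prime_elem_gcd)
  ultimately have "coprime f g" by (rule prime_elem_imp_coprime[rotated])
  hence "fst (bezout_coefficients f g) * f + snd (bezout_coefficients f g) * g = 1"
    by (simp add: bezout_coefficients_fst_snd)
  hence "rpoly (fst (bezout_coefficients f g) * f + snd (bezout_coefficients f g) * g) \<theta> = 1" by simp
  thus False using assms by simp
qed

text \<open>This takes the place of the Galois action: f divides g, so a polynomial relation over
  \<rat> that holds for one conjugate holds for all.\<close>

lemma rpoly_root_transfer:
  assumes "Factorial_Ring.irreducible f" "rpoly f \<theta> = 0" "rpoly g \<theta> = 0" "rpoly f x = 0"
  shows "rpoly g x = 0"
  using irreducible_dvd_of_root[OF assms(1-3)] assms(4) by (auto elim!: dvdE)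

text \<open>A multiple root would make f divide its derivative, which is nonzero of smaller
  degree.\<close>

lemma card_roots_irreducible:
  fixes f :: "rat poly"
  assumes f: "Factorial_Ring.irreducible f"
  shows "card {x. rpoly f x = 0} = Polynomial.degree f" "finite {x. rpoly f x = 0}"
proof -
  define F :: "complex poly" where "F = map_poly of_rat f"
  have f0: "f \<noteq> 0" using f by auto
  hence F0: "F \<noteq> 0" unfolding F_def by (metis degree_map_poly_of_rat coeff_map_poly leading_coeff_0_iff of_rat_0 of_rat_eq_0_iff)
  have "Polynomial.degree f \<noteq> 0"
  proof
    assume "Polynomial.degree f = 0"
    then obtain c where "f = [:c:]" using degree_eq_zeroE by blast
    thus False using f f0 by (auto simp: Factorial_Ring.irreducible_def is_unit_const_poly_iff dvd_field_iff)
  qed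
  have pd: "pderiv F = map_poly of_rat (pderiv f)"
    by (rule poly_eqI) (simp add: F_def coeff_pderiv coeff_map_poly of_rat_mult of_rat_add)
  have "rsquarefree F"
    unfolding rsquarefree_roots
  proof safe
    fix a assume a: "poly F a = 0" "poly (pderiv F) a = 0"
    have "f dvd pderiv f"
      by (rule irreducible_dvd_of_root[OF f, of a]) (use a pd in \<open>simp_all add: rpoly_def F_def\<close>)
    hence "Polynomial.degree f \<le> Polynomial.degree (pderiv f)"
      using \<open>Polynomial.degree f \<noteq> 0\<close> by (intro dvd_imp_degree_le) (auto simp: pderiv_eq_0_iff)
    thus False using \<open>Polynomial.degree f \<noteq> 0\<close> by (simp add: degree_pderiv)
  qed
  hence "Polynomial.smult (Polynomial.lead_coeff F) (\<Prod>z|poly F z = 0. [:- z, 1:]) = F"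
    by (rule complex_poly_decompose_rsquarefree)
  hence "Polynomial.degree F = Polynomial.degree (\<Prod>z|poly F z = 0. [:- z, 1:])"
    using F0 by (metis degree_smult_eq leading_coeff_0_iff)
  also have "\<dots> = card {z. poly F z = 0}"
    by (subst degree_prod_eq_sum_degree) auto
  finally show "card {x. rpoly f x = 0} = Polynomial.degree f"
    by (simp add: F_def rpoly_def)
  show "finite {x. rpoly f x = 0}" using poly_roots_finite[OF F0] by (simp add: F_def rpoly_def)
qed

section \<open>Subfields and subrings of \<complex> generated by one element\<close>

lemma complex_ring_simps [simp]:
  "carrier complex_ring = UNIV" "x \<otimes>\<^bsub>complex_ring\<^esub> y = x * y" "x \<oplus>\<^bsub>complex_ring\<^esub> y = x + y"
  "\<one>\<^bsub>complex_ring\<^esub> = 1" "\<zero>\<^bsub>complex_ring\<^esub> = 0"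
  by (simp_all add: ring_of_type_algebra_def)

lemma field_complex_ring: "field complex_ring"
  by (rule field_from_type_algebra)

lemma complex_ring_minus [simp]: "\<ominus>\<^bsub>complex_ring\<^esub> x = - x"
proof -
  interpret field complex_ring by (rule field_complex_ring)
  have "x \<oplus>\<^bsub>complex_ring\<^esub> (-x) = \<zero>\<^bsub>complex_ring\<^esub>" by simp
  thus ?thesis by (metis complex_ring_simps(1) UNIV_I sum_zero_eq_neg a_comm)
qed

lemma complex_ring_inv: "x \<noteq> 0 \<Longrightarrow> inv\<^bsub>complex_ring\<^esub> x = inverse x"
proof -
  interpret field complex_ring by (rule field_complex_ring)
  assume "x \<noteq> 0"
  thus ?thesis by (intro comm_inv_char) auto
qed

lemma rat_mem_generate_field: "of_rat q \<in> generate_field complex_ring S"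
proof -
  let ?K = "generate_field complex_ring S"
  have one: "1 \<in> ?K" using generate_field.one[of complex_ring S] by simp
  have add: "x + y \<in> ?K" if "x \<in> ?K" "y \<in> ?K" for x y
    using generate_field.eng_add[OF that] by simp
  have minus: "- x \<in> ?K" if "x \<in> ?K" for x
    using generate_field.a_inv[OF that] by simp
  have zero: "0 \<in> ?K" using add[OF one minus[OF one]] by simp
  have nat: "of_nat n \<in> ?K" for n by (induction n) (auto intro: zero one add)
  have int: "of_int i \<in> ?K" for i by (cases i rule: int_cases2) (auto intro: nat minus)
  obtain a b where ab: "quotient_of q = (a, b)" by (cases "quotient_of q")
  have b: "b > 0" using quotient_of_denom_pos[OF ab] .
  have "q = of_int a / of_int b" by (rule quotient_of_div[OF ab])
  hence "(of_rat q :: complex) = of_int a * inverse (of_int b)"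
    by (simp add: of_rat_mult of_rat_inverse divide_inverse)
  moreover have "inverse (of_int b) \<in> ?K"
    using generate_field.m_inv[OF int[of b]] b by (simp add: complex_ring_inv)
  ultimately show ?thesis using generate_field.eng_mult[OF int[of a]] by simp
qed

lemma rpoly_mem_rat_adjoin:
  assumes "x \<in> rat_adjoin y"
  shows "rpoly g x \<in> rat_adjoin y"
proof (induction g)
  case 0
  show ?case unfolding rat_adjoin_def using rat_mem_generate_field[of 0] by simp
next
  case (pCons a g)
  show ?case unfolding rat_adjoin_def rpoly_pCons
    using generate_field.eng_add[OF rat_mem_generate_field[of a] generate_field.eng_mult[OF assms[unfolded rat_adjoin_def] pCons.IH[unfolded rat_adjoin_def]]]
    by simp
qed

lemma mem_rat_adjoin: "x \<in> rat_adjoin x"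
  unfolding rat_adjoin_def by (rule generate_field.incl) simp

lemma rat_adjoin_subset: "x \<in> rat_adjoin y \<Longrightarrow> rat_adjoin x \<subseteq> rat_adjoin y"
  unfolding rat_adjoin_def
  by (rule field.generate_field_min_subfield1[OF field_complex_ring _ field.generate_field_is_subfield[OF field_complex_ring]]) auto

lemma rat_adjoin_eq:
  assumes f: "Factorial_Ring.irreducible f" "rpoly f \<theta> = 0"
  shows "rat_adjoin \<theta> = range (\<lambda>g. rpoly g \<theta>)"
proof (intro equalityI subsetI)
  fix z assume "z \<in> range (\<lambda>g. rpoly g \<theta>)"
  thus "z \<in> rat_adjoin \<theta>" using rpoly_mem_rat_adjoin[OF mem_rat_adjoin] by auto
next
  fix z assume "z \<in> rat_adjoin \<theta>"
  hence "z \<in> generate_field complex_ring {\<theta>}" by (simp add: rat_adjoin_def)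
  thus "z \<in> range (\<lambda>g. rpoly g \<theta>)"
  proof (induction rule: generate_field.induct)
    case one
    show ?case by (rule range_eqI[of _ _ 1]) simp
  next
    case (incl h)
    show ?case by (rule range_eqI[of _ _ "[:0,1:]"]) (use incl in \<open>simp add: rpoly_pCons\<close>)
  next
    case (a_inv h)
    then obtain g where "h = rpoly g \<theta>" by auto
    thus ?case by (intro range_eqI[of _ _ "-g"]) simp
  next
    case (m_inv h)
    then obtain g where g: "h = rpoly g \<theta>" by auto
    \<comment> \<open>Inverses stay polynomials in \<theta>: a Bezout relation between f and g,
      evaluated at \<theta>, exhibits 1/g(\<theta>).\<close>
    have "\<not> f dvd g" using m_inv g f(2) by (auto elim!: dvdE)
    moreover have "Factorial_Ring.prime_elem f" using f(1) by (rule irreducible_imp_prime_elem_gcd)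
    ultimately have "coprime f g" by (rule prime_elem_imp_coprime[rotated])
    hence "fst (bezout_coefficients f g) * f + snd (bezout_coefficients f g) * g = 1"
      by (simp add: bezout_coefficients_fst_snd)
    hence "rpoly (fst (bezout_coefficients f g) * f + snd (bezout_coefficients f g) * g) \<theta> = 1" by simp
    hence "rpoly (snd (bezout_coefficients f g)) \<theta> * h = 1" using f g by simp
    hence "inverse h = rpoly (snd (bezout_coefficients f g)) \<theta>" by (simp add: inverse_unique mult.commute)
    thus ?case using m_inv by (simp add: complex_ring_inv)
  next
    case (eng_add h1 h2)
    then obtain g1 g2 where "h1 = rpoly g1 \<theta>" "h2 = rpoly g2 \<theta>" by auto
    thus ?case by (intro range_eqI[of _ _ "g1 + g2"]) simp
  next
    case (eng_mult h1 h2)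
    then obtain g1 g2 where "h1 = rpoly g1 \<theta>" "h2 = rpoly g2 \<theta>" by auto
    thus ?case by (intro range_eqI[of _ _ "g1 * g2"]) simp
  qed
qed

lemma int_adjoin_eq: "int_adjoin \<eta> = {rpoly h \<eta> | h. \<forall>i. Polynomial.coeff h i \<in> \<int>}"
proof (intro equalityI subsetI)
  fix z assume "z \<in> int_adjoin \<eta>"
  hence "z \<in> generate_ring complex_ring {\<eta>}" by (simp add: int_adjoin_def)
  thus "z \<in> {rpoly h \<eta> | h. \<forall>i. Polynomial.coeff h i \<in> \<int>}"
  proof (induction rule: generate_ring.induct)
    case one
    show ?case by (auto intro!: exI[of _ 1] simp: coeff_1)
  next
    case (incl h)
    thus ?case by (auto intro!: exI[of _ "[:0,1:]"] simp: rpoly_pCons coeff_pCons split: nat.splits)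
  next
    case (a_inv h)
    then obtain g where "h = rpoly g \<eta>" "\<forall>i. Polynomial.coeff g i \<in> \<int>" by auto
    thus ?case by (auto intro!: exI[of _ "-g"])
  next
    case (eng_add h1 h2)
    then obtain g1 g2 where "h1 = rpoly g1 \<eta>" "h2 = rpoly g2 \<eta>"
      "\<forall>i. Polynomial.coeff g1 i \<in> \<int>" "\<forall>i. Polynomial.coeff g2 i \<in> \<int>" by auto
    thus ?case by (auto intro!: exI[of _ "g1 + g2"])
  next
    case (eng_mult h1 h2)
    then obtain g1 g2 where "h1 = rpoly g1 \<eta>" "h2 = rpoly g2 \<eta>"
      "\<forall>i. Polynomial.coeff g1 i \<in> \<int>" "\<forall>i. Polynomial.coeff g2 i \<in> \<int>" by auto
    thus ?case using coeff_mult_mem[of "\<int>" g1 g2] is_subring_Ints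
      by (auto intro!: exI[of _ "g1 * g2"] simp: Ints_def[symmetric])
  qed
next
  let ?B = "generate_ring complex_ring {\<eta>}"
  have one: "1 \<in> ?B" using generate_ring.one[of complex_ring "{\<eta>}"] by simp
  have add: "x + y \<in> ?B" if "x \<in> ?B" "y \<in> ?B" for x y
    using generate_ring.eng_add[OF that] by simp
  have mult: "x * y \<in> ?B" if "x \<in> ?B" "y \<in> ?B" for x y
    using generate_ring.eng_mult[OF that] by simp
  have minus: "- x \<in> ?B" if "x \<in> ?B" for x
    using generate_ring.a_inv[OF that] by simp
  have "is_subring ?B" unfolding is_subring_def
    using one add[OF _ minus] mult by (metis add_uminus_conv_diff)
  note B = is_subringD[OF this]
  fix z assume "z \<in> {rpoly h \<eta> | h. \<forall>i. Polynomial.coeff h i \<in> \<int>}"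
  then obtain h where h: "z = rpoly h \<eta>" "\<forall>i. Polynomial.coeff h i \<in> \<int>" by auto
  have "of_rat (Polynomial.coeff h i) \<in> ?B" for i
    using h(2)[rule_format, of i] B(10) by (elim Ints_cases) simp
  moreover have "\<eta> \<in> ?B" by (rule generate_ring.incl) simp
  ultimately show "z \<in> int_adjoin \<eta>"
    unfolding h rpoly_altdef int_adjoin_def by (intro B(6,7,8))
qed

section \<open>Primitive elements and conjugation\<close>

lemma vector_space_rat_complex: "vector_space (\<lambda>(q::rat) (z::complex). of_rat q * z)"
  by unfold_locales (auto simp: algebra_simps of_rat_add of_rat_mult)

text \<open>A polynomial killing \<eta> = P(\<theta>) also kills its conjugates; there are n
  distinct ones, so none of degree below n does, except zero. Hence the first n powers of \<eta> are
  independent over \<rat>, and as they lie in the span of n powers of \<theta>, they generate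
  it.\<close>

lemma primitive_element:
  assumes f: "Factorial_Ring.irreducible f" "rpoly f \<theta> = 0"
    and inj: "inj_on (rpoly P) {x. rpoly f x = 0}"
  shows "\<exists>h. Polynomial.degree h < Polynomial.degree f \<and> rpoly g \<theta> = rpoly h (rpoly P \<theta>)"
proof -
  interpret Q: vector_space "\<lambda>(q::rat) (z::complex). of_rat q * z"
    by (rule vector_space_rat_complex)
  define n where "n = Polynomial.degree f"
  define A where "A = {x. rpoly f x = 0}"
  define \<eta> where "\<eta> = rpoly P \<theta>"
  have A: "finite A" "card A = n" "\<theta> \<in> A"
    using card_roots_irreducible[OF f(1)] f(2) by (auto simp: A_def n_def)
  hence n0: "n > 0" using card_gt_0_iff by blast
  have zero: "h = 0" if h: "rpoly h \<eta> = 0" "Polynomial.degree h < n" for h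
  proof (rule ccontr)
    assume "h \<noteq> 0"
    have "rpoly h (rpoly P x) = 0" if "x \<in> A" for x
      using rpoly_root_transfer[OF f, of "h \<circ>\<^sub>p P" x] h that by (simp add: \<eta>_def A_def)
    hence "rpoly P ` A \<subseteq> {x. poly (map_poly of_rat h) x = 0}" by (auto simp: rpoly_def)
    moreover have H0: "map_poly of_rat h \<noteq> (0 :: complex poly)"
      using \<open>h \<noteq> 0\<close> by (auto simp: poly_eq_iff coeff_map_poly)
    ultimately have "card (rpoly P ` A) \<le> card {x. poly (map_poly of_rat h :: complex poly) x = 0}"
      by (intro card_mono poly_roots_finite)
    also have "\<dots> \<le> Polynomial.degree h"
      using card_poly_roots_bound[OF H0] by simp
    finally show False using h(2) inj A by (simp add: card_image A_def)
  qed
  \<comment> \<open>Independence is a property of sets, so the powers must be known to be distinct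
    before \<open>B\<close> can have n elements.\<close>
  have inj\<eta>: "inj_on (\<lambda>i. \<eta> ^ i) {..<n}"
  proof (rule inj_onI, rule ccontr)
    fix i j assume ij: "i \<in> {..<n}" "j \<in> {..<n}" "\<eta> ^ i = \<eta> ^ j" "i \<noteq> j"
    have "Polynomial.degree (Polynomial.monom 1 i - Polynomial.monom 1 j :: rat poly) < n"
      using ij by (intro degree_diff_less) (auto simp: Polynomial.degree_monom_eq)
    hence "Polynomial.monom 1 i - Polynomial.monom 1 j = (0 :: rat poly)"
      using ij by (intro zero) auto
    hence "Polynomial.coeff (Polynomial.monom 1 i - Polynomial.monom 1 j :: rat poly) i = 0" by simp
    thus False using ij by simp
  qed
  define B where "B = (\<lambda>i. \<eta> ^ i) ` {..<n}"
  define T where "T = (\<lambda>i. \<theta> ^ i) ` {..<n}"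
  have B: "finite B" "card B = n" using inj\<eta> by (auto simp: B_def card_image)
  have sumB: "(\<Sum>v\<in>B. of_rat (u v) * v) = rpoly (\<Sum>i<n. Polynomial.monom (u (\<eta> ^ i)) i) \<eta>" for u
    using inj\<eta> by (simp add: B_def sum.reindex)
  have degB: "Polynomial.degree (\<Sum>i<n. Polynomial.monom (w i :: rat) i) < n" for w
    by (rule le_less_trans[OF degree_sum_le[of _ _ "n - 1"]])
      (use n0 in \<open>auto intro: order.trans[OF degree_monom_le]\<close>)
  have indep: "Q.independent B"
    unfolding Q.dependent_finite[OF B(1)]
  proof safe
    fix u v assume u: "(\<Sum>v\<in>B. of_rat (u v) * v) = 0" "v \<in> B" "u v \<noteq> 0"
    have 0: "(\<Sum>i<n. Polynomial.monom (u (\<eta> ^ i)) i) = 0"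
      using zero[OF u(1)[unfolded sumB] degB] .
    obtain i where i: "i < n" "v = \<eta> ^ i" using u(2) by (auto simp: B_def)
    have "Polynomial.coeff (\<Sum>i<n. Polynomial.monom (u (\<eta> ^ i)) i) i = u v"
      using i by (simp add: coeff_sum)
    thus False using 0 u(3) by simp
  qed
  have spT: "rpoly g \<theta> \<in> Q.span T" for g
  proof -
    have f0: "f \<noteq> 0" using f by auto
    have "rpoly g \<theta> = rpoly (g mod f + f * (g div f)) \<theta>" by (simp only: mod_mult_div_eq)
    also have "\<dots> = rpoly (g mod f) \<theta>" unfolding rpoly_add rpoly_mult f(2) by simp
    also have "\<dots> = (\<Sum>i<n. of_rat (Polynomial.coeff (g mod f) i) * \<theta> ^ i)"
      using degree_mod_less'[of f g] n0 f0
      by (intro rpoly_altdef_lessThan) (cases "g mod f = 0", auto simp: n_def)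
    also have "\<dots> \<in> Q.span T"
      by (intro Q.span_sum Q.span_scale Q.span_base) (auto simp: T_def)
    finally show ?thesis .
  qed
  have "rpoly g \<theta> \<in> Q.span B"
  proof (rule ccontr)
    assume notin: "rpoly g \<theta> \<notin> Q.span B"
    have "insert (rpoly g \<theta>) B \<subseteq> Q.span T"
      using spT[of g] spT[of "P ^ i" for i] by (auto simp: B_def \<eta>_def)
    hence "card (insert (rpoly g \<theta>) B) \<le> card T"
      using Q.independent_span_bound[of T "insert (rpoly g \<theta>) B"] Q.independent_insertI[OF notin indep]
      by (auto simp: T_def)
    moreover have "card T \<le> n" unfolding T_def using card_image_le[of "{..<n}"] by simp
    moreover have "rpoly g \<theta> \<notin> B" using notin Q.span_base by blast
    ultimately show False using B by simp
  qed
  then obtain u where u: "rpoly g \<theta> = (\<Sum>v\<in>B. of_rat (u v) * v)"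
    unfolding Q.span_finite[OF B(1)] by auto
  show ?thesis
    using degB[of "\<lambda>i. u (\<eta> ^ i)"] u[unfolded sumB] unfolding n_def \<eta>_def
    by (intro exI[of _ "\<Sum>i<Polynomial.degree f. Polynomial.monom (u (rpoly P \<theta> ^ i)) i"]) simp
qed

text \<open>A monic integer equation for g(\<theta>), composed with g, is a relation for \<theta>
  and passes to x.\<close>

lemma algebraic_int_conj:
  assumes f: "Factorial_Ring.irreducible f" "rpoly f \<theta> = 0" "rpoly f x = 0"
    and g: "algebraic_int (rpoly g \<theta>)"
  shows "algebraic_int (rpoly g x)"
proof -
  obtain q where q: "poly (map_poly of_int q) (rpoly g \<theta>) = 0" "Polynomial.lead_coeff q = 1"
    using g by (auto simp: algebraic_int_altdef_ipoly)
  have eq: "rpoly (map_poly of_int q) z = poly (map_poly of_int q) z" for z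
  proof -
    have "map_poly of_rat (map_poly of_int q) = (map_poly of_int q :: complex poly)"
      by (rule poly_eqI) (simp add: coeff_map_poly)
    thus ?thesis by (simp add: rpoly_def)
  qed
  have "rpoly (map_poly of_int q \<circ>\<^sub>p g) x = 0"
    by (rule rpoly_root_transfer[OF f(1,2) _ f(3)]) (use q eq in simp)
  thus ?thesis using q eq by (auto simp: algebraic_int_altdef_ipoly)
qed

text \<open>Stripping factors X from an integer polynomial that kills w leaves a constant term c
  \<noteq> 0, and then c/w is a polynomial in w with integer coefficients.\<close>

lemma algebraic_int_denominator:
  fixes w :: complex
  assumes "w \<noteq> 0" "algebraic_int w"
  obtains d :: int where "d \<noteq> 0" "algebraic_int (of_int d / w)"
proof -
  note R = is_subringD[OF is_subring_algebraic_int[where 'a = complex]]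
  have "\<exists>d::int. d \<noteq> 0 \<and> algebraic_int (of_int d / w)"
    if "poly (map_poly of_int q) w = 0" "q \<noteq> 0" for q :: "int poly"
    using that
  proof (induction q)
    case (pCons c q)
    have eq: "of_int c + w * poly (map_poly of_int q) w = 0"
      using pCons.prems by (simp add: map_poly_pCons)
    show ?case
    proof (cases "c = 0")
      case False
      have "of_int c / w = - poly (map_poly of_int q) w"
        using eq assms(1) by (simp add: field_simps add_eq_0_iff)
      moreover have "poly (map_poly of_int q) w \<in> {x. algebraic_int x}"
        by (rule poly_mem[OF is_subring_algebraic_int]) (use assms in \<open>auto simp: coeff_map_poly\<close>)
      ultimately show ?thesis using False by (intro exI[of _ c]) auto
    next
      case True
      hence "poly (map_poly of_int q) w = 0" "q \<noteq> 0" using eq assms(1) pCons.prems(2) by auto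
      thus ?thesis by (rule pCons.IH)
    qed
  qed auto
  moreover obtain q :: "int poly" where "poly (map_poly of_int q) w = 0" "Polynomial.lead_coeff q = 1"
    using assms by (auto simp: algebraic_int_altdef_ipoly)
  ultimately show ?thesis using that by (metis leading_coeff_0_iff zero_neq_one)
qed

section \<open>Valuation rings above a prime p\<close>

locale p_valuation = valuation_ring V for V :: "complex set" +
  fixes p :: nat
  assumes prime: "Factorial_Ring.prime p" and p_maxi: "of_nat p \<in> maxi"
begin

text \<open>\<open>V\<close> meets \<int> in exactly p\<int>: for i prime to p, a Bezout relation
  prevents p and i from both lying in the maximal ideal.\<close>

lemma of_int_uni_iff: "of_int i \<in> uni \<longleftrightarrow> \<not> int p dvd i"
proof
  assume u: "of_int i \<in> uni"
  show "\<not> int p dvd i"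
  proof
    assume "int p dvd i"
    then obtain j where "i = int p * j" by (elim dvdE)
    hence "(of_int i :: complex) = of_nat p * of_int j" by simp
    hence "of_int i \<in> maxi" using maxi_mult(1)[OF p_maxi closed(10)[of j]] by simp
    thus False using u uni_not_maxi by blast
  qed
next
  assume i: "\<not> int p dvd i"
  have "Factorial_Ring.prime (int p)" using prime by simp
  hence "coprime (int p) i" using i by (intro prime_imp_coprime)
  then obtain u v where uv: "u * int p + v * i = 1"
    by (metis bezout_coefficients_fst_snd coprime_imp_gcd_eq_1)
  show "of_int i \<in> uni"
  proof (rule ccontr)
    assume "of_int i \<notin> uni"
    hence "of_int i \<in> maxi" using uni_or_maxi[OF closed(10)] by blast
    hence "of_int u * of_nat p + of_int v * of_int i \<in> maxi"
      using p_maxi by (intro maxi_add maxi_mult(2) closed)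
    also have "of_int u * of_nat p + of_int v * of_int i = (of_int (u * int p + v * i) :: complex)" by simp
    finally show False using uv uni_not_maxi[OF uni_1] by simp
  qed
qed

lemma of_int_maxi_iff: "of_int i \<in> maxi \<longleftrightarrow> int p dvd i"
  using of_int_uni_iff[of i] uni_not_maxi[of "of_int i"] uni_or_maxi[OF closed(10), of i] by blast

lemma of_nat_uni_iff: "of_nat i \<in> uni \<longleftrightarrow> \<not> p dvd i"
  using of_int_uni_iff[of "int i"] by simp

lemma rat_denominator:
  assumes "of_rat r \<in> V"
  obtains m :: nat where "\<not> p dvd m" "of_nat m * r \<in> \<int>"
proof -
  obtain a b where ab: "quotient_of r = (a, b)" by (cases "quotient_of r")
  have b: "b > 0" and cop: "coprime a b" and r: "r = of_int a / of_int b"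
    using quotient_of_denom_pos[OF ab] quotient_of_coprime[OF ab] quotient_of_div[OF ab] by auto
  have "\<not> int p dvd b"
  proof
    assume pb: "int p dvd b"
    have "(of_int a :: complex) = of_rat r * of_int b" using b by (simp add: r of_rat_divide)
    also have "\<dots> \<in> maxi" using pb assms by (intro maxi_mult) (simp_all add: of_int_maxi_iff)
    finally have "int p dvd a" by (simp add: of_int_maxi_iff)
    with pb cop have "is_unit (int p)" by (rule coprime_common_divisor[rotated -1])
    thus False using prime by auto
  qed
  hence "\<not> p dvd nat b" using b by (metis int_dvd_int_iff int_nat_eq less_imp_le)
  moreover have "of_nat (nat b) * r \<in> \<int>" using b by (simp add: r)
  ultimately show ?thesis using that by blast
qed

end

section \<open>A criterion for an index prime to \<open>p\<close>\<close>

text \<open>By Cauchy's theorem, p dividing the order of R/B would produce a class of order p,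
  against saturation. The finite set \<open>S\<close> makes the index a genuine cardinality; an
  infinite index counts as 0, which p divides.\<close>

lemma add_index_not_dvd:
  fixes R B :: "complex set"
  assumes R: "is_subring R" and B: "is_subring B" "B \<subseteq> R"
    and S: "finite S" "\<And>x. x \<in> R \<Longrightarrow> \<exists>s\<in>S. x - s \<in> B"
    and p: "Factorial_Ring.prime p" "\<And>x. x \<in> R \<Longrightarrow> of_nat p * x \<in> B \<Longrightarrow> x \<in> B"
  shows "\<not> p dvd add_index R B"
proof
  assume dvd: "p dvd add_index R B"
  define G where "G = add_monoid (complex_ring\<lparr>carrier := R\<rparr>)"
  note R' = is_subringD[OF R] and B' = is_subringD[OF B(1)]
  have G: "carrier G = R" "\<And>x y. x \<otimes>\<^bsub>G\<^esub> y = x + y" "\<one>\<^bsub>G\<^esub> = 0"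
    using complex_ring_simps by (simp_all add: G_def)
  interpret comm_group G
  proof (rule comm_groupI)
    fix x assume "x \<in> carrier G"
    thus "\<exists>y\<in>carrier G. y \<otimes>\<^bsub>G\<^esub> x = \<one>\<^bsub>G\<^esub>"
      by (intro bexI[of _ "-x"]) (simp_all add: G R')
  qed (auto simp: G R' algebra_simps)
  have inv: "inv\<^bsub>G\<^esub> x = - x" if "x \<in> R" for x
    by (rule inv_equality) (use that in \<open>auto simp: G R'\<close>)
  have sub: "subgroup B G"
  proof (rule subgroupI)
    show "B \<noteq> {}" using B'(2) by blast
  qed (use B in \<open>auto simp: G B' inv\<close>)
  then interpret normal B G by (rule subgroup_imp_normal)
  have pow: "x [^]\<^bsub>G\<^esub> (n::nat) = of_nat n * x" if "x \<in> R" for x n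
    by (induction n) (simp_all add: G algebra_simps)
  have coset: "B #>\<^bsub>G\<^esub> x = {y. y - x \<in> B}" for x
  proof (intro equalityI subsetI)
    fix y assume "y \<in> {y. y - x \<in> B}"
    thus "y \<in> B #>\<^bsub>G\<^esub> x" by (auto simp: r_coset_def G intro!: bexI[of _ "y - x"])
  qed (auto simp: r_coset_def G)
  have card: "add_index R B = Coset.order (G Mod B)"
    by (simp add: add_index_def Coset.order_def FactGroup_def A_RCOSETS_def G_def)
  have carr: "carrier (G Mod B) = (\<lambda>x. B #>\<^bsub>G\<^esub> x) ` R"
    by (simp add: carrier_FactGroup G)
  have "carrier (G Mod B) \<subseteq> (\<lambda>x. B #>\<^bsub>G\<^esub> x) ` S"
  proof
    fix C assume "C \<in> carrier (G Mod B)"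
    then obtain x where x: "x \<in> R" "C = B #>\<^bsub>G\<^esub> x" by (auto simp: carr)
    then obtain s where s: "s \<in> S" "x - s \<in> B" using S by blast
    have "C = B #>\<^bsub>G\<^esub> s"
      unfolding x coset using s(2) B'(3)[of _ "x - s"] B'(5)[of _ "x - s"] by fastforce
    thus "C \<in> (\<lambda>x. B #>\<^bsub>G\<^esub> x) ` S" using s by blast
  qed
  hence fin: "finite (carrier (G Mod B))" using S finite_subset by blast
  \<comment> \<open>Sylow's theorem with exponent 1 is Cauchy's theorem.\<close>
  obtain m where "Coset.order (G Mod B) = p ^ 1 * m" using dvd by (auto simp: card)
  from sylow_thm[OF p(1) factorgroup_is_group this fin]
  obtain H where H: "subgroup H (G Mod B)" "card H = p" by auto
  have "H \<noteq> {B}" using H(2) p(1) by auto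
  moreover have "B \<in> H" using subgroup.one_closed[OF H(1)] by simp
  ultimately obtain C where C: "C \<in> H" "C \<noteq> B" by blast
  then obtain x where x: "x \<in> R" "C = B #>\<^bsub>G\<^esub> x"
    using subgroup.subset[OF H(1)] by (auto simp: carr)
  interpret H: group "(G Mod B)\<lparr>carrier := H\<rparr>"
    using H(1) factorgroup_is_group by (rule subgroup.subgroup_is_group)
  have "C [^]\<^bsub>(G Mod B)\<lparr>carrier := H\<rparr>\<^esub> p = \<one>\<^bsub>(G Mod B)\<lparr>carrier := H\<rparr>\<^esub>"
    using H.pow_order_eq_1[of C] C(1) H(2) by (simp add: Coset.order_def)
  hence "C [^]\<^bsub>G Mod B\<^esub> p = B" by (simp add: nat_pow_def)
  hence "B #>\<^bsub>G\<^esub> (x [^]\<^bsub>G\<^esub> p) = B"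
    using FactGroup_pow[of x p] x by (simp add: G)
  hence "B #>\<^bsub>G\<^esub> (of_nat p * x) = B" using pow x by simp
  moreover have "of_nat p * x \<in> B #>\<^bsub>G\<^esub> (of_nat p * x)" by (simp add: coset B')
  ultimately have "of_nat p * x \<in> B" by simp
  hence "x \<in> B" using p x by blast
  hence "C = B" unfolding x coset using B'(3,5) by (auto; metis B'(5) diff_add_cancel)
  thus False using C by simp
qed

text \<open>X^n - g is the characteristic polynomial of \<eta>, so the elementary symmetric
  functions of the conjugates are rational. Writing \<eta>^n as g(\<eta>) gives one monic polynomial
  of degree n, the product of the linear factors another; both vanish at the n distinct
  conjugates.\<close>

lemma conjugate_polynomial:
  assumes f: "Factorial_Ring.irreducible f" "rpoly f \<theta> = 0"
    and A_def: "A = {x. rpoly f x = 0}"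
    and inj: "inj_on (rpoly P) A"
  obtains g where "Polynomial.degree g < Polynomial.degree f"
    "rpoly g (rpoly P \<theta>) = rpoly P \<theta> ^ Polynomial.degree f"
    "\<And>i. i < Polynomial.degree f \<Longrightarrow>
      of_rat (Polynomial.coeff g i) = - Polynomial.coeff (\<Prod>y\<in>A. [:- rpoly P y, 1:]) i"
proof -
  define n where "n = Polynomial.degree f"
  define h where "h = rpoly P"
  have A: "finite A" "card A = n"
    using card_roots_irreducible[OF f(1)] by (auto simp: A_def n_def)
  obtain g where g: "Polynomial.degree g < n" "rpoly g (rpoly P \<theta>) = rpoly P \<theta> ^ n"
    using primitive_element[OF f, of P "P ^ n"] inj unfolding A_def n_def by auto
  define M where "M = Polynomial.monom 1 n - map_poly (of_rat :: rat \<Rightarrow> complex) g"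
  define N where "N = (\<Prod>y\<in>A. [:- h y, 1:])"
  have coM: "Polynomial.coeff M n = 1"
    using g(1) by (simp add: M_def coeff_map_poly coeff_eq_0)
  have degM: "Polynomial.degree M \<le> n" unfolding M_def
    using g(1) by (intro degree_diff_le) (auto intro: order.trans[OF degree_monom_le])
  have degN: "Polynomial.degree N = n"
    unfolding N_def using A by (auto simp: degree_prod_eq_sum_degree)
  moreover have "Polynomial.lead_coeff N = 1"
    unfolding N_def by (simp only: lead_coeff_prod) simp
  ultimately have coN: "Polynomial.coeff N n = 1" by simp
  have "M = N"
  proof (rule poly_eqI_degree_lead_coeff[of _ n _ "h ` A"])
    fix z assume "z \<in> h ` A"
    then obtain x where x: "x \<in> A" "z = h x" by auto
    have "rpoly ((Polynomial.monom 1 n - g) \<circ>\<^sub>p P) x = 0"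
      by (rule rpoly_root_transfer[OF f]) (use g x in \<open>auto simp: A_def\<close>)
    hence "h x ^ n - rpoly g (h x) = 0" by (simp add: h_def)
    hence "poly M z = 0" by (simp add: M_def x poly_monom flip: rpoly_def)
    moreover have "poly N z = 0" using x A by (auto simp: N_def poly_prod)
    ultimately show "poly M z = poly N z" by simp
  next
    show "n \<le> card (h ` A)" using A inj by (simp add: card_image h_def)
  qed (use coM degM degN coN in auto)
  have "of_rat (Polynomial.coeff g i) = - Polynomial.coeff (\<Prod>y\<in>A. [:- rpoly P y, 1:]) i" if "i < n" for i
  proof -
    have "- of_rat (Polynomial.coeff g i) = Polynomial.coeff M i"
      using that by (simp add: M_def coeff_map_poly)
    also have "\<dots> = Polynomial.coeff N i" by (simp add: \<open>M = N\<close>)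
    finally show ?thesis by (simp add: N_def h_def minus_equation_iff[of "of_rat _"])
  qed
  thus ?thesis using g that unfolding n_def by blast
qed

context p_valuation
begin

text \<open>The denominators in \<open>disc\<close> are the values of the derivative of the
  characteristic polynomial at the conjugates of \<eta>. Interpolation is used twice: with p in the
  numerator for saturation, and with a common denominator \<open>D\<close> to embed the ring of
  integers in \<int>[\<eta>]/D, which makes the index finite.\<close>

lemma index_not_dvd:
  assumes f: "Factorial_Ring.irreducible f" "rpoly f \<theta> = 0"
    and A_def: "A = {x. rpoly f x = 0}"
    and inj: "inj_on (rpoly P) A"
    and int: "algebraic_int (rpoly P \<theta>)"
    and disc: "\<And>x. x \<in> A \<Longrightarrow> of_nat p / (\<Prod>y\<in>A - {x}. rpoly P x - rpoly P y) \<in> maxi"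
  shows "\<not> p dvd add_index (ring_of_integers (rat_adjoin \<theta>)) (int_adjoin (rpoly P \<theta>))"
    and "rat_adjoin \<theta> = rat_adjoin (rpoly P \<theta>)"
proof -
  define n where "n = Polynomial.degree f"
  define \<eta> where "\<eta> = rpoly P \<theta>"
  define L where "L = rat_adjoin \<theta>"
  define R where "R = ring_of_integers L"
  define B where "B = int_adjoin \<eta>"
  define h where "h = rpoly P"
  note Z = is_subringD[OF is_subring_algebraic_int[where 'a = complex], simplified]
  have A: "finite A" "card A = n" "\<theta> \<in> A"
    using card_roots_irreducible[OF f(1)] f(2) by (auto simp: A_def n_def)
  hence n0: "n > 0" using card_gt_0_iff by blast
  have prim: "\<exists>w. Polynomial.degree w < n \<and> rpoly g \<theta> = rpoly w \<eta>" for g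
    using primitive_element[OF f, of P g] inj unfolding A_def n_def \<eta>_def by simp
  show eq: "rat_adjoin \<theta> = rat_adjoin (rpoly P \<theta>)"
  proof (rule antisym)
    obtain w where "\<theta> = rpoly w \<eta>" using prim[of "[:0,1:]"] by (auto simp: rpoly_pCons)
    hence "\<theta> \<in> rat_adjoin \<eta>" using rpoly_mem_rat_adjoin[OF mem_rat_adjoin] by metis
    thus "rat_adjoin \<theta> \<subseteq> rat_adjoin (rpoly P \<theta>)" unfolding \<eta>_def by (rule rat_adjoin_subset)
    show "rat_adjoin (rpoly P \<theta>) \<subseteq> rat_adjoin \<theta>"
      by (intro rat_adjoin_subset rpoly_mem_rat_adjoin mem_rat_adjoin)
  qed
  have L: "L = range (\<lambda>g. rpoly g \<theta>)" unfolding L_def by (rule rat_adjoin_eq[OF f])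
  have Lmem: "\<exists>w. Polynomial.degree w < n \<and> x = rpoly w \<eta>" if "x \<in> L" for x
    using that prim unfolding L by auto
  have subL: "is_subring L" unfolding is_subring_def L
  proof (intro conjI ballI)
    show "1 \<in> range (\<lambda>g. rpoly g \<theta>)" by (rule range_eqI[of _ _ 1]) simp
    fix x y assume "x \<in> range (\<lambda>g. rpoly g \<theta>)" "y \<in> range (\<lambda>g. rpoly g \<theta>)"
    then obtain g1 g2 where "x = rpoly g1 \<theta>" "y = rpoly g2 \<theta>" by auto
    thus "x - y \<in> range (\<lambda>g. rpoly g \<theta>)" "x * y \<in> range (\<lambda>g. rpoly g \<theta>)"
      by (auto intro: range_eqI[of _ _ "g1 - g2"] range_eqI[of _ _ "g1 * g2"])
  qed
  have subR: "is_subring R"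
    unfolding is_subring_def R_def ring_of_integers_def
    using is_subringD(1,3,6)[OF subL] Z(1,3,6) by auto
  have B: "B = {rpoly g \<eta> | g. \<forall>i. Polynomial.coeff g i \<in> \<int>}"
    unfolding B_def by (rule int_adjoin_eq)
  have subB: "is_subring B" unfolding is_subring_def B
  proof (intro conjI ballI)
    show "1 \<in> {rpoly g \<eta> | g. \<forall>i. Polynomial.coeff g i \<in> \<int>}"
      by (auto intro!: exI[of _ 1] simp: coeff_1)
    fix x y assume "x \<in> {rpoly g \<eta> | g. \<forall>i. Polynomial.coeff g i \<in> \<int>}" "y \<in> {rpoly g \<eta> | g. \<forall>i. Polynomial.coeff g i \<in> \<int>}"
    then obtain g1 g2 where g: "x = rpoly g1 \<eta>" "\<forall>i. Polynomial.coeff g1 i \<in> \<int>" "y = rpoly g2 \<eta>" "\<forall>i. Polynomial.coeff g2 i \<in> \<int>"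
      by auto
    show "x - y \<in> {rpoly g \<eta> | g. \<forall>i. Polynomial.coeff g i \<in> \<int>}"
      using g by (auto intro!: exI[of _ "g1 - g2"])
    show "x * y \<in> {rpoly g \<eta> | g. \<forall>i. Polynomial.coeff g i \<in> \<int>}"
      using g coeff_mult_mem[of "\<int>" g1 g2] is_subring_Ints
      by (auto intro!: exI[of _ "g1 * g2"] simp: Ints_def[symmetric])
  qed
  note B' = is_subringD[OF subB] and R' = is_subringD[OF subR]
  have \<eta>R: "\<eta> \<in> R" unfolding R_def ring_of_integers_def L using int by (auto simp: \<eta>_def)
  have \<eta>B: "\<eta> \<in> B" unfolding B
    by (auto intro!: exI[of _ "[:0,1:]"] simp: rpoly_pCons coeff_pCons split: nat.splits)
  have BR: "B \<subseteq> R"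
  proof
    fix x assume "x \<in> B"
    then obtain g where g: "x = rpoly g \<eta>" "\<forall>i. Polynomial.coeff g i \<in> \<int>" by (auto simp: B)
    have "of_rat (Polynomial.coeff g i) \<in> R" for i
      using g(2)[rule_format, of i] R'(10) by (elim Ints_cases) simp
    thus "x \<in> R" unfolding g rpoly_altdef using \<eta>R by (intro R'(6,7,8)) auto
  qed
  have hint: "algebraic_int (h x)" if "x \<in> A" for x
    using algebraic_int_conj[OF f _ int, of x] that by (simp add: h_def A_def)
  have conj: "algebraic_int (rpoly w (h x))" if "x \<in> A" "algebraic_int (rpoly w \<eta>)" for x w
    using algebraic_int_conj[OF f, of x "w \<circ>\<^sub>p P"] that by (simp add: h_def A_def \<eta>_def)
  have lagr: "of_rat (Polynomial.coeff w i) = (\<Sum>x\<in>A. rpoly w (h x) / (\<Prod>y\<in>A - {x}. h x - h y)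
      * Polynomial.coeff (\<Prod>y\<in>A - {x}. [:- h y, 1:]) i)" if "Polynomial.degree w < n" for w i
  proof -
    have "of_rat (Polynomial.coeff w i) = Polynomial.coeff (map_poly of_rat w) i"
      by (simp add: coeff_map_poly)
    also have "\<dots> = (\<Sum>x\<in>A. poly (map_poly of_rat w) (h x) / (\<Prod>y\<in>A - {x}. h x - h y)
      * Polynomial.coeff (\<Prod>y\<in>A - {x}. [:- h y, 1:]) i)"
      by (subst lagrange_interpolation[OF A(1), of h "map_poly of_rat w"])
        (use inj that A in \<open>auto simp: coeff_sum h_def\<close>)
    finally show ?thesis by (simp add: rpoly_def)
  qed
  have nz: "(\<Prod>y\<in>A - {x}. h x - h y) \<noteq> 0" if "x \<in> A" for x
    using that inj A by (auto simp: inj_on_def h_def)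
  have hdiff: "algebraic_int (\<Prod>y\<in>A - {x}. h x - h y)" if "x \<in> A" for x
    using that hint by (intro Z(9) Z(3)) auto
  have cint: "algebraic_int (Polynomial.coeff (\<Prod>y\<in>A - {x}. [:- h y, 1:]) i)" for x i
    using coeff_prod_linear_mem[OF is_subring_algebraic_int, of "A - {x}" h i] hint by auto
  have "\<exists>d::int. d \<noteq> 0 \<and> algebraic_int (of_int d / (\<Prod>y\<in>A - {x}. h x - h y))" if "x \<in> A" for x
    using algebraic_int_denominator[OF nz[OF that] hdiff[OF that]] by blast
  then obtain d :: "complex \<Rightarrow> int" where d: "\<And>x. x \<in> A \<Longrightarrow> d x \<noteq> 0"
    "\<And>x. x \<in> A \<Longrightarrow> algebraic_int (of_int (d x) / (\<Prod>y\<in>A - {x}. h x - h y))" by metis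
  \<comment> \<open>\<open>D\<close> makes every Lagrange quotient integral, so D times a
    coefficient of an integral element is both rational and integral, hence an integer.\<close>
  define D where "D = nat \<bar>\<Prod>x\<in>A. d x\<bar>"
  have D0: "D > 0" using d A by (simp add: D_def)
  have Dint: "algebraic_int (of_nat D / (\<Prod>y\<in>A - {x}. h x - h y))" if x: "x \<in> A" for x
  proof -
    have "(of_nat D :: complex) = of_int \<bar>\<Prod>x\<in>A. d x\<bar>" by (simp add: D_def)
    moreover have "\<bar>\<Prod>x\<in>A. d x\<bar> = sgn (\<Prod>x\<in>A. d x) * (\<Prod>x\<in>A - {x}. d x) * d x"
      using x A by (simp add: abs_sgn prod.remove[of A x] mult_ac)
    ultimately have "of_nat D / (\<Prod>y\<in>A - {x}. h x - h y) =
      of_int (sgn (\<Prod>x\<in>A. d x) * (\<Prod>x\<in>A - {x}. d x)) * (of_int (d x) / (\<Prod>y\<in>A - {x}. h x - h y))"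
      by simp
    also have "algebraic_int \<dots>" by (rule Z(6)[OF algebraic_int_of_int d(2)[OF x]])
    finally show ?thesis .
  qed
  have Dcoeff: "of_nat D * Polynomial.coeff w i \<in> \<int>"
    if w: "Polynomial.degree w < n" "algebraic_int (rpoly w \<eta>)" for w i
  proof -
    have "of_rat (of_nat D * Polynomial.coeff w i) = of_nat D * (of_rat (Polynomial.coeff w i) :: complex)"
      by (simp add: of_rat_mult)
    also have "\<dots> = (\<Sum>x\<in>A. rpoly w (h x) * (of_nat D / (\<Prod>y\<in>A - {x}. h x - h y))
      * Polynomial.coeff (\<Prod>y\<in>A - {x}. [:- h y, 1:]) i)"
      unfolding lagr[OF w(1)] by (simp add: sum_distrib_left mult_ac)
    also have "algebraic_int \<dots>"
      using conj[OF _ w(2)] Dint cint by (intro Z(8) Z(6)) auto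
    finally have "(of_rat (of_nat D * Polynomial.coeff w i) :: complex) \<in> \<int>"
      by (rule rational_algebraic_int_is_int) simp
    then obtain k where "(of_rat (of_nat D * Polynomial.coeff w i) :: complex) = of_int k" by (elim Ints_cases)
    hence "(of_rat (of_nat D * Polynomial.coeff w i) :: complex) = of_rat (of_int k)" by simp
    hence "of_nat D * Polynomial.coeff w i = of_int k" by (simp only: of_rat_eq_iff)
    thus ?thesis by simp
  qed
  have \<eta>n: "\<exists>g. (\<forall>i. Polynomial.coeff g i \<in> \<int>) \<and> Polynomial.degree g < n \<and> rpoly g \<eta> = \<eta> ^ n"
  proof -
    obtain g where g: "Polynomial.degree g < n" "rpoly g \<eta> = \<eta> ^ n"
      "\<And>i. i < n \<Longrightarrow> of_rat (Polynomial.coeff g i) = - Polynomial.coeff (\<Prod>y\<in>A. [:- h y, 1:]) i"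
      using conjugate_polynomial[OF f A_def inj] by (auto simp: n_def \<eta>_def h_def)
    have "Polynomial.coeff g i \<in> \<int>" for i
    proof (cases "i < n")
      case True
      note g(3)[OF True]
      also have "algebraic_int (- Polynomial.coeff (\<Prod>y\<in>A. [:- h y, 1:]) i)"
        using coeff_prod_linear_mem[OF is_subring_algebraic_int, of A h i] hint
        by (intro algebraic_int_minus) auto
      finally have "(of_rat (Polynomial.coeff g i) :: complex) \<in> \<int>"
        by (rule rational_algebraic_int_is_int) simp
      then obtain k where "(of_rat (Polynomial.coeff g i) :: complex) = of_int k" by (elim Ints_cases)
      hence "(of_rat (Polynomial.coeff g i) :: complex) = of_rat (of_int k)" by simp
      hence "Polynomial.coeff g i = of_int k" by (simp only: of_rat_eq_iff)
      thus ?thesis by simp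
    qed (use g in \<open>simp add: coeff_eq_0\<close>)
    thus ?thesis using g by blast
  qed
  have Bred: "\<exists>g. (\<forall>i. Polynomial.coeff g i \<in> \<int>) \<and> Polynomial.degree g < n \<and> x = rpoly g \<eta>" if "x \<in> B" for x
  proof -
    obtain g0 where g0: "\<forall>i. Polynomial.coeff g0 i \<in> \<int>" "Polynomial.degree g0 < n" "rpoly g0 \<eta> = \<eta> ^ n"
      using \<eta>n by blast
    have "\<exists>g. (\<forall>i. Polynomial.coeff g i \<in> \<int>) \<and> Polynomial.degree g < n \<and> rpoly q \<eta> = rpoly g \<eta>"
      if "\<forall>i. Polynomial.coeff q i \<in> \<int>" for q
      using that
    proof (induction q)
      case 0
      show ?case by (rule exI[of _ 0]) (use n0 in auto)
    next
      case (pCons a q)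
      have a: "a \<in> \<int>" using pCons.prems[rule_format, of 0] by simp
      have "\<forall>i. Polynomial.coeff q i \<in> \<int>" using pCons.prems by (metis coeff_pCons_Suc)
      then obtain g where g: "\<forall>i. Polynomial.coeff g i \<in> \<int>" "Polynomial.degree g < n" "rpoly q \<eta> = rpoly g \<eta>"
        using pCons.IH by blast
      \<comment> \<open>Multiplication by X moves this coefficient to X^n, where it is removed by
        \<eta>^n = g0(\<eta>).\<close>
      define c where "c = Polynomial.coeff g (n - 1)"
      define g1 where "g1 = pCons a g - Polynomial.monom c n + Polynomial.smult c g0"
      have c: "c \<in> \<int>" using g by (simp add: c_def)
      have "\<forall>i. Polynomial.coeff g1 i \<in> \<int>"
        using a c g g0 by (auto simp: g1_def coeff_pCons split: nat.splits)
      moreover have "Polynomial.degree g1 < n"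
      proof -
        have "Polynomial.coeff g1 i = 0" if "i > n - 1" for i
        proof (cases "i = n")
          case True
          thus ?thesis using n0 g0 by (auto simp: g1_def c_def coeff_pCons coeff_eq_0 split: nat.splits)
        next
          case False
          hence "i > n" using that by simp
          thus ?thesis using g g0 by (auto simp: g1_def coeff_pCons coeff_eq_0 split: nat.splits)
        qed
        hence "Polynomial.degree g1 \<le> n - 1" by (intro degree_le) auto
        thus ?thesis using n0 by linarith
      qed
      moreover have "rpoly (pCons a q) \<eta> = rpoly g1 \<eta>"
        by (simp add: g1_def rpoly_pCons g(3) g0(3))
      ultimately show ?case by blast
    qed
    thus ?thesis using that by (auto simp: B)
  qed
  \<comment> \<open>Representatives modulo \<int>[\<eta>]: the numerators over \<open>D\<close>,
    reduced modulo \<open>D\<close>.\<close>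
  define S where "S = (\<lambda>c. (\<Sum>i<n. of_int (c i) / of_nat D * \<eta> ^ i)) ` ({..<n} \<rightarrow>\<^sub>E {0..<int D})"
  show "\<not> p dvd add_index (ring_of_integers (rat_adjoin \<theta>)) (int_adjoin (rpoly P \<theta>))"
    unfolding \<eta>_def[symmetric] B_def[symmetric] L_def[symmetric] R_def[symmetric]
  proof (rule add_index_not_dvd[OF subR subB BR _ _ prime])
    show "finite S" unfolding S_def by (intro finite_imageI finite_PiE) auto
  next
    fix x assume x: "x \<in> R"
    then obtain w where w: "Polynomial.degree w < n" "x = rpoly w \<eta>"
      using Lmem by (auto simp: R_def ring_of_integers_def)
    have "algebraic_int (rpoly w \<eta>)" using x w by (auto simp: R_def ring_of_integers_def)
    hence "\<exists>k. of_nat D * Polynomial.coeff w i = of_int k" for i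
      using Dcoeff[OF w(1), of i] by (auto elim: Ints_cases)
    then obtain c where c: "\<And>i. of_nat D * Polynomial.coeff w i = of_int (c i)" by metis
    define c' where "c' = restrict (\<lambda>i. c i mod int D) {..<n}"
    have coef: "of_rat (Polynomial.coeff w i) = (of_int (c i) / of_nat D :: complex)" for i
    proof -
      have "Polynomial.coeff w i = of_int (c i) / of_nat D" using c[of i] D0 by (simp add: field_simps)
      thus ?thesis by (simp add: of_rat_divide)
    qed
    have "x = (\<Sum>i<n. of_int (c i) / of_nat D * \<eta> ^ i)"
      unfolding w(2) rpoly_altdef_lessThan[OF w(1)] by (simp add: coef)
    moreover have diff: "of_int (c i) / of_nat D - of_int (c' i) / of_nat D = (of_int (c i div int D) :: complex)"
      if "i < n" for i
    proof -
      have "(of_int (c i) :: complex) = of_int (int D * (c i div int D) + c i mod int D)" by simp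
      also have "\<dots> = of_nat D * of_int (c i div int D) + of_int (c i mod int D)"
        by (simp only: of_int_add of_int_mult of_int_of_nat_eq)
      finally have *: "(of_int (c i) :: complex) = of_nat D * of_int (c i div int D) + of_int (c i mod int D)" .
      have "(of_int (c i) / of_nat D :: complex) = of_int (c i div int D) + of_int (c i mod int D) / of_nat D"
        unfolding * using D0 by (simp add: add_divide_distrib)
      thus ?thesis using that by (simp add: c'_def)
    qed
    ultimately have "x - (\<Sum>i<n. of_int (c' i) / of_nat D * \<eta> ^ i)
        = (\<Sum>i<n. (of_int (c i) / of_nat D - of_int (c' i) / of_nat D) * \<eta> ^ i)"
      by (simp only: sum_subtractf left_diff_distrib)
    also have "\<dots> = (\<Sum>i<n. of_int (c i div int D) * \<eta> ^ i)"
      by (intro sum.cong refl) (simp only: diff lessThan_iff)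
    also have "\<dots> \<in> B" using \<eta>B by (intro B'(6,7,8,10))
    finally have "x - (\<Sum>i<n. of_int (c' i) / of_nat D * \<eta> ^ i) \<in> B" .
    moreover have "c' \<in> {..<n} \<rightarrow>\<^sub>E {0..<int D}"
      using D0 unfolding c'_def restrict_PiE_iff by auto
    ultimately show "\<exists>s\<in>S. x - s \<in> B" unfolding S_def by blast
  next
    fix x assume x: "x \<in> R" and px: "of_nat p * x \<in> B"
    have p0: "p > 0" using prime by (simp add: prime_gt_0_nat)
    obtain g where g: "\<forall>i. Polynomial.coeff g i \<in> \<int>" "Polynomial.degree g < n" "of_nat p * x = rpoly g \<eta>"
      using Bred[OF px] by blast
    define w where "w = Polynomial.smult (1 / of_nat p) g"
    have w: "Polynomial.degree w < n" "x = rpoly w \<eta>"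
      using g p0 by (auto simp: w_def of_rat_divide field_simps)
    have xint: "algebraic_int (rpoly w \<eta>)" using x w by (simp add: R_def ring_of_integers_def)
    have co: "Polynomial.coeff g i = of_nat p * Polynomial.coeff w i" for i
      using p0 by (simp add: w_def)
    have "Polynomial.coeff w i \<in> \<int>" for i
    proof -
      obtain k where k: "Polynomial.coeff g i = of_int k" using g(1)[rule_format, of i] by (elim Ints_cases)
      have "of_int k = (of_rat (Polynomial.coeff g i) :: complex)" by (simp add: k)
      also have "\<dots> = of_nat p * of_rat (Polynomial.coeff w i)" unfolding co by (simp add: of_rat_mult)
      also have "\<dots> = (\<Sum>x\<in>A. of_nat p / (\<Prod>y\<in>A - {x}. h x - h y) * (rpoly w (h x)
          * Polynomial.coeff (\<Prod>y\<in>A - {x}. [:- h y, 1:]) i))"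
        unfolding lagr[OF w(1)] by (simp add: sum_distrib_left mult_ac)
      \<comment> \<open>Every term is a quotient from \<open>disc\<close> times an element of
        \<open>V\<close>. The integer k therefore lies in the maximal ideal, that is, in
        p\<int>.\<close>
      also have "\<dots> \<in> maxi"
        using disc conj[OF _ xint] cint
        by (intro maxi_sum maxi_mult(1) closed(6)) (auto simp: h_def intro: algebraic_int_mem)
      finally obtain j where "k = int p * j" by (auto simp: of_int_maxi_iff)
      thus ?thesis using p0 by (simp add: w_def k)
    qed
    thus "x \<in> B" unfolding B w(2) by blast
  qed
qed

text \<open>Integrality of the witness is asked only at \<open>V\<close>: its characteristic
  polynomial has coefficients in \<int> localised at p, so a factor m' prime to p turns P(\<theta>)
  into an algebraic integer while changing the quotients in \<open>disc\<close> by units.\<close>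

theorem field_index_not_dvd:
  assumes f: "Factorial_Ring.irreducible f" "rpoly f \<theta> = 0"
    and A_def: "A = {x. rpoly f x = 0}"
    and inj: "inj_on (rpoly P) A"
    and mem: "\<And>x. x \<in> A \<Longrightarrow> rpoly P x \<in> V"
    and disc: "\<And>x. x \<in> A \<Longrightarrow> of_nat p / (\<Prod>y\<in>A - {x}. rpoly P x - rpoly P y) \<in> maxi"
  shows "\<not> p dvd field_index (rat_adjoin \<theta>)"
proof -
  define n where "n = Polynomial.degree f"
  define \<eta> where "\<eta> = rpoly P \<theta>"
  define h where "h = rpoly P"
  have A: "finite A" "card A = n" "\<theta> \<in> A"
    using card_roots_irreducible[OF f(1)] f(2) by (auto simp: A_def n_def)
  hence n0: "n > 0" using card_gt_0_iff by blast
  obtain g where g: "Polynomial.degree g < n" "rpoly g \<eta> = \<eta> ^ n"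
    "\<And>i. i < n \<Longrightarrow> of_rat (Polynomial.coeff g i) = - Polynomial.coeff (\<Prod>y\<in>A. [:- h y, 1:]) i"
    using conjugate_polynomial[OF f A_def inj] by (auto simp: n_def \<eta>_def h_def)
  have "\<exists>m. \<not> p dvd m \<and> of_nat m * Polynomial.coeff g i \<in> \<int>" if "i < n" for i
  proof -
    note g(3)[OF that]
    also have "- Polynomial.coeff (\<Prod>y\<in>A. [:- h y, 1:]) i \<in> V"
      using mem by (intro closed(4) coeff_prod_linear_mem is_subring) (auto simp: h_def)
    finally show ?thesis by (elim rat_denominator) blast
  qed
  then obtain m where m: "\<And>i. i < n \<Longrightarrow> \<not> p dvd m i" "\<And>i. i < n \<Longrightarrow> of_nat (m i) * Polynomial.coeff g i \<in> \<int>"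
    by metis
  define m' where "m' = (\<Prod>i<n. m i)"
  have m'p: "\<not> p dvd m'" using m(1) prime by (auto simp: m'_def prime_dvd_prod_iff)
  have m'g: "of_nat m' * Polynomial.coeff g i \<in> \<int>" for i
  proof (cases "i < n")
    case True
    hence "of_nat m' * Polynomial.coeff g i = of_nat (\<Prod>j\<in>{..<n} - {i}. m j) * (of_nat (m i) * Polynomial.coeff g i)"
      by (simp add: m'_def prod.remove[of "{..<n}" i] mult_ac)
    thus ?thesis using m(2)[OF True] by (metis Ints_mult Ints_of_nat)
  qed (use g in \<open>simp add: coeff_eq_0\<close>)
  define Q where "Q = Polynomial.smult (of_nat m') P"
  have Q: "rpoly Q x = of_nat m' * rpoly P x" for x by (simp add: Q_def)
  have m'0: "m' \<noteq> 0" using m'p by (metis dvd_0_right)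
  have int: "algebraic_int (rpoly Q \<theta>)"
  proof (rule algebraic_int.intros)
    \<comment> \<open>The equation of \<eta> multiplied by m'^n and read as one for m' \<eta>: the
      coefficient of X^i keeps the factor m'^(n-i), enough to clear its denominator.\<close>
    define q :: "complex poly" where "q = Polynomial.monom 1 n - (\<Sum>i<n. Polynomial.monom (of_rat (of_nat m' ^ (n - i) * Polynomial.coeff g i)) i)"
    have co: "Polynomial.coeff q i = (if i = n then 1 else if i < n then - of_rat (of_nat m' ^ (n - i) * Polynomial.coeff g i) else 0)" for i
      by (auto simp: q_def coeff_sum)
    have "Polynomial.degree q = n" by (intro antisym degree_le le_degree) (auto simp: co)
    thus "Polynomial.lead_coeff q = 1" by (simp add: co)
    have "(of_rat (of_nat m' ^ (n - i) * Polynomial.coeff g i) :: complex) \<in> \<int>" if i: "i < n" for i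
    proof -
      obtain k where k: "n - i = Suc k" using i by (cases "n - i") auto
      have "of_nat m' ^ (n - i) * Polynomial.coeff g i = of_nat m' ^ k * (of_nat m' * Polynomial.coeff g i)"
        by (simp add: k)
      also have "\<dots> \<in> \<int>" by (rule Ints_mult[OF Ints_power[OF Ints_of_nat] m'g])
      finally show ?thesis by (elim Ints_cases) simp
    qed
    thus "\<forall>i. Polynomial.coeff q i \<in> \<int>" by (auto simp: co)
    have "(\<Sum>i<n. of_rat (of_nat m' ^ (n - i) * Polynomial.coeff g i) * rpoly Q \<theta> ^ i)
        = of_nat m' ^ n * (\<Sum>i<n. of_rat (Polynomial.coeff g i) * \<eta> ^ i)"
      unfolding sum_distrib_left
    proof (intro sum.cong refl)
      fix i assume "i \<in> {..<n}"
      hence "(of_nat m' :: complex) ^ n = of_nat m' ^ (n - i) * of_nat m' ^ i"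
        by (simp flip: power_add)
      thus "of_rat (of_nat m' ^ (n - i) * Polynomial.coeff g i) * rpoly Q \<theta> ^ i
          = of_nat m' ^ n * (of_rat (Polynomial.coeff g i) * \<eta> ^ i)"
        by (simp add: Q \<eta>_def of_rat_mult of_rat_power power_mult_distrib mult_ac)
    qed
    also have "\<dots> = of_nat m' ^ n * \<eta> ^ n" by (simp flip: g(2) rpoly_altdef_lessThan[OF g(1)])
    also have "\<dots> = rpoly Q \<theta> ^ n" by (simp add: Q \<eta>_def power_mult_distrib)
    finally show "poly q (rpoly Q \<theta>) = 0" by (simp add: q_def poly_sum poly_monom)
  qed
  have inj': "inj_on (rpoly Q) A" using inj m'0 by (auto simp: inj_on_def Q)
  have disc': "of_nat p / (\<Prod>y\<in>A - {x}. rpoly Q x - rpoly Q y) \<in> maxi" if x: "x \<in> A" for x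
  proof -
    have "(\<Prod>y\<in>A - {x}. rpoly Q x - rpoly Q y) = (\<Prod>y\<in>A - {x}. of_nat m' * (rpoly P x - rpoly P y))"
      by (simp add: Q right_diff_distrib)
    also have "\<dots> = of_nat m' ^ card (A - {x}) * (\<Prod>y\<in>A - {x}. rpoly P x - rpoly P y)"
      by (simp add: prod.distrib)
    finally have "of_nat p / (\<Prod>y\<in>A - {x}. rpoly Q x - rpoly Q y)
        = of_nat p / (\<Prod>y\<in>A - {x}. rpoly P x - rpoly P y) * inverse (of_nat m' ^ card (A - {x}))"
      by (simp add: field_simps)
    also have "\<dots> \<in> maxi"
      using m'p by (intro maxi_mult(1) disc[OF x] uni_mem uni_inverse uni_power) (simp add: of_nat_uni_iff)
    finally show ?thesis .
  qed
  note ind = index_not_dvd[OF f A_def inj' int disc']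
  have "rpoly Q \<theta> \<in> rat_adjoin \<theta>" by (intro rpoly_mem_rat_adjoin mem_rat_adjoin)
  hence "rpoly Q \<theta> \<in> ring_of_integers (rat_adjoin \<theta>)" using int by (simp add: ring_of_integers_def)
  hence "field_index (rat_adjoin \<theta>) dvd add_index (ring_of_integers (rat_adjoin \<theta>)) (int_adjoin (rpoly Q \<theta>))"
    unfolding field_index_def using ind(2) by (intro Gcd_dvd) blast
  thus ?thesis using ind(1) dvd_trans by blast
qed

end

section \<open>Tame generators\<close>

text \<open>Working with functions lets a witness be written as an expression in the root; the
  closure rules below then supply the polynomial.\<close>

definition rat_fun :: "(complex \<Rightarrow> complex) \<Rightarrow> bool"
  where "rat_fun \<phi> \<longleftrightarrow> (\<exists>P. \<phi> = rpoly P)"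

lemma rat_fun_const: "rat_fun (\<lambda>x. of_rat r)"
  and rat_fun_of_nat: "rat_fun (\<lambda>x. of_nat k)"
  and rat_fun_id: "rat_fun (\<lambda>x. x)"
  unfolding rat_fun_def
  by (rule exI[of _ "[:r:]"] exI[of _ "[:of_nat k:]"] exI[of _ "[:0,1:]"];
      simp add: fun_eq_iff rpoly_pCons)+

lemma rat_fun_add: "rat_fun \<phi> \<Longrightarrow> rat_fun \<psi> \<Longrightarrow> rat_fun (\<lambda>x. \<phi> x + \<psi> x)"
  unfolding rat_fun_def
proof (elim exE)
  fix P Q assume "\<phi> = rpoly P" "\<psi> = rpoly Q"
  thus "\<exists>R. (\<lambda>x. \<phi> x + \<psi> x) = rpoly R" by (intro exI[of _ "P + Q"]) (simp add: fun_eq_iff)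
qed

lemma rat_fun_diff: "rat_fun \<phi> \<Longrightarrow> rat_fun \<psi> \<Longrightarrow> rat_fun (\<lambda>x. \<phi> x - \<psi> x)"
  unfolding rat_fun_def
proof (elim exE)
  fix P Q assume "\<phi> = rpoly P" "\<psi> = rpoly Q"
  thus "\<exists>R. (\<lambda>x. \<phi> x - \<psi> x) = rpoly R" by (intro exI[of _ "P - Q"]) (simp add: fun_eq_iff)
qed

lemma rat_fun_mult: "rat_fun \<phi> \<Longrightarrow> rat_fun \<psi> \<Longrightarrow> rat_fun (\<lambda>x. \<phi> x * \<psi> x)"
  unfolding rat_fun_def
proof (elim exE)
  fix P Q assume "\<phi> = rpoly P" "\<psi> = rpoly Q"
  thus "\<exists>R. (\<lambda>x. \<phi> x * \<psi> x) = rpoly R" by (intro exI[of _ "P * Q"]) (simp add: fun_eq_iff)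
qed

lemma rat_fun_power: "rat_fun \<phi> \<Longrightarrow> rat_fun (\<lambda>x. \<phi> x ^ n)"
  unfolding rat_fun_def
proof (elim exE)
  fix P assume "\<phi> = rpoly P"
  thus "\<exists>R. (\<lambda>x. \<phi> x ^ n) = rpoly R" by (intro exI[of _ "P ^ n"]) (simp add: fun_eq_iff)
qed

lemma rat_fun_compose: "rat_fun \<phi> \<Longrightarrow> rat_fun \<psi> \<Longrightarrow> rat_fun (\<lambda>x. \<phi> (\<psi> x))"
  unfolding rat_fun_def
proof (elim exE)
  fix P Q assume "\<phi> = rpoly P" "\<psi> = rpoly Q"
  thus "\<exists>R. (\<lambda>x. \<phi> (\<psi> x)) = rpoly R" by (intro exI[of _ "P \<circ>\<^sub>p Q"]) (simp add: fun_eq_iff)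
qed

lemma rat_fun_divide_const:
  assumes "rat_fun \<phi>" "c \<in> \<rat>"
  shows "rat_fun (\<lambda>x. \<phi> x / c)"
proof -
  have "inverse c \<in> \<rat>" using assms(2) by (rule Rats_inverse)
  then obtain r where "inverse c = of_rat r" by (elim Rats_cases)
  thus ?thesis using rat_fun_mult[OF assms(1) rat_fun_const[of r]] by (simp add: divide_inverse)
qed

context valuation_ring
begin

lemma power_sum_cong:
  assumes "a - b \<in> maxi" "a \<in> V" "b \<in> V"
  shows "(\<Sum>i<n. b ^ (n - Suc i) * a ^ i) - of_nat n * b ^ (n - 1) \<in> maxi"
proof -
  have "of_nat n * b ^ (n - 1) = (\<Sum>i<n. b ^ (n - Suc i) * b ^ i)"
    by (simp flip: power_add)
  hence "(\<Sum>i<n. b ^ (n - Suc i) * a ^ i) - of_nat n * b ^ (n - 1) = (\<Sum>i<n. b ^ (n - Suc i) * (a ^ i - b ^ i))"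
    by (simp add: sum_subtractf right_diff_distrib)
  also have "\<dots> \<in> maxi" using assms by (intro maxi_sum maxi_mult(2) power_cong_maxi closed(7))
  finally show ?thesis .
qed

text \<open>The cofactor of a - b is congruent to n b^(n-1). That n is a unit is the tameness
  condition.\<close>

lemma power_diff_unit:
  assumes "a - b \<in> maxi" "a \<in> V" "b \<in> uni" "of_nat n \<in> uni"
  obtains s where "s \<in> uni" "a ^ n - b ^ n = (a - b) * s"
proof
  show "a ^ n - b ^ n = (a - b) * (\<Sum>i<n. b ^ (n - Suc i) * a ^ i)" by (rule power_diff_sumr2)
  have "of_nat n * b ^ (n - 1) + ((\<Sum>i<n. b ^ (n - Suc i) * a ^ i) - of_nat n * b ^ (n - 1)) \<in> uni"
    using assms(3,4) by (intro uni_add_maxi uni_mult uni_power power_sum_cong[OF assms(1,2) uni_mem[OF assms(3)]])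
  thus "(\<Sum>i<n. b ^ (n - Suc i) * a ^ i) \<in> uni" by simp
qed

lemma uni_cong: "x - y \<in> maxi \<Longrightarrow> y \<in> uni \<Longrightarrow> x \<in> uni"
  using uni_add_maxi[of y "x - y"] by simp

lemma maxi_divide_uni: "x \<in> maxi \<Longrightarrow> y \<in> uni \<Longrightarrow> x / y \<in> maxi"
  by (simp add: divide_inverse maxi_mult(1) uni_inverse uni_mem)

end

context p_valuation
begin

text \<open>Injectivity must be demanded separately: if two values of \<open>\<phi>\<close> agree, the product is \<open>0\<close> and
  \<open>p / 0 = 0\<close> lies in the maximal ideal.\<close>

definition tame_on :: "complex set \<Rightarrow> (complex \<Rightarrow> complex) \<Rightarrow> bool"
  where "tame_on A \<phi> \<longleftrightarrow> inj_on \<phi> A \<and> (\<forall>x\<in>A. \<phi> x \<in> V) \<and>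
    (\<forall>x\<in>A. of_nat p / (\<Prod>y\<in>A - {x}. \<phi> x - \<phi> y) \<in> maxi)"

lemma p_nz: "of_nat p \<noteq> (0 :: complex)"
  using prime by auto

text \<open>Seen from x, the other roots split into a class \<open>C\<close>, where differences are
  w times a unit, and the rest, where they are units. Their product is therefore w^(card C) times a
  unit.\<close>

lemma tame_onI:
  assumes A: "finite A" and V: "\<And>x. x \<in> A \<Longrightarrow> \<phi> x \<in> V"
    and ex: "\<And>x. x \<in> A \<Longrightarrow> \<exists>C w. C \<subseteq> A - {x} \<and> w \<noteq> 0 \<and> (\<forall>y\<in>A - {x} - C. \<phi> x - \<phi> y \<in> uni) \<and>
      (\<forall>y\<in>C. (\<phi> x - \<phi> y) / w \<in> uni) \<and> of_nat p / w ^ card C \<in> maxi"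
  shows "tame_on A \<phi>"
proof -
  have nz: "\<phi> x - \<phi> y \<noteq> 0" if xy: "x \<in> A" "y \<in> A" "x \<noteq> y" for x y
  proof -
    obtain C w where "\<forall>y\<in>A - {x} - C. \<phi> x - \<phi> y \<in> uni" "\<forall>y\<in>C. (\<phi> x - \<phi> y) / w \<in> uni"
      using ex[OF xy(1)] by blast
    hence "(y \<in> C \<longrightarrow> (\<phi> x - \<phi> y) / w \<in> uni) \<and> (y \<notin> C \<longrightarrow> \<phi> x - \<phi> y \<in> uni)" using xy by simp
    thus ?thesis using uni_nz[of "(\<phi> x - \<phi> y) / w"] uni_nz[of "\<phi> x - \<phi> y"] by (cases "y \<in> C") auto
  qed
  have "of_nat p / (\<Prod>y\<in>A - {x}. \<phi> x - \<phi> y) \<in> maxi" if x: "x \<in> A" for x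
  proof -
    obtain C w where C: "C \<subseteq> A - {x}" "w \<noteq> 0" "\<forall>y\<in>A - {x} - C. \<phi> x - \<phi> y \<in> uni"
      "\<forall>y\<in>C. (\<phi> x - \<phi> y) / w \<in> uni" "of_nat p / w ^ card C \<in> maxi"
      using ex[OF x] by blast
    have "(\<Prod>y\<in>A - {x}. \<phi> x - \<phi> y) = (\<Prod>y\<in>A - {x} - C. \<phi> x - \<phi> y) * (\<Prod>y\<in>C. \<phi> x - \<phi> y)"
      using A C(1) by (intro prod.subset_diff) auto
    also have "(\<Prod>y\<in>C. \<phi> x - \<phi> y) = (\<Prod>y\<in>C. w * ((\<phi> x - \<phi> y) / w))" using C(2) by simp
    also have "\<dots> = w ^ card C * (\<Prod>y\<in>C. (\<phi> x - \<phi> y) / w)"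
      unfolding prod.distrib prod_constant ..
    finally have "of_nat p / (\<Prod>y\<in>A - {x}. \<phi> x - \<phi> y)
      = of_nat p / w ^ card C / ((\<Prod>y\<in>A - {x} - C. \<phi> x - \<phi> y) * (\<Prod>y\<in>C. (\<phi> x - \<phi> y) / w))"
      by (simp add: mult_ac)
    also have "\<dots> \<in> maxi" using C(3,4) by (intro maxi_divide_uni[OF C(5)] uni_mult uni_prod) auto
    finally show ?thesis .
  qed
  moreover have "inj_on \<phi> A" by (rule inj_onI, rule ccontr) (use nz in simp)
  ultimately show ?thesis using V by (simp add: tame_on_def)
qed

lemma tame_on_unramified:
  assumes "finite A" "\<And>x. x \<in> A \<Longrightarrow> \<phi> x \<in> V"
    and "\<And>x y. x \<in> A \<Longrightarrow> y \<in> A \<Longrightarrow> x \<noteq> y \<Longrightarrow> \<phi> x - \<phi> y \<in> uni"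
  shows "tame_on A \<phi>"
  by (rule tame_onI) (use assms p_maxi in \<open>auto intro!: exI[of _ "{}"] exI[of _ 1]\<close>)

lemma tame_on_compose:
  assumes "inj_on \<psi> A" "tame_on (\<psi> ` A) \<phi>"
  shows "tame_on A (\<lambda>x. \<phi> (\<psi> x))"
  unfolding tame_on_def
proof (intro conjI ballI)
  show "inj_on (\<lambda>x. \<phi> (\<psi> x)) A"
    using assms comp_inj_on[of \<psi> A \<phi>] by (auto simp: tame_on_def comp_def)
  fix x assume x: "x \<in> A"
  show "\<phi> (\<psi> x) \<in> V" using assms x by (auto simp: tame_on_def)
  have "\<psi> ` A - {\<psi> x} = \<psi> ` (A - {x})" using assms(1) x by (auto simp: inj_on_def)
  moreover have "inj_on \<psi> (A - {x})" using assms(1) by (rule inj_on_subset) auto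
  ultimately have eq: "(\<Prod>y\<in>\<psi> ` A - {\<psi> x}. \<phi> (\<psi> x) - \<phi> y) = (\<Prod>y\<in>A - {x}. \<phi> (\<psi> x) - \<phi> (\<psi> y))"
    by (simp add: prod.reindex)
  show "of_nat p / (\<Prod>y\<in>A - {x}. \<phi> (\<psi> x) - \<phi> (\<psi> y)) \<in> maxi"
    unfolding eq[symmetric] using assms(2) x unfolding tame_on_def by blast
qed

text \<open>The witness is \<open>x\<^sup>e / p\<^sup>n\<^sup>' + t x\<^sup>k / p\<^sup>l\<close> with \<open>e = q/d\<close>, \<open>n' = n/d\<close> and \<open>k n = q l + d\<close>.  The first term has
  integral values and distinguishes the residue classes of \<open>\<tau>\<^sup>e\<close>, each of which contains at most \<open>e\<close> roots;
  inside a class its differences are \<open>\<pi>\<^sup>D\<close> times a unit and those of the second term \<open>\<pi>\<^sup>d\<close> times a unit.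
  For \<open>D = d\<close> these could cancel, but then the first term alone suffices and \<open>t = 0\<close>.\<close>

lemma tame_on_ramified:
  fixes A :: "complex set" and \<tau> :: "complex \<Rightarrow> complex" and \<pi> :: complex and n q d D :: nat
  assumes A: "finite A" and \<pi>: "\<pi> ^ q = of_nat p" and q: "q > 0" "\<not> p dvd q" and n: "n > 0"
    and d: "d = gcd n q" and D: "D \<ge> d"
    and \<tau>: "\<And>x. x \<in> A \<Longrightarrow> x = \<pi> ^ n * \<tau> x" "\<And>x. x \<in> A \<Longrightarrow> \<tau> x \<in> V"
    and diff: "\<And>x y. x \<in> A \<Longrightarrow> y \<in> A \<Longrightarrow> x \<noteq> y \<Longrightarrow> \<tau> x - \<tau> y \<in> uni"
    and pow: "\<And>x y. x \<in> A \<Longrightarrow> y \<in> A \<Longrightarrow> x \<noteq> y \<Longrightarrow> \<tau> x \<in> uni \<Longrightarrow> \<tau> y \<in> uni \<Longrightarrow>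
      \<exists>u\<in>uni. \<tau> x ^ q - \<tau> y ^ q = \<pi> ^ D * u"
  shows "\<exists>\<phi>. rat_fun \<phi> \<and> tame_on A \<phi>"
proof -
  have d0: "d > 0" using q d by simp
  obtain e where e: "q = d * e" using d by (metis gcd_dvd2 dvdE)
  obtain n' where n': "n = d * n'" using d by (metis gcd_dvd1 dvdE)
  have e0: "e > 0" using q e by (cases e) auto
  \<comment> \<open>With x = \<pi>^n \<tau>, the monomial x^k / p^l equals \<pi>^d \<tau>^k; d is
    the smallest positive exponent of \<pi> that a quotient of this kind can leave.\<close>
  obtain k l where kl: "n * k = q * l + d" using bezout_nat[of n q] n d by auto
  have kl': "n' * k = e * l + 1"
  proof -
    have "d * (n' * k) = d * (e * l + 1)" using kl unfolding n' e by (simp add: algebra_simps)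
    thus ?thesis using d0 by (simp only: mult_cancel1) simp
  qed
  have dp: "of_nat d \<in> uni" using q(2) e by (auto simp: of_nat_uni_iff)
  have \<pi>m: "\<pi> \<in> maxi" using maxi_power_iff[OF q(1), of \<pi>] p_maxi \<pi> by simp
  have \<pi>0: "\<pi> \<noteq> 0" using \<pi>[symmetric] p_nz q(1) by (auto simp del: of_nat_eq_0_iff)
  have \<pi>p: "\<pi> ^ m \<in> V" for m using \<pi>m by (intro closed(7) maxi_mem)
  define t :: nat where "t = (if D = d then 0 else 1)"
  define \<phi> where "\<phi> x = x ^ e / of_nat p ^ n' + of_nat t * (x ^ k / of_nat p ^ l)" for x :: complex
  have rat: "rat_fun \<phi>" unfolding \<phi>_def
    by (intro rat_fun_add rat_fun_mult rat_fun_divide_const rat_fun_power rat_fun_id rat_fun_of_nat) auto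
  have \<phi>: "\<phi> x = \<tau> x ^ e + of_nat t * (\<pi> ^ d * \<tau> x ^ k)" if x: "x \<in> A" for x
  proof -
    have "x ^ e = (\<pi> ^ q) ^ n' * \<tau> x ^ e"
      by (subst \<tau>(1)[OF x]) (simp add: power_mult_distrib n' e mult_ac flip: power_mult)
    moreover have "x ^ k = \<pi> ^ (n * k) * \<tau> x ^ k"
      by (subst \<tau>(1)[OF x]) (simp add: power_mult_distrib flip: power_mult)
    moreover have "\<pi> ^ (n * k) = (\<pi> ^ q) ^ l * \<pi> ^ d"
      unfolding kl by (simp add: power_add power_mult)
    ultimately show ?thesis using p_nz by (simp add: \<phi>_def \<pi>)
  qed
  have "tame_on A \<phi>"
  proof (rule tame_onI[OF A])
    fix x assume "x \<in> A"
    thus "\<phi> x \<in> V" unfolding \<phi>[OF \<open>x \<in> A\<close>] by (intro closed(5,6,7,11) \<tau>(2) maxi_mem[OF \<pi>m])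
  next
    fix x assume x: "x \<in> A"
    define C where "C = {y \<in> A - {x}. \<tau> x ^ e - \<tau> y ^ e \<in> maxi}"
    have C: "C \<subseteq> A - {x}" "finite C" using A by (auto simp: C_def)
    have unit: "\<phi> x - \<phi> y \<in> uni" if y: "y \<in> A - {x} - C" for y
    proof -
      have yA: "y \<in> A" using y by auto
      have "\<tau> x ^ e - \<tau> y ^ e \<in> uni"
        using y uni_or_maxi[of "\<tau> x ^ e - \<tau> y ^ e"] x \<tau>(2) by (auto simp: C_def intro: closed(3,7))
      moreover have "\<pi> ^ d * (of_nat t * (\<tau> x ^ k - \<tau> y ^ k)) \<in> maxi"
        using \<pi>m d0 x yA by (intro maxi_mult(1) maxi_power closed(3,6,7,11) \<tau>(2))
      ultimately have "(\<tau> x ^ e - \<tau> y ^ e) + \<pi> ^ d * (of_nat t * (\<tau> x ^ k - \<tau> y ^ k)) \<in> uni"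
        by (rule uni_add_maxi)
      also have "(\<tau> x ^ e - \<tau> y ^ e) + \<pi> ^ d * (of_nat t * (\<tau> x ^ k - \<tau> y ^ k)) = \<phi> x - \<phi> y"
        unfolding \<phi>[OF x] \<phi>[OF yA] by (simp add: algebra_simps)
      finally show ?thesis .
    qed
    have ram: "(\<phi> x - \<phi> y) / \<pi> ^ d \<in> uni" if y: "y \<in> C" for y
    proof -
      have yA: "y \<in> A" "x \<noteq> y" and cong: "\<tau> x ^ e - \<tau> y ^ e \<in> maxi" using y by (auto simp: C_def)
      have \<tau>V: "\<tau> x \<in> V" "\<tau> y \<in> V" using x yA \<tau>(2) by auto
      have \<tau>d: "\<tau> x - \<tau> y \<in> uni" using diff[OF x yA] .
      \<comment> \<open>If \<tau> y had residue 0, the congruence of e-th powers would give the same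
        for \<tau> x, against the unit difference. So both are units and \<open>pow\<close>
        applies.\<close>
      have yu: "\<tau> y \<in> uni"
      proof (rule ccontr)
        assume "\<tau> y \<notin> uni"
        hence ym: "\<tau> y \<in> maxi" using uni_or_maxi \<tau>V by blast
        hence "\<tau> x ^ e - \<tau> y ^ e + \<tau> y ^ e \<in> maxi" using cong e0 by (intro maxi_add maxi_power)
        hence "\<tau> x \<in> maxi" using e0 by (simp add: maxi_power_iff)
        thus False using ym \<tau>d uni_not_maxi maxi_diff by blast
      qed
      hence "\<tau> x ^ e \<in> uni" using cong by (intro uni_cong[of "\<tau> x ^ e" "\<tau> y ^ e"] uni_power)
      hence xu: "\<tau> x \<in> uni" using e0 by (simp add: uni_power_iff)
      obtain u where u: "u \<in> uni" "\<tau> x ^ q - \<tau> y ^ q = \<pi> ^ D * u" using pow[OF x yA xu yu] by blast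
      \<comment> \<open>The q-th powers are d-th powers of the congruent e-th powers; since p does
        not divide d, the difference of the e-th powers inherits the exact order
        \<open>D\<close>.\<close>
      obtain s where s: "s \<in> uni" "(\<tau> x ^ e) ^ d - (\<tau> y ^ e) ^ d = (\<tau> x ^ e - \<tau> y ^ e) * s"
        using power_diff_unit[OF cong closed(7)[OF \<tau>V(1)] uni_power[OF yu] dp] by blast
      have eds: "(\<tau> x ^ e - \<tau> y ^ e) * s = \<pi> ^ D * u"
        using s(2) u(2) by (simp add: e mult.commute flip: power_mult)
      have ed: "\<tau> x ^ e - \<tau> y ^ e = \<pi> ^ D * (u / s)"
        using nonzero_eq_divide_eq[OF uni_nz[OF s(1)], THEN iffD2, OF eds] by simp
      have us: "u / s \<in> uni" using u s by (intro uni_divide)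
      \<comment> \<open>As n' k = e l + 1, congruence of both the e-th and the k-th powers would
        force \<tau> x \<equiv> \<tau> y.\<close>
      have kd: "\<tau> x ^ k - \<tau> y ^ k \<in> uni"
      proof (rule ccontr)
        assume "\<tau> x ^ k - \<tau> y ^ k \<notin> uni"
        hence "\<tau> x ^ k - \<tau> y ^ k \<in> maxi" using uni_or_maxi[of "\<tau> x ^ k - \<tau> y ^ k"] \<tau>V by (auto intro: closed(3,7))
        hence "(\<tau> x ^ k) ^ n' - (\<tau> y ^ k) ^ n' \<in> maxi"
          by (rule power_cong_maxi[OF _ closed(7)[OF \<tau>V(1)] closed(7)[OF \<tau>V(2)]])
        hence 1: "\<tau> x ^ (e * l + 1) - \<tau> y ^ (e * l + 1) \<in> maxi"
          by (simp only: kl'[symmetric] power_mult[symmetric] mult.commute[of n' k])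
        have 2: "\<tau> y * ((\<tau> x ^ e) ^ l - (\<tau> y ^ e) ^ l) \<in> maxi"
          by (rule maxi_mult(2)[OF \<tau>V(2) power_cong_maxi[OF cong closed(7)[OF \<tau>V(1)] closed(7)[OF \<tau>V(2)]]])
        have "(\<tau> x ^ e) ^ l * (\<tau> x - \<tau> y) = (\<tau> x ^ (e * l + 1) - \<tau> y ^ (e * l + 1)) - \<tau> y * ((\<tau> x ^ e) ^ l - (\<tau> y ^ e) ^ l)"
          by (simp add: power_mult algebra_simps)
        also have "\<dots> \<in> maxi" using 1 2 by (rule maxi_diff)
        finally show False using xu \<tau>d uni_not_maxi by (metis uni_mult uni_power)
      qed
      have "(\<phi> x - \<phi> y) / \<pi> ^ d = \<pi> ^ (D - d) * (u / s) + of_nat t * (\<tau> x ^ k - \<tau> y ^ k)"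
      proof -
        have "\<phi> x - \<phi> y = (\<tau> x ^ e - \<tau> y ^ e) + \<pi> ^ d * (of_nat t * (\<tau> x ^ k - \<tau> y ^ k))"
          unfolding \<phi>[OF x] \<phi>[OF yA(1)] by (simp add: algebra_simps)
        also have "\<tau> x ^ e - \<tau> y ^ e = \<pi> ^ d * (\<pi> ^ (D - d) * (u / s))"
          unfolding ed using D by (simp flip: power_add mult.assoc)
        finally show ?thesis using \<pi>0 by (simp add: field_simps)
      qed
      also have "\<dots> \<in> uni"
      proof (cases "D = d")
        case True
        thus ?thesis using us by (simp add: t_def)
      next
        case False
        have "\<pi> ^ (D - d) * (u / s) \<in> maxi"
          using \<pi>m us D False by (intro maxi_mult(1) maxi_power uni_mem) auto
        thus ?thesis using False kd by (simp add: t_def maxi_add_uni)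
      qed
      finally show ?thesis .
    qed
    have inj: "inj_on \<tau> A"
    proof (rule inj_onI, rule ccontr)
      fix z w assume "z \<in> A" "w \<in> A" "\<tau> z = \<tau> w" "z \<noteq> w"
      thus False using uni_nz[OF diff[of z w]] by simp
    qed
    \<comment> \<open>The residues of x and its class are roots of X^e - \<tau> x^e.\<close>
    have "card (\<tau> ` insert x C) \<le> e"
    proof (rule card_power_cong_le[of _ e "\<tau> x ^ e"])
      show "finite (\<tau> ` insert x C)" using C by auto
      fix z assume "z \<in> \<tau> ` insert x C"
      then obtain y where y: "z = \<tau> y" "y \<in> insert x C" by auto
      show "z \<in> V" using y x C \<tau>(2) by auto
      have "\<tau> x ^ e - \<tau> y ^ e \<in> maxi" using y by (auto simp: C_def)
      from maxi_minus[OF this] show "z ^ e - \<tau> x ^ e \<in> maxi" using y by simp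
    next
      fix z w assume "z \<in> \<tau> ` insert x C" "w \<in> \<tau> ` insert x C" "z \<noteq> w"
      then obtain y y' where "z = \<tau> y" "y \<in> A" "w = \<tau> y'" "y' \<in> A" "y \<noteq> y'" using C x by auto
      thus "z - w \<in> uni" using diff by simp
    qed (use e0 in auto)
    also have "card (\<tau> ` insert x C) = card (insert x C)"
      using C x by (intro card_image inj_on_subset[OF inj]) auto
    also have "\<dots> = card C + 1" using C by (subst card_insert_disjoint) auto
    finally have cardC: "card C < e" by simp
    \<comment> \<open>Because x itself is not counted, the exponent is at most d (e - 1) < q, and a
      positive power of \<pi> survives.\<close>
    have "d * card C < q" using cardC d0 unfolding e by simp
    hence "q = (q - d * card C) + d * card C" by simp
    hence "of_nat p = \<pi> ^ (q - d * card C) * (\<pi> ^ d) ^ card C"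
      unfolding \<pi>[symmetric] by (metis power_add power_mult)
    hence "of_nat p / (\<pi> ^ d) ^ card C = \<pi> ^ (q - d * card C)" using \<pi>0 by simp
    also have "\<dots> \<in> maxi" using \<pi>m \<open>d * card C < q\<close> by (intro maxi_power) auto
    finally have pC: "of_nat p / (\<pi> ^ d) ^ card C \<in> maxi" .
    show "\<exists>C w. C \<subseteq> A - {x} \<and> w \<noteq> 0 \<and> (\<forall>y\<in>A - {x} - C. \<phi> x - \<phi> y \<in> uni) \<and>
      (\<forall>y\<in>C. (\<phi> x - \<phi> y) / w \<in> uni) \<and> of_nat p / w ^ card C \<in> maxi"
      using C(1) unit ram pC \<pi>0 by (intro exI[of _ C] exI[of _ "\<pi> ^ d"]) auto
  qed
  thus ?thesis using rat by blast
qed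

end

section \<open>Newton polygons of the trinomial\<close>

definition trinomial_roots :: "complex \<Rightarrow> complex \<Rightarrow> complex set"
  where "trinomial_roots a b = {x. x ^ 9 + a * x + b = 0}"

lemma trinomial_poly: "poly [:b, a, 0, 0, 0, 0, 0, 0, 0, 1:] x = x ^ 9 + a * x + (b::complex)"
  by (simp add: algebra_simps eval_nat_numeral)

lemma finite_trinomial_roots: "finite (trinomial_roots a b)"
  and card_trinomial_roots: "card (trinomial_roots a b) \<le> 9"
proof -
  have eq: "trinomial_roots a b = {x. poly [:b, a, 0, 0, 0, 0, 0, 0, 0, 1:] x = 0}"
    by (simp only: trinomial_roots_def trinomial_poly)
  have nz: "[:b, a, 0, 0, 0, 0, 0, 0, 0, 1:] \<noteq> 0" by simp
  show "finite (trinomial_roots a b)" unfolding eq by (rule poly_roots_finite[OF nz])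
  show "card (trinomial_roots a b) \<le> 9" unfolding eq using card_poly_roots_bound[OF nz] by simp
qed

lemma complex_nth_root_of_nat:
  assumes "q > 0"
  obtains w :: complex where "w ^ q = of_nat p"
proof
  have "root q (real p) ^ q = real p" using assms by simp
  hence "of_real (root q (real p) ^ q) = (of_real (real p) :: complex)" by (rule arg_cong)
  thus "complex_of_real (root q (real p)) ^ q = of_nat p" by simp
qed

context p_valuation
begin

lemma trinomial_root_mem:
  assumes "a \<in> V" "b \<in> V" "x ^ 9 + a * x + b = 0"
  shows "x \<in> V"
proof (rule integral_mem)
  show "poly [:b, a, 0, 0, 0, 0, 0, 0, 0, 1:] x = 0" using assms(3) by (simp only: trinomial_poly)
  show "\<forall>i. Polynomial.coeff [:b, a, 0, 0, 0, 0, 0, 0, 0, 1:] i \<in> V"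
    using assms(1,2) closed(1,2) by (auto simp: coeff_pCons split: nat.splits)
qed simp

text \<open>\<open>sep\<close> says that the derivative at x is a unit. Subtracting the equations
  shows that the cofactor of x - y in x^9 - y^9 is -a; for congruent x and y it is also congruent to
  9 x^8.\<close>

lemma trinomial_roots_diff_unit:
  assumes ab: "a \<in> V" "b \<in> V" and x: "x ^ 9 + a * x + b = 0" and y: "y ^ 9 + a * y + b = 0"
    and xy: "x \<noteq> y" and sep: "9 * x ^ 8 + a \<in> uni"
  shows "x - y \<in> uni"
proof (rule ccontr)
  have V: "x \<in> V" "y \<in> V" using trinomial_root_mem[OF ab] x y by auto
  assume "x - y \<notin> uni"
  hence "x - y \<in> maxi" using uni_or_maxi[of "x - y"] V by (auto intro: closed(3))
  hence "y - x \<in> maxi" using maxi_minus by fastforce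
  from power_sum_cong[OF this V(2,1), of 9]
  have 1: "(\<Sum>i<9. x ^ (9 - Suc i) * y ^ i) - 9 * x ^ 8 \<in> maxi" by simp
  have "(y - x) * (\<Sum>i<9. x ^ (9 - Suc i) * y ^ i) = y ^ 9 - x ^ 9" by (rule power_diff_sumr2[symmetric])
  also have "y ^ 9 = - (a * y + b)" using y by (simp add: eq_neg_iff_add_eq_0 algebra_simps)
  also have "x ^ 9 = - (a * x + b)" using x by (simp add: eq_neg_iff_add_eq_0 algebra_simps)
  also have "- (a * y + b) - - (a * x + b) = (y - x) * (- a)" by (simp add: algebra_simps)
  finally have "(\<Sum>i<9. x ^ (9 - Suc i) * y ^ i) = - a"
    using xy by (simp only: mult_cancel_left right_minus_eq) simp
  hence "- (9 * x ^ 8 + a) \<in> maxi" using 1 by (simp add: algebra_simps)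
  from maxi_minus[OF this] have "9 * x ^ 8 + a \<in> maxi" by (simp add: add.commute)
  thus False using sep uni_not_maxi by blast
qed

text \<open>The point (1, \<alpha>) lies above the segment from (0, \<beta>) to (9, 0), so all roots
  have valuation \<beta>/9. After scaling, the equation reduces to \<tau>^9 + b', which is separable
  because p does not divide 9.\<close>

lemma newton_polygon_one_side:
  fixes a' b' :: int and \<alpha> \<beta> :: nat
  assumes p: "p \<ge> 5" and b': "\<not> int p dvd b'" and a': "\<not> int p dvd a'" and lt: "8 * \<beta> < 9 * \<alpha>"
  shows "\<exists>\<phi>. rat_fun \<phi> \<and> tame_on (trinomial_roots (of_int (int p ^ \<alpha> * a')) (of_int (int p ^ \<beta> * b'))) \<phi>"
    (is "\<exists>\<phi>. _ \<and> tame_on ?A \<phi>")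
proof -
  obtain \<pi> :: complex where \<pi>: "\<pi> ^ 9 = of_nat p" using complex_nth_root_of_nat[of 9] by auto
  \<comment> \<open>Nine times the height of (1, \<alpha>) above the segment;
    \<open>\<pi> ^ D\<close> is what remains of the linear coefficient after scaling.\<close>
  define D where "D = 9 * \<alpha> - 8 * \<beta>"
  have D: "9 * \<alpha> = 8 * \<beta> + D" "D > 0" using lt by (auto simp: D_def)
  define \<tau> where "\<tau> x = x / \<pi> ^ \<beta>" for x :: complex
  have \<pi>0: "\<pi> \<noteq> 0" using \<pi>[symmetric] p_nz by (auto simp del: of_nat_eq_0_iff)
  have \<pi>m: "\<pi> \<in> maxi" using maxi_power_iff[of 9 \<pi>] p_maxi \<pi> by simp
  define a1 :: complex where "a1 = of_int a' * \<pi> ^ D"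
  have a1: "a1 \<in> maxi" unfolding a1_def using \<pi>m D(2) by (intro maxi_mult(2) maxi_power closed(10))
  have a'u: "of_int a' \<in> uni" and b'u: "of_int b' \<in> uni" using a' b' by (simp_all add: of_int_uni_iff)
  have x: "x = \<pi> ^ \<beta> * \<tau> x" for x using \<pi>0 by (simp add: \<tau>_def)
  have root: "\<tau> x ^ 9 + a1 * \<tau> x + of_int b' = 0" if "x \<in> ?A" for x
  proof -
    have "0 = (\<pi> ^ \<beta> * \<tau> x) ^ 9 + (\<pi> ^ 9) ^ \<alpha> * of_int a' * (\<pi> ^ \<beta> * \<tau> x) + (\<pi> ^ 9) ^ \<beta> * of_int b'"
      using that by (simp add: trinomial_roots_def \<pi> flip: x)
    also have "(\<pi> ^ 9) ^ \<alpha> = \<pi> ^ (8 * \<beta>) * \<pi> ^ D" by (simp flip: power_mult power_add D(1))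
    also have "(\<pi> ^ \<beta> * \<tau> x) ^ 9 + \<pi> ^ (8 * \<beta>) * \<pi> ^ D * of_int a' * (\<pi> ^ \<beta> * \<tau> x) + (\<pi> ^ 9) ^ \<beta> * of_int b'
      = \<pi> ^ (9 * \<beta>) * (\<tau> x ^ 9 + a1 * \<tau> x + of_int b')"
    proof -
      have "\<pi> ^ (8 * \<beta>) * \<pi> ^ D * of_int a' * (\<pi> ^ \<beta> * \<tau> x) = (\<pi> ^ (8 * \<beta>) * \<pi> ^ \<beta>) * (a1 * \<tau> x)"
        by (simp add: a1_def mult_ac)
      also have "\<pi> ^ (8 * \<beta>) * \<pi> ^ \<beta> = \<pi> ^ (9 * \<beta>)" by (simp flip: power_add)
      finally show ?thesis
        by (simp add: power_mult_distrib distrib_left mult.commute[of \<beta> 9] flip: power_mult)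
    qed
    finally show ?thesis using \<pi>0 by simp
  qed
  have \<tau>V: "\<tau> x \<in> V" if "x \<in> ?A" for x
    using trinomial_root_mem[OF maxi_mem[OF a1] _ root[OF that]] closed(10) by blast
  have \<tau>u: "\<tau> x \<in> uni" if "x \<in> ?A" for x
  proof -
    have "\<tau> x ^ 9 = - (of_int b' + a1 * \<tau> x)" using root[OF that] by (simp add: eq_neg_iff_add_eq_0 algebra_simps)
    also have "\<dots> \<in> uni" using b'u a1 \<tau>V[OF that] by (intro uni_minus uni_add_maxi maxi_mult(1))
    finally show ?thesis by (simp add: uni_power_iff)
  qed
  have np: "\<not> p dvd 9"
  proof
    assume "p dvd 9"
    hence "p dvd 3 * 3" by simp
    hence "p dvd 3" using prime prime_dvd_mult_iff by blast
    thus False using p by (auto dest: dvd_imp_le)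
  qed
  have diff: "\<tau> x - \<tau> y \<in> uni" if "x \<in> ?A" "y \<in> ?A" "x \<noteq> y" for x y
  proof (rule trinomial_roots_diff_unit[OF maxi_mem[OF a1] closed(10) root[OF that(1)] root[OF that(2)]])
    show "\<tau> x \<noteq> \<tau> y" using that x by metis
    have "of_nat 9 \<in> uni" using np by (simp only: of_nat_uni_iff) simp
    thus "9 * \<tau> x ^ 8 + a1 \<in> uni" using \<tau>u[OF that(1)] a1 by (intro uni_add_maxi uni_mult uni_power) auto
  qed
  show ?thesis
  proof (cases "\<beta> = 0")
    case True
    hence "\<tau> = (\<lambda>x. x)" by (simp add: \<tau>_def fun_eq_iff)
    hence "tame_on ?A (\<lambda>x. x)"
      using \<tau>V diff by (intro tame_on_unramified finite_trinomial_roots) auto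
    thus ?thesis using rat_fun_id by blast
  next
    case False
    show ?thesis
    proof (rule tame_on_ramified[OF finite_trinomial_roots \<pi> _ np _ refl _ x \<tau>V diff])
      \<comment> \<open>Equality can occur, for instance for \<alpha> = \<beta> = 1; this is why
        \<open>tame_on_ramified\<close> has to admit D = d.\<close>
      have "gcd \<beta> 9 dvd D" unfolding D_def by (intro dvd_diff_nat) auto
      thus "gcd \<beta> 9 \<le> D" using D(2) by (rule dvd_imp_le)
      fix x y assume xy: "x \<in> ?A" "y \<in> ?A" "x \<noteq> y"
      have "\<tau> x ^ 9 - \<tau> y ^ 9 = \<pi> ^ D * (- of_int a' * (\<tau> x - \<tau> y))"
      proof -
        have "\<tau> x ^ 9 = - (a1 * \<tau> x + of_int b')" 
          using root[OF xy(1)] by (simp add: eq_neg_iff_add_eq_0 algebra_simps)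
        moreover have "\<tau> y ^ 9 = - (a1 * \<tau> y + of_int b')" 
          using root[OF xy(2)] by (simp add: eq_neg_iff_add_eq_0 algebra_simps)
        ultimately show ?thesis by (simp add: a1_def algebra_simps)
      qed
      thus "\<exists>u\<in>uni. \<tau> x ^ 9 - \<tau> y ^ 9 = \<pi> ^ D * u"
        using a'u diff[OF xy] by blast
    qed (use False in auto)
  qed
qed

text \<open>Here (1, \<alpha>) is a vertex: eight roots have valuation \<alpha>/8 and one root a
  larger one. All nine are scaled by the same \<pi>^\<alpha>, and the reduction \<tau> (\<tau>^8 +
  a') is separable because p does not divide 8; the exceptional root gets residue 0.\<close>

lemma newton_polygon_two_sides:
  fixes a' b' :: int and \<alpha> \<beta> :: nat
  assumes p: "p \<ge> 5" and b': "\<not> int p dvd b'" and a': "\<not> int p dvd a'" and lt: "9 * \<alpha> < 8 * \<beta>"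
  shows "\<exists>\<phi>. rat_fun \<phi> \<and> tame_on (trinomial_roots (of_int (int p ^ \<alpha> * a')) (of_int (int p ^ \<beta> * b'))) \<phi>"
    (is "\<exists>\<phi>. _ \<and> tame_on ?A \<phi>")
proof -
  obtain \<pi> :: complex where \<pi>: "\<pi> ^ 8 = of_nat p" using complex_nth_root_of_nat[of 8] by auto
  define D where "D = 8 * \<beta> - 9 * \<alpha>"
  have D: "8 * \<beta> = 9 * \<alpha> + D" "D > 0" using lt by (auto simp: D_def)
  define \<tau> where "\<tau> x = x / \<pi> ^ \<alpha>" for x :: complex
  have \<pi>0: "\<pi> \<noteq> 0" using \<pi>[symmetric] p_nz by (auto simp del: of_nat_eq_0_iff)
  have \<pi>m: "\<pi> \<in> maxi" using maxi_power_iff[of 8 \<pi>] p_maxi \<pi> by simp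
  define b1 :: complex where "b1 = \<pi> ^ D * of_int b'"
  have b1: "b1 \<in> maxi" unfolding b1_def using \<pi>m D(2) by (intro maxi_mult(1) maxi_power closed(10))
  have a'u: "of_int a' \<in> uni" and b'u: "of_int b' \<in> uni" using a' b' by (simp_all add: of_int_uni_iff)
  have x: "x = \<pi> ^ \<alpha> * \<tau> x" for x using \<pi>0 by (simp add: \<tau>_def)
  have root: "\<tau> x ^ 9 + of_int a' * \<tau> x + b1 = 0" if "x \<in> ?A" for x
  proof -
    have "0 = (\<pi> ^ \<alpha> * \<tau> x) ^ 9 + (\<pi> ^ 8) ^ \<alpha> * of_int a' * (\<pi> ^ \<alpha> * \<tau> x) + (\<pi> ^ 8) ^ \<beta> * of_int b'"
      using that by (simp add: trinomial_roots_def \<pi> flip: x)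
    also have "(\<pi> ^ 8) ^ \<beta> = \<pi> ^ (9 * \<alpha>) * \<pi> ^ D" by (simp flip: power_mult power_add D(1))
    also have "(\<pi> ^ \<alpha> * \<tau> x) ^ 9 + (\<pi> ^ 8) ^ \<alpha> * of_int a' * (\<pi> ^ \<alpha> * \<tau> x) + \<pi> ^ (9 * \<alpha>) * \<pi> ^ D * of_int b'
      = \<pi> ^ (9 * \<alpha>) * (\<tau> x ^ 9 + of_int a' * \<tau> x + b1)"
    proof -
      have "(\<pi> ^ 8) ^ \<alpha> * of_int a' * (\<pi> ^ \<alpha> * \<tau> x) = (\<pi> ^ (8 * \<alpha>) * \<pi> ^ \<alpha>) * (of_int a' * \<tau> x)"
        by (simp add: mult_ac flip: power_mult)
      also have "\<pi> ^ (8 * \<alpha>) * \<pi> ^ \<alpha> = \<pi> ^ (9 * \<alpha>)" by (simp flip: power_add)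
      finally show ?thesis
        by (simp add: power_mult_distrib distrib_left b1_def mult.assoc mult.commute[of \<alpha> 9] flip: power_mult)
    qed
    finally show ?thesis using \<pi>0 by simp
  qed
  have \<tau>V: "\<tau> x \<in> V" if "x \<in> ?A" for x
    by (rule trinomial_root_mem[OF closed(10) maxi_mem[OF b1] root[OF that]])
  have np: "\<not> p dvd 8"
  proof
    assume "p dvd 8"
    hence "p dvd 2 ^ 3" by simp
    hence "p dvd 2" using prime prime_dvd_power by blast
    thus False using p by (auto dest: dvd_imp_le)
  qed
  have diff: "\<tau> x - \<tau> y \<in> uni" if "x \<in> ?A" "y \<in> ?A" "x \<noteq> y" for x y
  proof (rule trinomial_roots_diff_unit[OF closed(10) maxi_mem[OF b1] root[OF that(1)] root[OF that(2)]])
    show "\<tau> x \<noteq> \<tau> y" using that x by metis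
    have "\<tau> x * (\<tau> x ^ 8 + of_int a') = - b1"
      using root[OF that(1)] by (simp add: algebra_simps eq_neg_iff_add_eq_0 flip: power_Suc)
    hence "\<tau> x * (\<tau> x ^ 8 + of_int a') \<in> maxi" using b1 maxi_minus by simp
    hence "\<tau> x \<in> maxi \<or> \<tau> x ^ 8 + of_int a' \<in> maxi"
      using \<tau>V[OF that(1)] by (intro maxi_prime closed(5,7,10))
    \<comment> \<open>The derivative is congruent to a' at the residue 0 and to -8 a' where \<tau>^8
      \<equiv> -a'.\<close>
    thus "9 * \<tau> x ^ 8 + of_int a' \<in> uni"
    proof
      assume "\<tau> x \<in> maxi"
      hence "of_nat 9 * \<tau> x ^ 8 \<in> maxi" by (intro maxi_mult(2) maxi_power closed(11)) auto
      thus ?thesis using a'u by (simp add: maxi_add_uni)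
    next
      assume 1: "\<tau> x ^ 8 + of_int a' \<in> maxi"
      have "of_nat 9 * (\<tau> x ^ 8 + of_int a') - of_nat 8 * of_int a' \<in> uni"
        using 1 a'u np by (intro maxi_diff_uni maxi_mult(2) closed(11) uni_mult) (simp_all only: of_nat_uni_iff not_False_eq_True)
      thus ?thesis by (simp add: algebra_simps)
    qed
  qed
  show ?thesis
  proof (cases "\<alpha> = 0")
    case True
    hence "\<tau> = (\<lambda>x. x)" by (simp add: \<tau>_def fun_eq_iff)
    hence "tame_on ?A (\<lambda>x. x)"
      using \<tau>V diff by (intro tame_on_unramified finite_trinomial_roots) auto
    thus ?thesis using rat_fun_id by blast
  next
    case False
    show ?thesis
    proof (rule tame_on_ramified[OF finite_trinomial_roots \<pi> _ np _ refl _ x \<tau>V diff])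
      have "gcd \<alpha> 8 dvd D" unfolding D_def by (intro dvd_diff_nat) auto
      thus "gcd \<alpha> 8 \<le> D" using D(2) by (rule dvd_imp_le)
      fix x y assume xy: "x \<in> ?A" "y \<in> ?A" "x \<noteq> y" and u: "\<tau> x \<in> uni" "\<tau> y \<in> uni"
      \<comment> \<open>For units the equation says \<tau>^8 = - a' - b1/\<tau>, so eighth powers
        differ by b1 times a unit.\<close>
      have "\<tau> x * \<tau> y * (\<tau> x ^ 8 - \<tau> y ^ 8) = \<tau> y * \<tau> x ^ 9 - \<tau> x * \<tau> y ^ 9"
        by (simp add: algebra_simps eval_nat_numeral)
      also have "\<tau> x ^ 9 = - (of_int a' * \<tau> x + b1)" 
        using root[OF xy(1)] by (simp add: eq_neg_iff_add_eq_0 algebra_simps)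
      also have "\<tau> y ^ 9 = - (of_int a' * \<tau> y + b1)" 
        using root[OF xy(2)] by (simp add: eq_neg_iff_add_eq_0 algebra_simps)
      also have "\<tau> y * - (of_int a' * \<tau> x + b1) - \<tau> x * - (of_int a' * \<tau> y + b1) = \<pi> ^ D * (of_int b' * (\<tau> x - \<tau> y))"
        by (simp add: b1_def algebra_simps)
      finally have "\<tau> x ^ 8 - \<tau> y ^ 8 = \<pi> ^ D * (of_int b' * (\<tau> x - \<tau> y) / (\<tau> x * \<tau> y))"
        using uni_nz[OF u(1)] uni_nz[OF u(2)] by (simp add: nonzero_eq_divide_eq mult.commute)
      moreover have "of_int b' * (\<tau> x - \<tau> y) / (\<tau> x * \<tau> y) \<in> uni"
        using b'u diff[OF xy] u by (intro uni_divide uni_mult)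
      ultimately show "\<exists>u\<in>uni. \<tau> x ^ 8 - \<tau> y ^ 8 = \<pi> ^ D * u" by blast
    qed (use False in auto)
  qed
qed

end

section \<open>Two roots meeting modulo \<open>p\<close>\<close>

lemma taylor_power9:
  fixes c w :: complex
  shows "(c + w) ^ 9 = c ^ 9 + 9 * c ^ 8 * w + w\<^sup>2 * (w ^ 7 + 9 * c * w ^ 6 + 36 * c ^ 2 * w ^ 5 + 84 * c ^ 3 * w ^ 4
    + 126 * c ^ 4 * w ^ 3 + 126 * c ^ 5 * w ^ 2 + 84 * c ^ 6 * w + 36 * c ^ 7)"
proof -
  have "(c + w) ^ 9 = (\<Sum>k\<le>9. of_nat (9 choose k) * c ^ k * w ^ (9 - k))"
    by (rule binomial_ring)
  also have "\<dots> = w ^ 9 + 9 * c * w ^ 8 + 36 * c ^ 2 * w ^ 7 + 84 * c ^ 3 * w ^ 6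
    + 126 * c ^ 4 * w ^ 5 + 126 * c ^ 5 * w ^ 4 + 84 * c ^ 6 * w ^ 3 + 36 * c ^ 7 * w ^ 2 + 9 * c ^ 8 * w + c ^ 9"
    by (simp add: atMost_nat_numeral atMost_Suc eval_nat_numeral(2,3) binomial_Suc_Suc algebra_simps del: power_Suc)
  finally show ?thesis
    by (simp add: distrib_left mult_ac flip: power_add; simp add: power2_eq_square power3_eq_cube)
qed

text \<open>The left side of \<open>disc\<close> is the discriminant of x^9 + a x + b, and m is its
  p-adic valuation, possibly 0. The setting is the polygon whose two coefficients are both prime to
  p.\<close>

locale double_root = p_valuation +
  fixes a b :: int and m :: nat and u :: int
  assumes p5: "p \<ge> 5" and a: "\<not> int p dvd a" and b: "\<not> int p dvd b" and u: "\<not> int p dvd u"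
    and disc: "8 ^ 8 * a ^ 9 + 9 ^ 9 * b ^ 8 = int p ^ m * u"
begin

text \<open>The Taylor expansion of \<open>x\<^sup>9 + a x + b\<close> at \<open>c\<close> is \<open>w\<^sup>2 G(w) + \<delta> (w + c/9)\<close> with \<open>\<delta>\<close> the discriminant divided
  by \<open>(8a)\<^sup>8\<close>; so \<open>c\<close> is a double root modulo \<open>p\<close> to the highest possible precision.\<close>

definition c :: complex where "c = - (9 * of_int b) / (8 * of_int a)"

definition \<delta> :: complex where "\<delta> = 9 * c ^ 8 + of_int a"

definition \<kappa> :: complex where "\<kappa> = 36 * c ^ 7"

definition G :: "complex \<Rightarrow> complex"
  where "G w = w ^ 7 + 9 * c * w ^ 6 + 36 * c ^ 2 * w ^ 5 + 84 * c ^ 3 * w ^ 4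
    + 126 * c ^ 4 * w ^ 3 + 126 * c ^ 5 * w ^ 2 + 84 * c ^ 6 * w + \<kappa>"

definition A :: "complex set" where "A = trinomial_roots (of_int a) (of_int b)"

definition \<omega> :: "complex \<Rightarrow> complex" where "\<omega> x = x - c"

lemma numeral_uni: "2 \<in> uni" "3 \<in> uni" "8 \<in> uni" "9 \<in> uni" "36 \<in> uni"
proof -
  have "\<not> p dvd 2" "\<not> p dvd 3" using p5 by (auto dest: dvd_imp_le)
  thus 23: "2 \<in> uni" "3 \<in> uni" using of_nat_uni_iff[of 2] of_nat_uni_iff[of 3] by simp_all
  from uni_power[OF 23(1), of 3] uni_power[OF 23(2), of 2] uni_mult[OF uni_power[OF 23(1), of 2] uni_power[OF 23(2), of 2]]
  show "8 \<in> uni" "9 \<in> uni" "36 \<in> uni" by simp_all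
qed

lemma ab_uni: "of_int a \<in> uni" "of_int b \<in> uni"
  using a b by (simp_all add: of_int_uni_iff)

lemma c_uni: "c \<in> uni" and c_mem: "c \<in> V" and c_rat: "c \<in> \<rat>"
proof -
  show "c \<in> uni" unfolding c_def using numeral_uni ab_uni by (intro uni_divide uni_minus uni_mult)
  thus "c \<in> V" by (rule uni_mem)
  show "c \<in> \<rat>" unfolding c_def by (intro Rats_divide Rats_minus_iff[THEN iffD2] Rats_mult) auto
qed

lemma c_eq: "8 * of_int a * c = - (9 * of_int b)"
  using uni_nz[OF ab_uni(1)] by (simp add: c_def)

text \<open>\<kappa> is half the second derivative at c; its being a unit prevents a triple root
  modulo p.\<close>

lemma \<kappa>_uni: "\<kappa> \<in> uni"
  unfolding \<kappa>_def using numeral_uni c_uni by (intro uni_mult uni_power)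

lemma \<delta>_eq: obtains v where "v \<in> uni" "\<delta> = of_nat p ^ m * v"
proof
  let ?a = "of_int a :: complex" and ?b = "of_int b :: complex"
  have "(8 * ?a) ^ 8 * \<delta> = 9 * (8 * ?a * c) ^ 8 + (8 * ?a) ^ 8 * ?a"
    by (simp add: \<delta>_def algebra_simps power_mult_distrib)
  also have "\<dots> = 8 ^ 8 * ?a ^ 9 + 9 ^ 9 * ?b ^ 8"
    unfolding c_eq by (simp add: power_mult_distrib flip: power_Suc2)
  also have "\<dots> = of_int (8 ^ 8 * a ^ 9 + 9 ^ 9 * b ^ 8)" by simp
  also have "\<dots> = of_nat p ^ m * of_int u" unfolding disc by simp
  finally have "(8 * ?a) ^ 8 * \<delta> = of_nat p ^ m * of_int u" .
  thus "\<delta> = of_nat p ^ m * (of_int u / (8 * ?a) ^ 8)"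
    using uni_nz[OF ab_uni(1)] by (simp add: nonzero_eq_divide_eq mult.commute)
  show "of_int u / (8 * ?a) ^ 8 \<in> uni"
    using u numeral_uni ab_uni by (intro uni_divide uni_power uni_mult) (simp_all add: of_int_uni_iff)
qed

lemma p_power_maxi: "k > 0 \<Longrightarrow> of_nat p ^ k \<in> maxi"
  using p_maxi by (rule maxi_power)

lemma p_power_nz: "of_nat p ^ k \<noteq> (0 :: complex)"
  using p_nz by simp

text \<open>The derivative at c is \<delta>, and because 9b = -8ac the value at c is c \<delta>/9;
  so the constant and the linear Taylor terms are both multiples of \<delta>.\<close>

lemma root_eq:
  assumes "x \<in> A"
  shows "(\<omega> x)\<^sup>2 * G (\<omega> x) = - \<delta> * (\<omega> x + c / 9)"
proof -
  let ?a = "of_int a :: complex" and ?b = "of_int b :: complex"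
  have "(\<omega> x)\<^sup>2 * G (\<omega> x) = (c + \<omega> x) ^ 9 - c ^ 9 - 9 * c ^ 8 * \<omega> x"
    unfolding taylor_power9 by (simp add: G_def \<kappa>_def)
  also have "(c + \<omega> x) ^ 9 = - ?a * (c + \<omega> x) - ?b"
    using assms by (simp add: A_def trinomial_roots_def \<omega>_def algebra_simps eq_neg_iff_add_eq_0)
  also have "?b = - (8 * ?a * c) / 9" unfolding c_eq by simp
  also have "- ?a * (c + \<omega> x) - - (8 * ?a * c) / 9 - c ^ 9 - 9 * c ^ 8 * \<omega> x = - \<delta> * (\<omega> x + c / 9)"
  proof -
    have aux: "- ?a * (9 * k + w) + 8 * ?a * k - 9 * k * d - 9 * d * w = - (9 * d + ?a) * (w + k)" for d w k
      by (simp add: algebra_simps)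
    have "c ^ 9 = 9 * (c / 9) * c ^ 8" by (simp flip: power_Suc)
    thus ?thesis using aux[of "c / 9" "\<omega> x" "c ^ 8"] by (simp add: \<delta>_def)
  qed
  finally show ?thesis .
qed

lemma A_mem: "x \<in> A \<Longrightarrow> x \<in> V"
  using trinomial_root_mem[OF closed(10) closed(10)] by (auto simp: A_def trinomial_roots_def)

lemma \<omega>_mem: "x \<in> A \<Longrightarrow> \<omega> x \<in> V"
  unfolding \<omega>_def by (intro closed(3) A_mem c_mem)

lemma A_uni:
  assumes "x \<in> A"
  shows "x \<in> uni"
proof -
  have "x * (x ^ 8 + of_int a) = - of_int b"
    using assms by (simp add: A_def trinomial_roots_def algebra_simps eq_neg_iff_add_eq_0 flip: power_Suc)
  hence "x * (x ^ 8 + of_int a) \<in> uni" using ab_uni(2) uni_minus by simp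
  thus ?thesis using mult_uni_iff[of x "x ^ 8 + of_int a"] A_mem[OF assms] closed(5,7,10) by blast
qed

text \<open>At a root, x times the derivative equals -8a (x - c), so the derivative is a unit as
  soon as x is not congruent to c.\<close>

lemma simple_root_diff:
  assumes x: "x \<in> A" "\<omega> x \<in> uni" and y: "y \<in> A" "x \<noteq> y"
  shows "x - y \<in> uni"
proof (rule trinomial_roots_diff_unit[OF closed(10) closed(10)])
  show "x ^ 9 + of_int a * x + of_int b = 0" "y ^ 9 + of_int a * y + of_int b = 0"
    using x y by (simp_all add: A_def trinomial_roots_def)
  have "x * (9 * x ^ 8 + of_int a) = 9 * (x ^ 9 + of_int a * x + of_int b) - 8 * of_int a * x - 9 * of_int b"
    by (simp add: algebra_simps flip: power_Suc)
  also have "\<dots> = - (8 * of_int a) * \<omega> x"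
    using c_eq x by (simp add: A_def trinomial_roots_def \<omega>_def algebra_simps)
  also have "\<dots> \<in> uni" using x numeral_uni ab_uni by (intro uni_mult uni_minus)
  finally show "9 * x ^ 8 + of_int a \<in> uni"
    using mult_uni_iff[of x "9 * x ^ 8 + of_int a"] A_mem[OF x(1)] numeral_uni uni_mem closed(5,6,7,10) by blast
qed (use y in auto)

lemma G_diff:
  assumes "v \<in> V" "w \<in> V"
  obtains s where "s \<in> V" "G v - G w = (v - w) * s"
proof -
  let ?q = "[:\<kappa>, 84 * c ^ 6, 126 * c ^ 5, 126 * c ^ 4, 84 * c ^ 3, 36 * c ^ 2, 9 * c, 1:]"
  have G: "poly ?q z = G z" for z
    by (simp add: G_def algebra_simps eval_nat_numeral)
  have num: "numeral k \<in> V" for k using closed(11)[of "numeral k"] by simp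
  have "\<forall>i. Polynomial.coeff ?q i \<in> V"
    using uni_mem[OF \<kappa>_uni] num c_mem by (auto simp: coeff_pCons intro!: closed(1,2,6,7) split: nat.splits)
  from poly_diff_mem[OF this assms] show ?thesis using that unfolding G by blast
qed

lemma G_0: "G 0 = \<kappa>"
  by (simp add: G_def)

lemma G_mem: "v \<in> V \<Longrightarrow> G v \<in> V"
proof -
  assume v: "v \<in> V"
  obtain s where "s \<in> V" "G v - G 0 = (v - 0) * s" using G_diff[OF v closed(2)] by blast
  hence "G v = v * s + \<kappa>" "v * s + \<kappa> \<in> V"
    using v uni_mem[OF \<kappa>_uni] by (auto simp: G_0 algebra_simps intro: closed(5,6))
  thus ?thesis by simp
qed

lemma G_cong: "v \<in> maxi \<Longrightarrow> G v - \<kappa> \<in> maxi"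
proof -
  assume v: "v \<in> maxi"
  obtain s where "s \<in> V" "G v - G 0 = (v - 0) * s" using G_diff[OF maxi_mem[OF v] closed(2)] by blast
  thus ?thesis using v by (simp add: G_0 maxi_mult(1))
qed

lemma G_uni: "v \<in> maxi \<Longrightarrow> G v \<in> uni"
  using uni_cong[OF G_cong \<kappa>_uni] .

lemma c9_uni: "v \<in> maxi \<Longrightarrow> v + c / 9 \<in> uni"
  using c_uni numeral_uni by (intro maxi_add_uni uni_divide)

text \<open>In \<open>root_eq\<close> both \<open>G (\<omega> x)\<close> and
  \<open>\<omega> x + c / 9\<close> are units near c, so \<omega> x has valuation m/2. The parity of
  m decides whether the two roots ramify.\<close>

lemma double_root_sq:
  assumes x: "x \<in> A" "\<omega> x \<in> maxi"
  obtains e where "e \<in> uni" "(\<omega> x)\<^sup>2 = of_nat p ^ m * e"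
proof -
  obtain v where v: "v \<in> uni" "\<delta> = of_nat p ^ m * v" by (rule \<delta>_eq)
  have "(\<omega> x)\<^sup>2 = - \<delta> * (\<omega> x + c / 9) / G (\<omega> x)"
    by (rule nonzero_eq_divide_eq[OF uni_nz[OF G_uni[OF x(2)]], THEN iffD2, OF root_eq[OF x(1)]])
  also have "\<dots> = of_nat p ^ m * (- v * (\<omega> x + c / 9) / G (\<omega> x))" by (simp add: v(2))
  finally show ?thesis
    using that[of "- v * (\<omega> x + c / 9) / G (\<omega> x)"] v(1) x c9_uni G_uni
    by (simp add: uni_divide uni_mult uni_minus)
qed

lemma double_root_nz:
  assumes x: "x \<in> A" "\<omega> x \<in> maxi"
  shows "\<omega> x \<noteq> 0"
proof -
  obtain e where "e \<in> uni" "(\<omega> x)\<^sup>2 = of_nat p ^ m * e" using double_root_sq[OF x] by blast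
  thus ?thesis using p_power_nz[of m] uni_nz[of e] by auto
qed

text \<open>To first order \<omega>^2 is the same for both roots, so they lie on opposite sides of
  c. Subtracting the two root equations, cancelling \<omega> x - \<omega> y and eliminating \<delta>
  makes \<omega> x + \<omega> y divisible by (\<omega> y)^2.\<close>

lemma double_root_quotient:
  assumes x: "x \<in> A" "\<omega> x \<in> maxi" and y: "y \<in> A" "\<omega> y \<in> maxi" and xy: "x \<noteq> y"
  shows "\<omega> x / \<omega> y + 1 \<in> maxi"
proof -
  obtain s where s: "s \<in> V" "G (\<omega> x) - G (\<omega> y) = (\<omega> x - \<omega> y) * s"
    using G_diff[OF maxi_mem[OF x(2)] maxi_mem[OF y(2)]] by blast
  have nz: "\<omega> x - \<omega> y \<noteq> 0" using xy by (simp add: \<omega>_def)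
  have y0: "\<omega> y \<noteq> 0" by (rule double_root_nz[OF y])
  have c9: "\<omega> y + c / 9 \<noteq> 0" using uni_nz[OF c9_uni[OF y(2)]] .
  have Gx: "G (\<omega> x) \<in> uni" "G (\<omega> y) \<in> V" using G_uni[OF x(2)] G_mem[OF maxi_mem[OF y(2)]] by auto
  have "(\<omega> x - \<omega> y) * ((\<omega> x + \<omega> y) * G (\<omega> x) + (\<omega> y)\<^sup>2 * s + \<delta>)
    = (\<omega> x)\<^sup>2 * G (\<omega> x) - (\<omega> y)\<^sup>2 * G (\<omega> x) + (\<omega> y)\<^sup>2 * ((\<omega> x - \<omega> y) * s) + \<delta> * (\<omega> x - \<omega> y)"
    by (simp add: algebra_simps power2_eq_square)
  also have "\<dots> = (\<omega> x)\<^sup>2 * G (\<omega> x) - (\<omega> y)\<^sup>2 * G (\<omega> y) + \<delta> * (\<omega> x - \<omega> y)"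
    unfolding s(2)[symmetric] by (simp add: algebra_simps)
  also have "\<dots> = 0" unfolding root_eq[OF x(1)] root_eq[OF y(1)] by (simp add: algebra_simps)
  finally have "(\<omega> x + \<omega> y) * G (\<omega> x) + ((\<omega> y)\<^sup>2 * s + \<delta>) = 0"
    using nz by (simp add: add.assoc)
  hence "(\<omega> x + \<omega> y) * G (\<omega> x) = - ((\<omega> y)\<^sup>2 * s + \<delta>)"
    by (rule eq_neg_iff_add_eq_0[THEN iffD2])
  also have "\<delta> = - ((\<omega> y)\<^sup>2 * G (\<omega> y)) / (\<omega> y + c / 9)"
    unfolding root_eq[OF y(1)] using c9 by simp
  finally have "(\<omega> x + \<omega> y) * G (\<omega> x) = \<omega> y * (\<omega> y * (G (\<omega> y) / (\<omega> y + c / 9) - s))"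
    by (simp add: algebra_simps power2_eq_square)
  hence "(\<omega> x + \<omega> y) / \<omega> y = \<omega> y * (G (\<omega> y) / (\<omega> y + c / 9) - s) / G (\<omega> x)"
    by (subst frac_eq_eq[OF y0 uni_nz[OF Gx(1)]]) (simp only: mult.commute)
  hence "\<omega> x / \<omega> y + 1 = \<omega> y * (G (\<omega> y) / (\<omega> y + c / 9) - s) / G (\<omega> x)"
    using y0 by (simp add: add_divide_distrib)
  also have "\<dots> \<in> maxi"
    using y(2) s(1) Gx c9_uni[OF y(2)] by (intro maxi_divide_uni maxi_mult(1) closed(3) divide_uni_mem)
  finally show ?thesis .
qed

text \<open>With three roots near c, all pairwise quotients would be -1 modulo the maximal ideal;
  multiplicativity of quotients gives 1 \<equiv> -1, impossible as 2 is a unit.\<close>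

lemma double_root_unique:
  assumes "x \<in> A" "\<omega> x \<in> maxi" "y \<in> A" "\<omega> y \<in> maxi" "x \<noteq> y"
    and "z \<in> A" "\<omega> z \<in> maxi" "x \<noteq> z"
  shows "y = z"
proof (rule ccontr)
  assume yz: "y \<noteq> z"
  have 1: "\<omega> x / \<omega> z + 1 \<in> maxi" and 2: "\<omega> y / \<omega> z + 1 \<in> maxi" and 3: "\<omega> x / \<omega> y + 1 \<in> maxi"
    using assms yz by (intro double_root_quotient; auto)+
  have "\<omega> y / \<omega> z \<in> V" using closed(3)[OF maxi_mem[OF 2] closed(1)] by simp
  hence "(\<omega> x / \<omega> y + 1) * (\<omega> y / \<omega> z) - (\<omega> x / \<omega> z + 1) - (\<omega> y / \<omega> z + 1) \<in> maxi"
    using 1 2 3 by (intro maxi_diff maxi_mult(1))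
  also have "(\<omega> x / \<omega> y + 1) * (\<omega> y / \<omega> z) - (\<omega> x / \<omega> z + 1) - (\<omega> y / \<omega> z + 1) = - 2"
    using double_root_nz[OF assms(3,4)] by (simp add: distrib_right add_divide_distrib)
  finally show False using numeral_uni(1) uni_not_maxi maxi_minus by fastforce
qed

lemma simple_root_G:
  assumes x: "x \<in> A" "\<omega> x \<in> uni"
  obtains s where "s \<in> V" "G (\<omega> x) = of_nat p ^ m * s"
proof -
  obtain v where v: "v \<in> uni" "\<delta> = of_nat p ^ m * v" by (rule \<delta>_eq)
  have "G (\<omega> x) = - \<delta> * (\<omega> x + c / 9) / (\<omega> x)\<^sup>2"
    by (rule nonzero_eq_divide_eq[OF uni_nz[OF uni_power[OF x(2)]], THEN iffD2])
      (simp only: root_eq[OF x(1), symmetric] mult.commute)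
  also have "\<dots> = of_nat p ^ m * (- v * (\<omega> x + c / 9) / (\<omega> x)\<^sup>2)" by (simp add: v(2))
  moreover have "- v * (\<omega> x + c / 9) / (\<omega> x)\<^sup>2 \<in> V"
    using v(1) x(2) c_uni numeral_uni
    by (intro divide_uni_mem uni_power closed(5,6) uni_mem[OF uni_minus] uni_mem[OF uni_divide]) (auto intro: uni_mem)
  ultimately show ?thesis using that by simp
qed

end

section \<open>Witnesses separating the two meeting roots\<close>

lemma rat_fun_Rats: "r \<in> \<rat> \<Longrightarrow> rat_fun (\<lambda>x. r)"
  using rat_fun_const by (elim Rats_cases) simp

context p_valuation
begin

lemma p_pos: "p > 0"
  using prime by (rule prime_gt_0_nat)

lemma int_inverse_mod:
  assumes "\<not> int p dvd t"
  obtains w :: int where "of_int w * of_int t - 1 \<in> maxi"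
proof -
  have "Factorial_Ring.prime (int p)" using prime by simp
  hence "coprime (int p) t" using assms by (intro prime_imp_coprime)
  then obtain v w where vw: "v * int p + w * t = 1"
    by (metis bezout_coefficients_fst_snd coprime_imp_gcd_eq_1)
  have "int p dvd w * t - 1" by (rule dvdI[of _ _ "- v"]) (use vw in \<open>simp add: algebra_simps\<close>)
  hence "of_int (w * t - 1) \<in> maxi" by (simp only: of_int_maxi_iff)
  thus ?thesis using that by simp
qed

end

context double_root
begin

text \<open>Where \<open>\<omega> x\<close> is a unit, \<open>G (\<omega> x)\<close> is divisible by \<open>p\<^sup>m\<close>; so \<open>z\<close> is negligible at the simple roots, while it has
  valuation \<open>m/2 - k\<close> and opposite leading terms at the two roots near \<open>c\<close>.\<close>

definition z :: "nat \<Rightarrow> complex \<Rightarrow> complex" where "z k x = \<omega> x * G (\<omega> x) / of_nat p ^ k"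

lemma rat_fun_\<omega>: "rat_fun \<omega>"
proof -
  have "rat_fun (\<lambda>x. x - c)" by (intro rat_fun_diff rat_fun_id rat_fun_Rats c_rat)
  thus ?thesis by (simp add: \<omega>_def[abs_def])
qed

lemma rat_fun_G: "rat_fun (\<lambda>x. G (\<omega> x))"
  unfolding G_def \<kappa>_def
  by (intro rat_fun_add rat_fun_mult rat_fun_power rat_fun_\<omega> rat_fun_Rats c_rat Rats_number_of Rats_mult Rats_power)

lemma rat_fun_z: "rat_fun (z k)"
proof -
  have "rat_fun (\<lambda>x. \<omega> x * G (\<omega> x) / of_nat p ^ k)"
    by (intro rat_fun_divide_const rat_fun_mult rat_fun_\<omega> rat_fun_G Rats_power Rats_of_nat)
  thus ?thesis by (simp add: z_def[abs_def])
qed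

lemma finite_A: "finite A"
  unfolding A_def by (rule finite_trinomial_roots)

lemma \<omega>_cases: "x \<in> A \<Longrightarrow> \<omega> x \<in> uni \<or> \<omega> x \<in> maxi"
  using \<omega>_mem uni_or_maxi by blast

lemma z_simple:
  assumes "x \<in> A" "\<omega> x \<in> uni" "k < m"
  shows "z k x \<in> maxi"
proof -
  obtain s where s: "s \<in> V" "G (\<omega> x) = of_nat p ^ m * s" using simple_root_G[OF assms(1,2)] by blast
  have "(of_nat p :: complex) ^ m = of_nat p ^ (m - k) * of_nat p ^ k"
    using assms(3) by (simp flip: power_add)
  hence "z k x = of_nat p ^ (m - k) * (\<omega> x * s)"
    unfolding z_def s(2) using p_pos by simp
  also have "\<dots> \<in> maxi"
    using assms s(1) by (intro maxi_mult(1) p_power_maxi closed(6) uni_mem[OF assms(2)]) simp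
  finally show ?thesis .
qed

text \<open>The quotient is -1 and both values of \<open>G\<close> are \<kappa> modulo the maximal
  ideal. It follows that \<open>z\<close> has opposite leading terms at the two roots.\<close>

lemma quotient_G:
  assumes "x \<in> A" "\<omega> x \<in> maxi" "y \<in> A" "\<omega> y \<in> maxi" "x \<noteq> y"
  shows "\<omega> x / \<omega> y * G (\<omega> x) + G (\<omega> y) \<in> maxi"
proof -
  have "(\<omega> x / \<omega> y + 1) * G (\<omega> x) - (G (\<omega> x) - \<kappa>) + (G (\<omega> y) - \<kappa>) \<in> maxi"
    using assms by (intro maxi_add maxi_diff maxi_mult(1) G_cong double_root_quotient G_mem) (auto intro: maxi_mem)
  thus ?thesis by (simp add: algebra_simps)
qed

lemma double_roots_le_1:
  assumes "x \<in> A" "\<omega> x \<in> maxi"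
  shows "card {y \<in> A - {x}. \<omega> y \<in> maxi} \<le> 1"
proof -
  have "finite {y \<in> A - {x}. \<omega> y \<in> maxi}" using finite_A by simp
  thus ?thesis using double_root_unique[OF assms] by (subst One_nat_def, subst card_le_Suc0_iff_eq) auto
qed

text \<open>\<omega>/p^k has valuation 1/2 near c, so the two roots form a tame class with e = 2.
  Adding z to the root lowers the valuation of their difference from m/2 to 1/2 and leaves all
  residues unchanged.\<close>

lemma tame_on_odd:
  assumes m: "m = 2 * k + 1"
  shows "\<exists>\<phi>. rat_fun \<phi> \<and> tame_on A \<phi>"
proof -
  \<comment> \<open>For k = 0 the roots already differ by valuation 1/2, and adding z could spoil
    this: the quotient would be 2 + 2\<kappa> modulo the maximal ideal, possibly 0.\<close>
  define j :: nat where "j = (if k = 0 then 0 else 1)"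
  define \<phi> where "\<phi> x = x + of_nat j * z k x" for x
  define v where "v x = \<omega> x / of_nat p ^ k" for x
  have vsq: "\<exists>e\<in>uni. (v x)\<^sup>2 = of_nat p * e" if x: "x \<in> A" "\<omega> x \<in> maxi" for x
  proof -
    obtain e where e: "e \<in> uni" "(\<omega> x)\<^sup>2 = of_nat p ^ m * e" using double_root_sq[OF x] by blast
    have "(v x)\<^sup>2 = of_nat p ^ m * e / (of_nat p ^ k)\<^sup>2" by (simp add: v_def power_divide e(2))
    also have "(of_nat p :: complex) ^ m = of_nat p * (of_nat p ^ k)\<^sup>2"
      by (simp add: m power_mult mult.commute[of k 2] flip: power_mult)
    finally show ?thesis using e(1) p_pos by auto
  qed
  have vm: "v x \<in> maxi" if x: "x \<in> A" "\<omega> x \<in> maxi" for x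
  proof -
    obtain e where e: "e \<in> uni" "(v x)\<^sup>2 = of_nat p * e" using vsq[OF x] by blast
    have "(v x)\<^sup>2 \<in> maxi" unfolding e(2) using e(1) by (intro maxi_mult(1) p_maxi uni_mem)
    thus ?thesis by (simp add: maxi_power_iff)
  qed
  have zv: "z k x = v x * G (\<omega> x)" for x by (simp add: z_def v_def)
  have zm: "z k x \<in> maxi" if x: "x \<in> A" for x
    using \<omega>_cases[OF x]
  proof
    assume "\<omega> x \<in> uni"
    thus ?thesis using z_simple[OF x] m by simp
  next
    assume "\<omega> x \<in> maxi"
    thus ?thesis unfolding zv using vm[OF x] G_mem[OF \<omega>_mem[OF x]] by (intro maxi_mult(1))
  qed
  have simple: "\<phi> x - \<phi> y \<in> uni" if "x \<in> A" "y \<in> A" "x - y \<in> uni" for x y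
  proof -
    have "(x - y) + of_nat j * (z k x - z k y) \<in> uni"
      using that by (intro uni_add_maxi maxi_mult(2) closed(11) maxi_diff zm)
    thus ?thesis by (simp add: \<phi>_def algebra_simps)
  qed
  have "tame_on A \<phi>"
  proof (rule tame_onI[OF finite_A])
    fix x assume x: "x \<in> A"
    show "\<phi> x \<in> V" unfolding \<phi>_def
      using maxi_mem[OF zm[OF x]] A_mem[OF x] by (intro closed(5,6,11))
    show "\<exists>C w. C \<subseteq> A - {x} \<and> w \<noteq> 0 \<and> (\<forall>y\<in>A - {x} - C. \<phi> x - \<phi> y \<in> uni) \<and>
      (\<forall>y\<in>C. (\<phi> x - \<phi> y) / w \<in> uni) \<and> of_nat p / w ^ card C \<in> maxi"
    proof (cases "\<omega> x \<in> uni")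
      case True
      have "\<forall>y\<in>A - {x}. \<phi> x - \<phi> y \<in> uni"
        using x True by (auto intro!: simple simple_root_diff)
      thus ?thesis using p_maxi by (intro exI[of _ "{}"] exI[of _ 1]) simp
    next
      case False
      hence xm: "\<omega> x \<in> maxi" using \<omega>_cases[OF x] by blast
      define C where "C = {y \<in> A - {x}. \<omega> y \<in> maxi}"
      have v0: "v x \<noteq> 0" using double_root_nz[OF x xm] p_power_nz[of k] by (simp add: v_def)
      have 1: "\<phi> x - \<phi> y \<in> uni" if y: "y \<in> A - {x} - C" for y
      proof (rule simple[OF x])
        have "\<omega> y \<in> uni" using y \<omega>_cases[of y] by (auto simp: C_def)
        hence "y - x \<in> uni" using x y by (intro simple_root_diff) auto
        from uni_minus[OF this] show "x - y \<in> uni" by simp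
      qed (use y in auto)
      have 2: "(\<phi> x - \<phi> y) / v x \<in> uni" if y: "y \<in> C" for y
      proof -
        have y': "y \<in> A" "\<omega> y \<in> maxi" "y \<noteq> x" using y by (auto simp: C_def)
        define \<rho> where "\<rho> = \<omega> y / \<omega> x"
        have \<rho>: "\<rho> + 1 \<in> maxi" unfolding \<rho>_def by (rule double_root_quotient[OF y'(1,2) x xm y'(3)])
        have \<rho>u: "1 - \<rho> \<in> uni" using uni_diff_maxi[OF numeral_uni(1) \<rho>] by simp
        have q: "\<rho> * G (\<omega> y) + G (\<omega> x) \<in> maxi" unfolding \<rho>_def by (rule quotient_G[OF y'(1,2) x xm y'(3)])
        have vy: "v y = \<rho> * v x" using double_root_nz[OF x xm] by (simp add: v_def \<rho>_def)
        have \<omega>v: "\<omega> w = of_nat p ^ k * v w" for w using p_power_nz[of k] by (simp add: v_def)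
        have "\<phi> x - \<phi> y = (\<omega> x - \<omega> y) + of_nat j * (v x * G (\<omega> x) - v y * G (\<omega> y))"
          by (simp add: \<phi>_def zv \<omega>_def algebra_simps)
        also have "\<omega> x - \<omega> y = v x * (of_nat p ^ k * (1 - \<rho>))"
          unfolding \<omega>v vy by (simp add: algebra_simps)
        also have "v x * G (\<omega> x) - v y * G (\<omega> y) = v x * (G (\<omega> x) - \<rho> * G (\<omega> y))"
          unfolding vy by (simp add: algebra_simps)
        finally have eq: "(\<phi> x - \<phi> y) / v x = of_nat p ^ k * (1 - \<rho>) + of_nat j * (G (\<omega> x) - \<rho> * G (\<omega> y))"
          using v0 by (simp add: add_divide_distrib)
        show ?thesis
        proof (cases "k = 0")
          case True
          thus ?thesis unfolding eq using \<rho>u by (simp add: j_def)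
        next
          case False
          have "2 * G (\<omega> x) - (\<rho> * G (\<omega> y) + G (\<omega> x)) \<in> uni"
            using q numeral_uni(1) G_uni[OF xm] by (intro uni_diff_maxi uni_mult)
          hence "of_nat p ^ k * (1 - \<rho>) + (2 * G (\<omega> x) - (\<rho> * G (\<omega> y) + G (\<omega> x))) \<in> uni"
            using False \<rho>u by (intro maxi_add_uni maxi_mult(1) p_power_maxi uni_mem[OF \<rho>u]) auto
          thus ?thesis unfolding eq using False by (simp add: j_def)
        qed
      qed
      have 3: "of_nat p / v x ^ card C \<in> maxi"
      proof (cases "card C = 0")
        case False
        hence c1: "card C = 1" using double_roots_le_1[OF x xm] by (simp add: C_def)
        obtain e where e: "e \<in> uni" "(v x)\<^sup>2 = of_nat p * e" using vsq[OF x xm] by blast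
        have "of_nat p / v x = v x / e"
          using v0 uni_nz[OF e(1)] e(2) by (simp add: frac_eq_eq power2_eq_square)
        also have "\<dots> \<in> maxi" using vm[OF x xm] e(1) by (rule maxi_divide_uni)
        finally show ?thesis using c1 by simp
      qed (use p_maxi in simp)
      show ?thesis using 1 2 3 v0 by (intro exI[of _ C] exI[of _ "v x"]) (auto simp: C_def)
    qed
  qed
  moreover have "rat_fun \<phi>"
    unfolding \<phi>_def by (intro rat_fun_add rat_fun_id rat_fun_mult rat_fun_of_nat rat_fun_z)
  ultimately show ?thesis by blast
qed

text \<open>The residues of the simple roots leave room for a pair \<open>r \<plusminus> s z\<^sub>0\<close>: if \<open>z\<^sub>0\<close> is rational modulo
  the maximal ideal, the pair \<open>0, c\<close> is free; otherwise there are ten disjoint pairs with \<open>r \<in> {0..4}\<close>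
  and \<open>s \<in> {1,2}\<close>, but at most nine roots.\<close>

lemma free_residues:
  assumes z0: "z0 \<in> uni"
  obtains r s where "r \<in> \<rat>" "s \<in> \<rat>" "r \<in> V" "s \<in> uni"
    "\<And>x. x \<in> A \<Longrightarrow> \<omega> x \<in> uni \<Longrightarrow> x - (r + s * z0) \<in> uni"
    "\<And>x. x \<in> A \<Longrightarrow> \<omega> x \<in> uni \<Longrightarrow> x - (r - s * z0) \<in> uni"
proof (cases "\<exists>\<rho>::int. z0 - of_int \<rho> \<in> maxi")
  case True
  then obtain \<rho> :: int where \<rho>: "z0 - of_int \<rho> \<in> maxi" by blast
  have \<rho>u: "of_int \<rho> \<in> uni" using uni_diff_maxi[OF z0 \<rho>] by simp
  \<comment> \<open>With r = c/2 this makes the pair congruent to 0 and c. Every root is a unit,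
    hence avoids 0, and the simple roots avoid c.\<close>
  define s where "s = - c / (2 * of_int \<rho>)"
  have s: "s \<in> uni" unfolding s_def using c_uni \<rho>u numeral_uni by (intro uni_divide uni_minus uni_mult)
  have s\<rho>: "s * of_int \<rho> = - (c / 2)" using uni_nz[OF \<rho>u] by (simp add: s_def)
  have sm: "s * (z0 - of_int \<rho>) \<in> maxi" using s \<rho> by (intro maxi_mult(2) uni_mem)
  show ?thesis
  proof (rule that[of "c / 2" s])
    show "c / 2 \<in> \<rat>" "s \<in> \<rat>" unfolding s_def
      by (intro Rats_divide Rats_minus_iff[THEN iffD2] Rats_mult c_rat Rats_number_of Rats_of_int)+
    show "c / 2 \<in> V" using c_uni numeral_uni by (intro uni_mem uni_divide)
    fix x assume x: "x \<in> A" "\<omega> x \<in> uni"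
    have "x - s * (z0 - of_int \<rho>) \<in> uni" using A_uni[OF x(1)] sm by (rule uni_diff_maxi)
    thus "x - (c / 2 + s * z0) \<in> uni" by (simp add: algebra_simps s\<rho>)
    have "\<omega> x + s * (z0 - of_int \<rho>) \<in> uni" using x(2) sm by (rule uni_add_maxi)
    also have "\<omega> x + s * (z0 - of_int \<rho>) = x - (c / 2 - s * z0)"
      by (simp add: right_diff_distrib s\<rho> \<omega>_def)
    finally show "x - (c / 2 - s * z0) \<in> uni" .
  qed (rule s)
next
  case False
  define S :: "(int \<times> int) set" where "S = {0..4} \<times> {1..2}"
  \<comment> \<open>The root x occupies one of the two residues of the pair (i, j).\<close>
  define P where "P = (\<lambda>(i, j) x. x \<in> A \<and> (\<exists>\<epsilon>\<in>{1, -1}. x - (of_int i + of_int (\<epsilon> * j) * z0) \<in> maxi))"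
  have ex: "\<exists>ij\<in>S. \<forall>x. \<not> P ij x"
  proof (rule ccontr)
    assume "\<not> ?thesis"
    then obtain h where h: "\<And>ij. ij \<in> S \<Longrightarrow> P ij (h ij)" by metis
    have "inj_on h S"
    proof (rule inj_onI)
      fix ij ij' assume ij: "ij \<in> S" "ij' \<in> S" "h ij = h ij'"
      obtain i j i' j' where e: "ij = (i, j)" "ij' = (i', j')" by (metis surj_pair)
      have bnd: "0 \<le> i" "i \<le> 4" "0 \<le> i'" "i' \<le> 4" "1 \<le> j" "j \<le> 2" "1 \<le> j'" "j' \<le> 2"
        using ij unfolding e by (auto simp: S_def)
      obtain \<epsilon> where \<epsilon>: "\<epsilon> \<in> {1, -1}" "h ij - (of_int i + of_int (\<epsilon> * j) * z0) \<in> maxi"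
        using h[OF ij(1)] unfolding P_def e(1) prod.case by blast
      obtain \<epsilon>' where \<epsilon>': "\<epsilon>' \<in> {1, -1}" "h ij' - (of_int i' + of_int (\<epsilon>' * j') * z0) \<in> maxi"
        using h[OF ij(2)] unfolding P_def e(2) prod.case by blast
      define t where "t = \<epsilon> * j - \<epsilon>' * j'"
      have "(h ij' - (of_int i' + of_int (\<epsilon>' * j') * z0)) - (h ij - (of_int i + of_int (\<epsilon> * j) * z0)) \<in> maxi"
        by (rule maxi_diff[OF \<epsilon>'(2) \<epsilon>(2)])
      hence t: "of_int (i - i') + of_int t * z0 \<in> maxi"
        unfolding ij(3) t_def by (simp add: algebra_simps)
      have tb: "\<bar>t\<bar> \<le> 4" using bnd \<epsilon>(1) \<epsilon>'(1) by (auto simp: t_def)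
      \<comment> \<open>A nonzero t is at most 4 in absolute value, hence invertible modulo p, and
        dividing by it would make z0 congruent to an integer.\<close>
      have "t = 0"
      proof (rule ccontr)
        assume "t \<noteq> 0"
        hence "\<not> int p dvd t" using tb p5 zdvd_imp_le[of "int p" "\<bar>t\<bar>"] by auto
        then obtain w where w: "of_int w * of_int t - 1 \<in> maxi" by (rule int_inverse_mod)
        have "of_int w * (of_int (i - i') + of_int t * z0) - (of_int w * of_int t - 1) * z0 \<in> maxi"
          by (rule maxi_diff[OF maxi_mult(2)[OF closed(10) t] maxi_mult(1)[OF w uni_mem[OF z0]]])
        hence "z0 - of_int (- w * (i - i')) \<in> maxi" by (simp add: algebra_simps)
        thus False using \<open>\<not> (\<exists>\<rho>::int. _ \<rho>)\<close> by blast
      qed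
      hence "of_int (i - i') \<in> maxi" using t by simp
      hence "int p dvd i - i'" by (simp only: of_int_maxi_iff)
      hence "i \<noteq> i' \<longrightarrow> int p \<le> \<bar>i - i'\<bar>" using zdvd_imp_le[of "int p" "\<bar>i - i'\<bar>"] by simp
      hence "i = i'" using bnd p5 by linarith
      moreover have "j = j'" using \<open>t = 0\<close> bnd \<epsilon>(1) \<epsilon>'(1) by (auto simp: t_def)
      ultimately show "ij = ij'" by (simp add: e)
    qed
    moreover have "h ` S \<subseteq> A" using h by (auto simp: P_def)
    ultimately have "card S \<le> card A" using finite_A by (intro card_inj_on_le)
    moreover have "card S = 10" by (simp add: S_def card_cartesian_product)
    ultimately show False using card_trinomial_roots[of "of_int a" "of_int b"] by (simp add: A_def)
  qed
  then obtain i j where ij: "(i, j) \<in> S" "\<And>x. \<not> P (i, j) x" by auto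
  have "\<not> int p dvd j" using ij(1) p5 by (auto simp: S_def dest!: zdvd_imp_le)
  hence ju: "of_int j \<in> uni" by (simp add: of_int_uni_iff)
  have free: "x - (of_int i + of_int (\<epsilon> * j) * z0) \<in> uni" if "x \<in> A" "\<epsilon> \<in> {1, -1}" for x \<epsilon>
  proof -
    have "x - (of_int i + of_int (\<epsilon> * j) * z0) \<notin> maxi" using ij(2)[of x] that by (auto simp: P_def)
    moreover have "x - (of_int i + of_int (\<epsilon> * j) * z0) \<in> V"
      using A_mem[OF that(1)] uni_mem[OF z0] by (intro closed(3,5,6,10))
    ultimately show ?thesis using uni_or_maxi by blast
  qed
  show ?thesis
    by (rule that[of "of_int i" "of_int j"]) (use free[of _ 1] free[of _ "-1"] ju closed(10) in auto)
qed

text \<open>Near c the function z is a unit with opposite residues at the two roots, so the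
  extension is unramified there and all nine values can be made incongruent: simple roots keep their
  residues, the other two go to the free pair r \<plusminus> s z0.\<close>

lemma tame_on_even:
  assumes m: "m = 2 * k"
  shows "\<exists>\<phi>. rat_fun \<phi> \<and> tame_on A \<phi>"
proof (cases "\<exists>x\<in>A. \<omega> x \<in> maxi")
  case False
  hence "\<forall>x\<in>A. \<omega> x \<in> uni" using \<omega>_cases by blast
  hence "tame_on A (\<lambda>x. x)"
    by (intro tame_on_unramified finite_A A_mem simple_root_diff) auto
  thus ?thesis using rat_fun_id by blast
next
  case True
  then obtain x0 where x0: "x0 \<in> A" "\<omega> x0 \<in> maxi" by blast
  define v where "v x = \<omega> x / of_nat p ^ k" for x
  have vu: "v x \<in> uni" if x: "x \<in> A" "\<omega> x \<in> maxi" for x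
  proof -
    obtain e where e: "e \<in> uni" "(\<omega> x)\<^sup>2 = of_nat p ^ m * e" using double_root_sq[OF x] by blast
    have "(v x)\<^sup>2 = of_nat p ^ m * e / (of_nat p ^ k)\<^sup>2" by (simp add: v_def power_divide e(2))
    also have "(of_nat p :: complex) ^ m = (of_nat p ^ k)\<^sup>2"
      by (simp add: m mult.commute flip: power_mult)
    finally have "(v x)\<^sup>2 = e" using p_pos by simp
    thus ?thesis using e(1) uni_power_iff[of 2 "v x"] by simp
  qed
  \<comment> \<open>A root congruent to c forces p to divide the discriminant; positivity of k also
    gives k < m, as \<open>z_simple\<close> requires.\<close>
  have k: "k > 0"
  proof (rule ccontr)
    assume "\<not> k > 0"
    hence "\<omega> x0 \<in> uni" using vu[OF x0] by (simp add: v_def)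
    thus False using x0 uni_not_maxi by blast
  qed
  have zv: "z k x = v x * G (\<omega> x)" for x by (simp add: z_def v_def)
  have zu: "z k x \<in> uni" if x: "x \<in> A" "\<omega> x \<in> maxi" for x
    unfolding zv by (intro uni_mult vu[OF x] G_uni x)
  have zz: "z k x + z k y \<in> maxi" if x: "x \<in> A" "\<omega> x \<in> maxi" and y: "y \<in> A" "\<omega> y \<in> maxi" and "x \<noteq> y" for x y
  proof -
    have "v x = \<omega> x / \<omega> y * v y" using double_root_nz[OF y] by (simp add: v_def)
    hence "z k x + z k y = v y * (\<omega> x / \<omega> y * G (\<omega> x) + G (\<omega> y))"
      unfolding zv by (simp add: algebra_simps)
    also have "\<dots> \<in> maxi" using vu[OF y] quotient_G[OF x y \<open>x \<noteq> y\<close>] by (intro maxi_mult(2) uni_mem)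
    finally show ?thesis .
  qed
  obtain r s where rs: "r \<in> \<rat>" "s \<in> \<rat>" "r \<in> V" "s \<in> uni"
    and free: "\<And>x. x \<in> A \<Longrightarrow> \<omega> x \<in> uni \<Longrightarrow> x - (r + s * z k x0) \<in> uni"
      "\<And>x. x \<in> A \<Longrightarrow> \<omega> x \<in> uni \<Longrightarrow> x - (r - s * z k x0) \<in> uni"
    using free_residues[OF zu[OF x0]] by blast
  \<comment> \<open>At the meeting roots x \<equiv> c and G \<equiv> \<kappa>, so adding l G moves
    the residue c to r; at the simple roots G is divisible by p^m and the correction
    vanishes.\<close>
  define l where "l = (r - c) / \<kappa>"
  have lV: "l \<in> V" unfolding l_def using rs(3) c_mem \<kappa>_uni by (intro divide_uni_mem closed(3))
  have l\<kappa>: "l * \<kappa> = r - c" using uni_nz[OF \<kappa>_uni] by (simp add: l_def)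
  define \<phi> where "\<phi> x = x + s * z k x + l * G (\<omega> x)" for x
  have simple: "\<phi> x - x \<in> maxi" if x: "x \<in> A" "\<omega> x \<in> uni" for x
  proof -
    obtain t where t: "t \<in> V" "G (\<omega> x) = of_nat p ^ m * t" using simple_root_G[OF x] by blast
    have "G (\<omega> x) \<in> maxi" unfolding t(2) using t(1) k m by (intro maxi_mult(1) p_power_maxi) auto
    moreover have "z k x \<in> maxi" using z_simple[OF x] k m by simp
    ultimately have "s * z k x + l * G (\<omega> x) \<in> maxi"
      by (intro maxi_add maxi_mult(2)[OF uni_mem[OF rs(4)]] maxi_mult(2)[OF lV])
    thus ?thesis by (simp add: \<phi>_def)
  qed
  have double: "\<phi> x - (r + s * z k x) \<in> maxi" if x: "x \<in> A" "\<omega> x \<in> maxi" for x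
  proof -
    have "\<omega> x + l * (G (\<omega> x) - \<kappa>) \<in> maxi" using x lV by (intro maxi_add maxi_mult(2) G_cong)
    thus ?thesis by (simp add: \<phi>_def right_diff_distrib l\<kappa> \<omega>_def algebra_simps)
  qed
  have sd: "\<phi> x - \<phi> y \<in> uni" if x: "x \<in> A" "\<omega> x \<in> uni" and y: "y \<in> A" "\<omega> y \<in> maxi" for x y
  proof -
    have "x - (r + s * z k y) \<in> uni"
    \<comment> \<open>At the second meeting root z is congruent to the negative of its value at
      \<open>x0\<close>, so the other half of the free pair is used.\<close>
    proof (cases "y = x0")
      case True
      thus ?thesis using free(1)[OF x] by simp
    next
      case False
      have "x - (r - s * z k x0) - s * (z k y + z k x0) \<in> uni"
        by (rule uni_diff_maxi[OF free(2)[OF x] maxi_mult(2)[OF uni_mem[OF rs(4)] zz[OF y x0 False]]])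
      thus ?thesis by (simp add: algebra_simps)
    qed
    hence "x - (r + s * z k y) + ((\<phi> x - x) - (\<phi> y - (r + s * z k y))) \<in> uni"
      by (rule uni_add_maxi[OF _ maxi_diff[OF simple[OF x] double[OF y]]])
    thus ?thesis by simp
  qed
  have "\<phi> x - \<phi> y \<in> uni" if xy: "x \<in> A" "y \<in> A" "x \<noteq> y" for x y
  proof (cases "\<omega> x \<in> uni"; cases "\<omega> y \<in> uni")
    assume u: "\<omega> x \<in> uni" "\<omega> y \<in> uni"
    have "(x - y) + ((\<phi> x - x) - (\<phi> y - y)) \<in> uni"
      by (rule uni_add_maxi[OF simple_root_diff[OF xy(1) u(1) xy(2,3)] maxi_diff[OF simple[OF xy(1) u(1)] simple[OF xy(2) u(2)]]])
    thus ?thesis by simp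
  next
    assume "\<omega> x \<in> uni" "\<omega> y \<notin> uni"
    thus ?thesis using sd xy \<omega>_cases by blast
  next
    assume "\<omega> x \<notin> uni" "\<omega> y \<in> uni"
    hence "\<phi> y - \<phi> x \<in> uni" using sd xy \<omega>_cases by blast
    from uni_minus[OF this] show ?thesis by simp
  next
    assume "\<omega> x \<notin> uni" "\<omega> y \<notin> uni"
    hence m: "\<omega> x \<in> maxi" "\<omega> y \<in> maxi" using xy \<omega>_cases by blast+
    have "s * (2 * z k x - (z k x + z k y)) \<in> uni"
      using xy m by (intro uni_mult rs(4) uni_diff_maxi numeral_uni zu zz)
    from uni_add_maxi[OF this maxi_diff[OF double[OF xy(1) m(1)] double[OF xy(2) m(2)]]]
    have "s * (2 * z k x - (z k x + z k y)) + ((\<phi> x - (r + s * z k x)) - (\<phi> y - (r + s * z k y))) \<in> uni" .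
    thus ?thesis by (simp add: algebra_simps)
  qed
  moreover have "\<phi> x \<in> V" if x: "x \<in> A" for x
  proof -
    have "z k x \<in> V"
      using \<omega>_cases[OF x] z_simple[OF x, of k] zu[OF x] k m by (auto intro: uni_mem maxi_mem)
    thus ?thesis
      unfolding \<phi>_def using closed(5)[OF closed(5)[OF A_mem[OF x] closed(6)[OF uni_mem[OF rs(4)]]]
        closed(6)[OF lV G_mem[OF \<omega>_mem[OF x]]]] by simp
  qed
  ultimately have "tame_on A \<phi>" by (intro tame_on_unramified finite_A)
  moreover have "rat_fun \<phi>"
    unfolding \<phi>_def l_def \<kappa>_def using rs c_rat
    by (intro rat_fun_add rat_fun_id rat_fun_mult rat_fun_z rat_fun_G rat_fun_Rats Rats_divide Rats_diff Rats_mult Rats_power Rats_number_of)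
  ultimately show ?thesis by blast
qed

lemma ex_tame_on: "\<exists>\<phi>. rat_fun \<phi> \<and> tame_on A \<phi>"
  using tame_on_even[of "m div 2"] tame_on_odd[of "m div 2"] by (cases "even m") auto

end

section \<open>Case distinction on the Newton polygon and conclusion\<close>

context p_valuation
begin

text \<open>The cases are the positions of (1, \<alpha>) relative to the segment from (0, \<beta>)
  to (9, 0). If it lies on the segment, then \<alpha> = 8s and \<beta> = 9s; dividing the roots by
  p^s is a rational operation, makes both coefficients prime to p and removes p^(72 s) from the
  discriminant.\<close>

lemma ex_tame_on_trinomial_roots:
  fixes a b :: int
  assumes p5: "p \<ge> 5" and ab: "a \<noteq> 0" "b \<noteq> 0" and disc: "8 ^ 8 * a ^ 9 + 9 ^ 9 * b ^ 8 \<noteq> 0"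
  shows "\<exists>\<phi>. rat_fun \<phi> \<and> tame_on (trinomial_roots (of_int a) (of_int b)) \<phi>"
proof -
  have up: "\<not> is_unit (int p)" using prime by (auto simp: prime_nat_iff)
  obtain a' where a': "a = int p ^ multiplicity (int p) a * a'" "\<not> int p dvd a'"
    using multiplicity_decompose'[OF ab(1) up] by blast
  obtain b' where b': "b = int p ^ multiplicity (int p) b * b'" "\<not> int p dvd b'"
    using multiplicity_decompose'[OF ab(2) up] by blast
  define \<alpha> \<beta> where "\<alpha> = multiplicity (int p) a" and "\<beta> = multiplicity (int p) b"
  note a = a'(1)[folded \<alpha>_def] and b = b'(1)[folded \<beta>_def]
  consider "8 * \<beta> < 9 * \<alpha>" | "9 * \<alpha> < 8 * \<beta>" | "9 * \<alpha> = 8 * \<beta>" by linarith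
  thus ?thesis
  proof cases
    case 1
    from newton_polygon_one_side[OF p5 b'(2) a'(2) this] show ?thesis using a b by simp
  next
    case 2
    from newton_polygon_two_sides[OF p5 b'(2) a'(2) this] show ?thesis using a b by simp
  next
    case 3
    have "coprime (8::nat) 9" using coprime_Suc_right_nat[of 8] by (simp del: coprime_Suc_right_nat)
    moreover have "8 dvd 9 * \<alpha>" unfolding 3 by simp
    ultimately have "8 dvd \<alpha>" by (simp only: coprime_dvd_mult_right_iff)
    then obtain s where \<alpha>: "\<alpha> = 8 * s" by (elim dvdE)
    have \<beta>: "\<beta> = 9 * s" using 3 unfolding \<alpha> by linarith
    define \<psi> where "\<psi> x = x / of_nat p ^ s" for x :: complex
    have x: "x = of_nat p ^ s * \<psi> x" for x using p_nz by (simp add: \<psi>_def)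
    have iff: "of_nat p ^ s * y \<in> trinomial_roots (of_int a) (of_int b) \<longleftrightarrow> y \<in> trinomial_roots (of_int a') (of_int b')" for y
    proof -
      have "(of_nat p ^ s * y) ^ 9 + of_int a * (of_nat p ^ s * y) + of_int b
        = (of_nat p ^ s) ^ 9 * y ^ 9 + (of_nat p ^ s) ^ 8 * of_nat p ^ s * (of_int a' * y) + (of_nat p ^ s) ^ 9 * of_int b'"
        by (subst a, subst b) (simp add: \<alpha> \<beta> power_mult_distrib mult.commute[of _ s] power_mult)
      also have "\<dots> = (of_nat p ^ s) ^ 9 * (y ^ 9 + of_int a' * y + of_int b')"
      proof -
        have "(of_nat p ^ s :: complex) ^ 8 * of_nat p ^ s = (of_nat p ^ s) ^ 9" by (simp flip: power_Suc2)
        thus ?thesis by (simp only: distrib_left)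
      qed
      finally show ?thesis using p_nz by (simp add: trinomial_roots_def)
    qed
    have im: "\<psi> ` trinomial_roots (of_int a) (of_int b) = trinomial_roots (of_int a') (of_int b')"
    proof (intro equalityI subsetI)
      fix y assume "y \<in> \<psi> ` trinomial_roots (of_int a) (of_int b)"
      thus "y \<in> trinomial_roots (of_int a') (of_int b')" using iff x by auto metis
    next
      fix y assume "y \<in> trinomial_roots (of_int a') (of_int b')"
      hence "of_nat p ^ s * y \<in> trinomial_roots (of_int a) (of_int b)" by (simp only: iff)
      moreover have "y = \<psi> (of_nat p ^ s * y)" using p_nz by (simp add: \<psi>_def)
      ultimately show "y \<in> \<psi> ` trinomial_roots (of_int a) (of_int b)" by (rule rev_image_eqI)
    qed
    have "8 ^ 8 * a ^ 9 + 9 ^ 9 * b ^ 8 = int p ^ (72 * s) * (8 ^ 8 * a' ^ 9 + 9 ^ 9 * b' ^ 8)"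
      by (subst a, subst b) (simp add: \<alpha> \<beta> power_mult_distrib distrib_left flip: power_mult)
    hence "8 ^ 8 * a' ^ 9 + 9 ^ 9 * b' ^ 8 \<noteq> 0" using disc by auto
    from multiplicity_decompose'[OF this up] obtain u where
      u: "8 ^ 8 * a' ^ 9 + 9 ^ 9 * b' ^ 8 = int p ^ multiplicity (int p) (8 ^ 8 * a' ^ 9 + 9 ^ 9 * b' ^ 8) * u" "\<not> int p dvd u"
      by blast
    interpret D: double_root V p a' b' "multiplicity (int p) (8 ^ 8 * a' ^ 9 + 9 ^ 9 * b' ^ 8)" u
      by unfold_locales (use p5 a' b' u in auto)
    obtain \<phi> where \<phi>: "rat_fun \<phi>" "tame_on (trinomial_roots (of_int a') (of_int b')) \<phi>"
      using D.ex_tame_on unfolding D.A_def by blast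
    have inj: "inj \<psi>" using p_nz by (auto simp: inj_def \<psi>_def)
    have "tame_on (trinomial_roots (of_int a) (of_int b)) (\<lambda>x. \<phi> (\<psi> x))"
      by (rule tame_on_compose[OF inj_on_subset[OF inj subset_UNIV]]) (simp only: im \<phi>(2))
    moreover have "rat_fun \<psi>" unfolding \<psi>_def[abs_def]
      by (intro rat_fun_divide_const rat_fun_id Rats_power Rats_of_nat)
    ultimately show ?thesis
      using rat_fun_compose[OF \<phi>(1)] by (intro exI[of _ "\<lambda>x. \<phi> (\<psi> x)"] conjI)
  qed
qed

end

lemma ex_p_valuation:
  assumes p: "Factorial_Ring.prime p"
  obtains V where "p_valuation V p"
proof -
  have "inverse (of_nat p) \<notin> (range of_int :: complex set)"
  proof
    assume "inverse (of_nat p) \<in> (range of_int :: complex set)"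
    then obtain i where "inverse (of_nat p) = (of_int i :: complex)" by auto
    moreover have "of_nat p \<noteq> (0 :: complex)" using p by auto
    ultimately have "of_int (i * int p) = (1 :: complex)" by (simp flip: \<open>inverse _ = _\<close>)
    hence "i * int p = 1" by (simp only: of_int_eq_1_iff)
    hence "is_unit (int p)" by (metis dvd_triv_right)
    thus False using p by (auto simp: prime_nat_iff)
  qed
  moreover have "of_nat p \<in> (range of_int :: complex set)" by (metis of_int_of_nat_eq rangeI)
  ultimately obtain V where V: "valuation_ring V" "(range of_int :: complex set) \<subseteq> V" "inverse (of_nat p) \<notin> V"
    using ex_valuation_ring[OF is_subring_Ints] by metis
  interpret valuation_ring V by (rule V(1))
  have "of_nat p \<in> maxi" using V(3) closed(11) by (simp add: maxi_def)
  hence "p_valuation V p" using p by unfold_locales auto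
  thus ?thesis using that by blast
qed

theorem theorem1p3:
  fixes a b :: int and F :: "int poly" and \<theta> :: complex and K :: "complex set" and p :: nat
  assumes "a * b \<noteq> 0"
    and "F = Polynomial.monom 1 9 + Polynomial.monom a 1 + [:b:]"
    and "Factorial_Ring.irreducible (map_poly rat_of_int F)"
    and "poly (map_poly complex_of_int F) \<theta> = 0"
    and "K = rat_adjoin \<theta>"
    and "Factorial_Ring.prime p" and "p \<ge> 5"
  shows "\<not> common_index_divisor p K"
proof -
  define f where "f = map_poly rat_of_int F"
  have fF: "rpoly f x = poly (map_poly complex_of_int F) x" for x
    by (simp add: rpoly_def f_def map_poly_map_poly o_def)
  have "map_poly complex_of_int F = Polynomial.monom 1 9 + Polynomial.monom (of_int a) 1 + [:of_int b:]"
    by (rule poly_eqI) (simp add: assms(2) coeff_map_poly coeff_pCons split: nat.splits)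
  hence rp: "rpoly f x = x ^ 9 + of_int a * x + of_int b" for x
    by (simp add: fF poly_monom)
  have A: "trinomial_roots (of_int a) (of_int b) = {x. rpoly f x = 0}"
    by (simp add: trinomial_roots_def rp)
  have ab: "a \<noteq> 0" "b \<noteq> 0" using assms(1) by auto
  have f: "Factorial_Ring.irreducible f" "rpoly f \<theta> = 0" using assms(3,4) fF[of \<theta>] by (simp_all add: f_def)
  have degf: "Polynomial.degree f = 9"
  proof (rule antisym)
    have co: "Polynomial.coeff f i = of_int (Polynomial.coeff F i)" for i by (simp add: f_def coeff_map_poly)
    show "Polynomial.degree f \<le> 9" by (rule degree_le) (auto simp: co assms(2) coeff_pCons split: nat.splits)
    show "9 \<le> Polynomial.degree f" by (rule le_degree) (simp add: co assms(2) coeff_pCons split: nat.splits)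
  qed
  have "8 ^ 8 * a ^ 9 + 9 ^ 9 * b ^ 8 \<noteq> 0"
  proof
    assume 0: "8 ^ 8 * a ^ 9 + 9 ^ 9 * b ^ 8 = 0"
    \<comment> \<open>Eliminating x^9 from F and x F' leaves the linear form 8ax + 9b, so a multiple
      root could only be this rational number, which an irreducible polynomial of degree 9 cannot
      have as a root.\<close>
    define q :: rat where "q = - (9 * of_int b) / (8 * of_int a)"
    define c :: complex where "c = of_rat q"
    have c: "8 * of_int a * c = - (9 * of_int b)"
      using ab by (simp add: c_def q_def of_rat_divide of_rat_minus of_rat_mult)
    have "(8 * of_int a) ^ 8 * (9 * c ^ 8 + of_int a) = 9 * (8 * of_int a * c) ^ 8 + (8 * of_int a) ^ 8 * of_int a"
      by (simp add: algebra_simps power_mult_distrib)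
    also have "\<dots> = of_int (8 ^ 8 * a ^ 9 + 9 ^ 9 * b ^ 8)"
      unfolding c by (simp add: power_mult_distrib flip: power_Suc2)
    finally have "(8 * of_int a) ^ 8 * (9 * c ^ 8 + of_int a) = 0" unfolding 0 by simp
    hence z: "9 * c ^ 8 + of_int a = 0" using ab by simp
    have eq: "9 * (c ^ 9 + of_int a * c + of_int b) = c * (9 * c ^ 8 + of_int a) + (8 * of_int a * c + 9 * of_int b)"
      by (simp add: algebra_simps flip: power_Suc)
    have "9 * (c ^ 9 + of_int a * c + of_int b) = 0" unfolding eq z c by simp
    hence "rpoly f c = 0" unfolding rp by (simp only: mult_eq_0_iff) simp
    moreover have "rpoly [:- q, 1:] c = 0" by (simp add: rpoly_pCons c_def of_rat_minus)
    ultimately have "f dvd [:- q, 1:]" by (intro irreducible_dvd_of_root[OF f(1)])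
    hence "Polynomial.degree f \<le> Polynomial.degree [:- q, 1:]" by (rule dvd_imp_degree_le) simp
    thus False by (simp add: degf)
  qed
  note disc = this
  obtain V where "p_valuation V p" using ex_p_valuation[OF assms(6)] by blast
  then interpret p_valuation V p .
  obtain P where P: "tame_on {x. rpoly f x = 0} (rpoly P)"
    using ex_tame_on_trinomial_roots[OF assms(7) ab disc] unfolding rat_fun_def A by blast
  have "\<not> p dvd field_index (rat_adjoin \<theta>)"
    using P by (intro field_index_not_dvd[OF f refl]) (auto simp: tame_on_def)
  thus ?thesis by (simp add: common_index_divisor_def assms(5))
qed

end
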